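(* Let $H\in(0,\frac12)$ and $T>0$, and let $b:[0,T]\times\mathbb{R}\to\mathbb{R}$ be Borel measurable such that (i) there is a constant $K>0$ with $|b(t,x)-b(t,y)|\le K|x-y|$ for all $x,y\in\mathbb{R}$, $t\in[0,T]$, and (ii) $t\mapsto b(t,0)$ is bounded on $[0,T]$. Let $P_Tf(x)=\mathbb{E}f(X_T^x)$, where $X^x$ is the solution of $dX_t=b(t,X_t)\,dt+dB_t^H$, $X_0=x$. Then $P_T$ is strong Feller (it maps bounded measurable functions on $\mathbb{R}$ to bounded continuous functions), and for all $x,y\in\mathbb{R}$ and every bounded measurable $f:\mathbb{R}\to\mathbb{R}$, $$|P_Tf(x)-P_Tf(y)|\le \|f\|_\infty\,[2C(T,K,H)]^{\frac12}\,|x-y|\,\exp\left[C(T,K,H)|x-y|^2\right],$$ where $$C(T,K,H)=\left(\frac{\mathrm{B}(\frac32-H,\frac12-H)}{\Gamma(\frac12-H)}\right)^2\frac{T^{2-2H}}{K^{-2}(1-e^{-2KT})^2(1-H)}.$$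
   Context: $\Gamma$ is the Gamma function, $\mathrm{B}(\cdot,\cdot)$ is the Euler Beta function, and $\|f\|_\infty=\sup_x|f(x)|$. $B^H=(B^H_t)_{t\in[0,T]}$ is a fractional Brownian motion with Hurst parameter $H$, with the normalization given by the integral representation $B^H_t=\int_0^tK_H(t,s)\,dW_s$, where $W$ is a standard one-dimensional Wiener process and, for $0<s<t\le T$, $$K_H(t,s)=\Gamma(H+\tfrac12)^{-1}(t-s)^{H-\frac12}F\left(H-\tfrac12,\tfrac12-H,H+\tfrac12,1-\tfrac ts\right),$$ $F$ being the Gauss hypergeometric function (analytically continued). Thus $B^H$ is a centered Gaussian process with covariance $\mathbb{E}(B^H_tB^H_s)=\int_0^{t\wedge s}K_H(t,r)K_H(s,r)\,dr$, which is proportional to $t^{2H}+s^{2H}-|t-s|^{2H}$. A solution $X^x$ of the equation is a continuous adapted process with $X^x_t=x+\int_0^tb(s,X^x_s)\,ds+B^H_t$ for $t\in[0,T]$; under the stated hypotheses on $b$ there is a unique (strong) solution. *)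

theory Defs
  imports
    "HOL-Probability.Probability"
    "HOL-Complex_Analysis.Complex_Analysis"
begin

section \<open>The Volterra kernel of fractional Brownian motion\<close>

text \<open>
  The Gauss hypergeometric function, analytically continued from the unit disc to the plane cut
  along the half-line from 1 to infinity. For \<open>c\<close> not a non-positive integer the
  continuation exists, and it is unique on the cut plane by the identity theorem, so the choice
  below is determined there.
\<close>

definition Gauss_hypergeo :: "complex \<Rightarrow> complex \<Rightarrow> complex \<Rightarrow> complex \<Rightarrow> complex" where
  "Gauss_hypergeo a b c = (SOME F.
     F holomorphic_on (- (of_real ` {1::real..})) \<and>
     (\<forall>z\<in>ball 0 1. F z = eval_fps (fps_hypergeo [a, b] [c] 1) z))"

text \<open>
  For real parameters and \<open>0 < s < t\<close> the argument \<open>1 - t / s\<close> is negative, hence off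
  the cut, and the value is real; \<^const>\<open>Re\<close> only converts the type. The kernel is set to 0
  outside the range \<open>0 < s < t\<close>.
\<close>

definition K_H :: "real \<Rightarrow> real \<Rightarrow> real \<Rightarrow> real" where
  "K_H H t s = (if 0 < s \<and> s < t then
     inverse (Gamma (H + 1 / 2)) * (t - s) powr (H - 1 / 2) *
     Re (Gauss_hypergeo (of_real (H - 1 / 2)) (of_real (1 / 2 - H)) (of_real (H + 1 / 2))
           (of_real (1 - t / s)))
   else 0)"


section \<open>Wiener process and Wiener integral\<close>

text \<open>Time is \<^typ>\<open>real\<close>; only the values of the processes and of the filtration on
  \<open>{0..T}\<close> matter.\<close>

definition filtered_prob_space :: "'w measure \<Rightarrow> (real \<Rightarrow> 'w measure) \<Rightarrow> bool" where
  "filtered_prob_space M \<F> \<longleftrightarrow>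
     prob_space M \<and> filtration (space M) \<F> \<and> (\<forall>t. subalgebra M (\<F> t))"

definition wiener_process ::
  "'w measure \<Rightarrow> (real \<Rightarrow> 'w measure) \<Rightarrow> real \<Rightarrow> (real \<Rightarrow> 'w \<Rightarrow> real) \<Rightarrow> bool" where
  "wiener_process M \<F> T W \<longleftrightarrow>
     (\<forall>t\<in>{0..T}. W t \<in> borel_measurable (\<F> t)) \<and>
     (AE \<omega> in M. W 0 \<omega> = 0) \<and>
     (AE \<omega> in M. continuous_on {0..T} (\<lambda>t. W t \<omega>)) \<and>
     (\<forall>s t. 0 \<le> s \<and> s < t \<and> t \<le> T \<longrightarrow>
        distributed M lborel (\<lambda>\<omega>. W t \<omega> - W s \<omega>) (normal_density 0 (sqrt (t - s))) \<and>
        prob_space.indep_set M (sets (\<F> s))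
          (sets (vimage_algebra (space M) (\<lambda>\<omega>. W t \<omega> - W s \<omega>) borel)))"

text \<open>
  A step function with \<open>n\<close> steps is encoded by its partition points
  \<open>\<tau> 0 \<le> \<dots> \<le> \<tau> n\<close> and its values \<open>c 0, \<dots>, c (n - 1)\<close>.
\<close>

definition step_fun :: "nat \<Rightarrow> (nat \<Rightarrow> real) \<Rightarrow> (nat \<Rightarrow> real) \<Rightarrow> real \<Rightarrow> real" where
  "step_fun n \<tau> c s = (\<Sum>i<n. c i * indicator {\<tau> i<..\<tau> (Suc i)} s)"

definition step_integral ::
  "(real \<Rightarrow> 'w \<Rightarrow> real) \<Rightarrow> nat \<Rightarrow> (nat \<Rightarrow> real) \<Rightarrow> (nat \<Rightarrow> real) \<Rightarrow> 'w \<Rightarrow> real" where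
  "step_integral W n \<tau> c \<omega> = (\<Sum>i<n. c i * (W (\<tau> (Suc i)) \<omega> - W (\<tau> i) \<omega>))"

text \<open>
  \<open>Y\<close> is (a version of) the integral of the deterministic function \<open>f\<close> over
  \<open>{0..t}\<close> with respect to \<open>W\<close>: the \<open>L\<^sup>2\<close> limit of the integrals of step functions
  converging to \<open>f\<close> in \<open>L\<^sup>2\<close>. By the isometry property of the integral the limit does not depend, up to
  null sets, on the approximating sequence.
\<close>

definition has_wiener_integral ::
  "'w measure \<Rightarrow> (real \<Rightarrow> 'w \<Rightarrow> real) \<Rightarrow> real \<Rightarrow> (real \<Rightarrow> real) \<Rightarrow> ('w \<Rightarrow> real) \<Rightarrow> bool" where
  "has_wiener_integral M W t f Y \<longleftrightarrow>
     set_borel_measurable lborel {0..t} f \<and> Y \<in> borel_measurable M \<and>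
     (\<exists>n \<tau> c.
        (\<forall>k. \<forall>i\<le>n k. \<tau> k i \<in> {0..t}) \<and>
        (\<forall>k. \<forall>i<n k. \<tau> k i \<le> \<tau> k (Suc i)) \<and>
        (\<lambda>k. \<integral>\<^sup>+s\<in>{0..t}. ennreal ((f s - step_fun (n k) (\<tau> k) (c k) s)\<^sup>2) \<partial>lborel) \<longlonglongrightarrow> 0 \<and>
        (\<lambda>k. \<integral>\<^sup>+\<omega>. ennreal ((Y \<omega> - step_integral W (n k) (\<tau> k) (c k) \<omega>)\<^sup>2) \<partial>M) \<longlonglongrightarrow> 0)"

definition fractional_brownian_motion ::
  "'w measure \<Rightarrow> real \<Rightarrow> real \<Rightarrow> (real \<Rightarrow> 'w \<Rightarrow> real) \<Rightarrow> (real \<Rightarrow> 'w \<Rightarrow> real) \<Rightarrow> bool" where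
  "fractional_brownian_motion M H T W B \<longleftrightarrow>
     (\<forall>t\<in>{0..T}. has_wiener_integral M W t (K_H H t) (B t)) \<and>
     (AE \<omega> in M. continuous_on {0..T} (\<lambda>t. B t \<omega>))"


section \<open>The equation and its transition operator\<close>

definition is_solution ::
  "'w measure \<Rightarrow> (real \<Rightarrow> 'w measure) \<Rightarrow> real \<Rightarrow> (real \<Rightarrow> real \<Rightarrow> real) \<Rightarrow> (real \<Rightarrow> 'w \<Rightarrow> real) \<Rightarrow>
   real \<Rightarrow> (real \<Rightarrow> 'w \<Rightarrow> real) \<Rightarrow> bool" where
  "is_solution M \<F> T b B x X \<longleftrightarrow>
     (\<forall>t\<in>{0..T}. X t \<in> borel_measurable (\<F> t)) \<and>
     (AE \<omega> in M. continuous_on {0..T} (\<lambda>t. X t \<omega>)) \<and>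
     (AE \<omega> in M. \<forall>t\<in>{0..T}.
        set_integrable lborel {0..t} (\<lambda>s. b s (X s \<omega>)) \<and>
        X t \<omega> = x + (LINT s:{0..t}|lborel. b s (X s \<omega>)) + B t \<omega>)"

text \<open>\<open>X x\<close> is the solution started at \<open>x\<close>.\<close>

definition transition_op ::
  "'w measure \<Rightarrow> (real \<Rightarrow> real \<Rightarrow> 'w \<Rightarrow> real) \<Rightarrow> real \<Rightarrow> (real \<Rightarrow> real) \<Rightarrow> real \<Rightarrow> real" where
  "transition_op M X T f x = (\<integral>\<omega>. f (X x T \<omega>) \<partial>M)"

definition strong_Feller :: "((real \<Rightarrow> real) \<Rightarrow> real \<Rightarrow> real) \<Rightarrow> bool" where
  "strong_Feller P \<longleftrightarrow>
     (\<forall>f. f \<in> borel_measurable borel \<and> bounded (range f) \<longrightarrow>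
          bounded (range (P f)) \<and> continuous_on UNIV (P f))"

definition sup_norm :: "(real \<Rightarrow> real) \<Rightarrow> real" where
  "sup_norm f = (SUP x. \<bar>f x\<bar>)"

definition Harnack_const :: "real \<Rightarrow> real \<Rightarrow> real \<Rightarrow> real" where
  "Harnack_const T K H =
     (Beta (3 / 2 - H) (1 / 2 - H) / Gamma (1 / 2 - H))\<^sup>2 *
     (T powr (2 - 2 * H) / (K powr (- 2) * (1 - exp (- 2 * K * T))\<^sup>2 * (1 - H)))"

end

theory Submission
  imports Defs
begin

text \<open>
  Why the estimate holds. Write \<open>p = 1/2 - H\<close> and \<open>d = x - y\<close>. Let \<open>X\<close> be the solution started at \<open>y\<close> and
  put \<open>Y t = X t + g t\<close>, where \<open>g\<close> is the deterministic function \<open>d * sinh (K (T - t)) / sinh (K T)\<close>,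
  which runs from \<open>d\<close> to \<open>0\<close>. Then \<open>Y\<close> solves the same equation, started at \<open>x\<close> and driven by the noise
  \<open>B + \<integral>\<eta>\<close> with \<open>\<eta> t = g' t + b t (X t) - b t (X t + g t)\<close>. The Lipschitz condition bounds
  \<open>\<bar>\<eta>\<bar>\<close> by \<open>\<bar>g'\<bar> + K \<bar>g\<bar>\<close>, hence by \<open>N = 2 K \<bar>d\<bar> / (1 - exp (-2 K T))\<close>, whatever the path of \<open>X\<close>. Since
  \<open>Y T = X T\<close>, the two laws at time \<open>T\<close> differ only by the effect of the adapted shift \<open>\<integral>\<eta>\<close> of the noise.

  On the level of the Wiener process this shift is \<open>W \<mapsto> W + \<integral>u\<close> with
  \<open>u s = s powr (-p) / Gamma p * \<integral> q powr p * (s - q) powr (p - 1) * \<eta> q\<close> (integral over \<open>0 < q < s\<close>), because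
  \<open>\<integral>K_H t s * u s = \<integral>\<eta>\<close> over \<open>{0..t}\<close>. The bound on \<open>\<eta>\<close> gives \<open>\<integral>u\<^sup>2 \<le> A\<close> with
  \<open>A = 2 * Harnack_const * d\<^sup>2\<close>. The Girsanov density \<open>R\<close> of the shift has \<open>E R = 1\<close> and \<open>E R\<^sup>2 \<le> exp A\<close>, so the two
  expectations of \<open>f\<close> differ by at most \<open>\<parallel>f\<parallel> * E \<bar>R - 1\<bar> \<le> \<parallel>f\<parallel> * sqrt (exp A - 1)\<close>, and \<open>exp A - 1 \<le> A * exp A\<close>.

  Stochastic integration is avoided by discretizing twice. In time, the equation is replaced by an Euler
  scheme whose drift is averaged over the cells of a uniform grid (the drift is only measurable in time); the
  coupling by \<open>g\<close> works for the scheme with the same constant (\<open>coupled_euler\<close>, \<open>coupling_drift_bound\<close>). In the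
  noise, the finitely many Wiener integrals \<open>B (grid n i)\<close> that enter the scheme are replaced by
  integrals of step functions, so only finitely many independent Gaussian increments of \<open>W\<close>
  remain. For those the Girsanov theorem is an induction over the increments
  (\<open>girsanov\<close>, \<open>shift_total_variation\<close>). Refining the step functions (\<open>noise_coupling\<close>) and then the
  grid (\<open>solution_coupling\<close>) gives the estimate for bounded Lipschitz \<open>f\<close> with a bound that does not
  involve the Lipschitz constant, and inner regularity extends it to bounded measurable \<open>f\<close>
  (\<open>bounded_Lipschitz_imp_total_variation\<close>).
\<close>

section \<open>Euler's integral for the hypergeometric function\<close>

definition beta_weight :: "real \<Rightarrow> real \<Rightarrow> real \<Rightarrow> real" where
  "beta_weight p q x = indicator {0<..<1} x * (x powr (p - 1) * (1 - x) powr (q - 1))"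

lemma beta_weight_nonneg: "0 \<le> beta_weight p q x"
  by (simp add: beta_weight_def)

lemma beta_weight_measurable [measurable]: "beta_weight p q \<in> borel_measurable borel"
  unfolding beta_weight_def by measurable

lemma has_bochner_integral_beta_weight:
  assumes "p > 0" "q > 0"
  shows "has_bochner_integral lborel (beta_weight p q) (Beta p q)"
proof -
  let ?f = "\<lambda>x::real. x powr (p - 1) * (1 - x) powr (q - 1)"
  have "set_integrable lborel {0..1} ?f" by (rule integrable_Beta[OF assms])
  hence i: "integrable lborel (\<lambda>x. indicator {0..1} x *\<^sub>R ?f x)" by (simp add: set_integrable_def)
  have "integral {0..1} ?f = Beta p q" using has_integral_Beta_real[OF assms] by (rule integral_unique)
  moreover have "set_lebesgue_integral lborel {0..1} ?f = integral {0..1} ?f"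
    by (rule set_borel_integral_eq_integral[OF integrable_Beta[OF assms]])
  ultimately have e: "has_bochner_integral lborel (\<lambda>x. indicator {0..1} x *\<^sub>R ?f x) (Beta p q)"
    using i by (simp add: has_bochner_integral_iff set_lebesgue_integral_def)
  show ?thesis
  proof (rule has_bochner_integral_cong[THEN iffD1, OF refl _ refl e])
    fix x :: real
    show "indicator {0..1} x *\<^sub>R ?f x = beta_weight p q x"
      by (cases "x = 0 \<or> x = 1") (auto simp: beta_weight_def indicator_def)
  qed
qed

lemma beta_weight_power:
  "beta_weight p q x * x ^ n = beta_weight (p + real n) q x"
  by (auto simp: beta_weight_def indicator_def powr_add[symmetric] powr_realpow[symmetric] algebra_simps)

lemma integrable_beta_weight: "p > 0 \<Longrightarrow> q > 0 \<Longrightarrow> integrable lborel (beta_weight p q)"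
  using has_bochner_integral_beta_weight by (auto simp: has_bochner_integral_iff)

lemma gbinomial_series_abs_summable:
  fixes z :: complex
  assumes "norm z < 1"
  shows "summable (\<lambda>n. norm ((a gchoose n) * z ^ n))"
proof -
  obtain r where r: "norm z < r" "r < 1" using assms dense by blast
  hence "norm (complex_of_real r) < 1" using norm_ge_zero[of z] by (simp del: norm_ge_zero)
  hence "summable (\<lambda>n. (a gchoose n) * complex_of_real r ^ n)"
    using gen_binomial_complex sums_summable by blast
  thus ?thesis
    by (rule powser_insidea) (use r norm_ge_zero[of z] in \<open>simp del: norm_ge_zero\<close>)
qed

text \<open>
  Up to the factor \<open>Beta p q\<close>, Euler's integral for the hypergeometric function with parameters
  \<open>a\<close>, \<open>p\<close> and \<open>p + q\<close>. Its integrand makes sense for all \<open>z\<close> off the cut.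
\<close>

definition Euler_integral :: "real \<Rightarrow> real \<Rightarrow> real \<Rightarrow> complex \<Rightarrow> complex" where
  "Euler_integral a p q z =
     (LINT x|lborel. of_real (beta_weight p q x) * (1 - z * of_real x) powr (- of_real a))"

text \<open>
  Expand the power by the binomial series and integrate term by term: the moments of the weight are Beta values,
  whose quotients are the Pochhammer quotients of the hypergeometric coefficients.
\<close>

lemma Euler_integral_series:
  assumes pq: "p > 0" "q > 0" and z: "norm z < 1"
  shows "(\<lambda>n. fps_nth (fps_hypergeo [of_real a, of_real p] [of_real (p + q)] 1) n * z ^ n)
           sums (Euler_integral a p q z / of_real (Beta p q))"
proof -
  let ?c = "\<lambda>n. (- complex_of_real a gchoose n) * (- z) ^ n"
  define f where "f n x = complex_of_real (beta_weight p q x) * ((- of_real a gchoose n) * (- z * of_real x) ^ n)"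
    for n and x :: real
  have f_alt: "f n x = ?c n * complex_of_real (beta_weight (p + real n) q x)" for n x
    unfolding beta_weight_power[symmetric] f_def power_mult_distrib by simp
  have norm_f: "norm (f n x) = norm (?c n) * beta_weight (p + real n) q x" for n x
    by (simp add: f_alt norm_mult beta_weight_nonneg)
  have mom: "has_bochner_integral lborel (beta_weight (p + real n) q) (Beta (p + real n) q)" for n
    by (rule has_bochner_integral_beta_weight) (use pq in auto)
  have int: "integrable lborel (f n)" for n
    unfolding f_alt[abs_def] using mom[of n] by (auto simp: has_bochner_integral_iff)
  have If: "integral\<^sup>L lborel (f n) = ?c n * of_real (Beta (p + real n) q)" for n
    unfolding f_alt[abs_def] using mom[of n] by (auto simp: has_bochner_integral_iff)
  have small: "norm (- z * of_real x) < 1" if "x \<in> {0<..<1}" for x :: real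
    using that z by (simp add: norm_mult) (metis less_eq_real_def mult_left_le norm_ge_zero order_le_less_trans)
  have sum1: "summable (\<lambda>n. norm (f n x))" for x
  proof (cases "x \<in> {0<..<1}")
    case True
    have "summable (\<lambda>n. norm (complex_of_real (beta_weight p q x)) * norm ((- of_real a gchoose n) * (- z * of_real x) ^ n))"
      by (intro summable_mult gbinomial_series_abs_summable small True)
    thus ?thesis by (simp add: f_def norm_mult)
  next
    case False thus ?thesis by (simp add: f_def beta_weight_def)
  qed
  have sum2: "summable (\<lambda>n. LINT x|lborel. norm (f n x))"
  proof (rule summable_comparison_test')
    show "summable (\<lambda>n. norm (?c n) * Beta p q)"
      by (intro summable_mult2 gbinomial_series_abs_summable) (use z in simp)
    fix n :: nat
    have "(LINT x|lborel. norm (f n x)) = norm (?c n) * Beta (p + real n) q"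
      unfolding norm_f using mom[of n] by (auto simp: has_bochner_integral_iff)
    moreover have "Beta (p + real n) q \<le> Beta p q"
    proof -
      have "integral\<^sup>L lborel (beta_weight (p + real n) q) \<le> integral\<^sup>L lborel (beta_weight p q)"
      proof (rule integral_mono)
        show "integrable lborel (beta_weight (p + real n) q)" "integrable lborel (beta_weight p q)"
          using pq by (auto intro!: integrable_beta_weight)
        show "beta_weight (p + real n) q x \<le> beta_weight p q x" for x
          unfolding beta_weight_power[symmetric]
          by (cases "x \<in> {0<..<1}") (auto intro!: mult_left_le power_le_one beta_weight_nonneg simp: beta_weight_def)
      qed
      thus ?thesis using mom[of n] mom[of 0] by (auto simp: has_bochner_integral_iff)
    qed
    moreover have "Beta (p + real n) q \<ge> 0" using pq by (simp add: Beta_def)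
    ultimately show "norm (LINT x|lborel. norm (f n x)) \<le> norm (?c n) * Beta p q"
      by (simp add: abs_mult mult_left_mono)
  qed
  have pt: "(\<Sum>n. f n x) = of_real (beta_weight p q x) * (1 - z * of_real x) powr (- of_real a)" for x
  proof (cases "x \<in> {0<..<1}")
    case True
    from gen_binomial_complex[OF small[OF True], of "- of_real a"]
    have "(\<lambda>n. f n x) sums (of_real (beta_weight p q x) * (1 + - z * of_real x) powr (- of_real a))"
      unfolding f_def by (rule sums_mult)
    thus ?thesis by (simp add: sums_iff)
  next
    case False thus ?thesis by (simp add: f_def beta_weight_def)
  qed
  have "(\<lambda>n. integral\<^sup>L lborel (f n)) sums (LINT x|lborel. (\<Sum>n. f n x))"
    by (rule sums_integral[OF int _ sum2]) (use sum1 in auto)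
  hence "(\<lambda>n. ?c n * of_real (Beta (p + real n) q)) sums Euler_integral a p q z"
    by (simp add: If pt Euler_integral_def)
  hence "(\<lambda>n. ?c n * of_real (Beta (p + real n) q) / of_real (Beta p q))
     sums (Euler_integral a p q z / of_real (Beta p q))" by (rule sums_divide)
  moreover have "?c n * of_real (Beta (p + real n) q) / of_real (Beta p q)
     = fps_nth (fps_hypergeo [of_real a, of_real p] [of_real (p + q)] 1) n * z ^ n" for n
  proof -
    have B: "Beta (p + real n) q / Beta p q = pochhammer p n / pochhammer (p + q) n"
      using pq unfolding Beta_def
      by (simp add: pochhammer_Gamma Gamma_eq_zero_iff nonpos_Ints_def field_simps)
        (auto simp: add_ac dest!: Gamma_eq_zero_iff[THEN iffD1] elim!: nonpos_Ints_cases)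
    have "of_real (Beta (p + real n) q) / complex_of_real (Beta p q) = of_real (pochhammer p n / pochhammer (p + q) n)"
      unfolding B[symmetric] by simp
    hence "?c n * of_real (Beta (p + real n) q) / complex_of_real (Beta p q)
      = ?c n * of_real (pochhammer p n / pochhammer (p + q) n)"
      by (metis times_divide_eq_right)
    also have "\<dots> = pochhammer (of_real a) n / fact n * z ^ n * of_real (pochhammer p n / pochhammer (p + q) n)"
      unfolding gbinomial_pochhammer by (simp add: power_minus[of z] mult_ac)
    also have "\<dots> = fps_nth (fps_hypergeo [of_real a, of_real p] [of_real (p + q)] 1) n * z ^ n"
      by (simp add: pochhammer_of_real[symmetric] mult_ac)
    finally show ?thesis .
  qed
  ultimately show ?thesis by simp
qed

abbreviation cut_plane :: "complex set" where "cut_plane \<equiv> - (of_real ` {1::real..})"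

lemma open_cut_plane: "open cut_plane"
proof -
  have "of_real ` {1::real..} = {z. Im z = 0} \<inter> {z. Re z \<ge> 1}"
    by (auto simp: image_iff complex_eq_iff intro!: bexI[of _ "Re _"])
  also have "closed \<dots>" by (intro closed_Int closed_Collect_eq closed_Collect_le continuous_intros)
  finally show ?thesis by (simp add: open_closed)
qed

lemma cut_plane_one_minus:
  assumes z: "z \<in> cut_plane" and x: "x \<in> {0..1}"
  shows "1 - z * of_real x \<notin> \<real>\<^sub>\<le>\<^sub>0"
proof
  assume "1 - z * of_real x \<in> \<real>\<^sub>\<le>\<^sub>0"
  then obtain r where r: "r \<le> 0" "1 - z * of_real x = of_real r" by (elim nonpos_Reals_cases) auto
  hence eq: "z * of_real x = of_real (1 - r)" by (simp add: algebra_simps)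
  with r have "x \<noteq> 0" by (auto simp del: of_real_diff simp: of_real_eq_0_iff)
  hence "z = of_real ((1 - r) / x)" using eq by (simp add: field_simps)
  moreover have "(1 - r) / x \<ge> 1" using x r \<open>x \<noteq> 0\<close> by (simp add: field_simps)
  ultimately show False using z by (metis ComplD atLeast_iff imageI)
qed

lemma connected_cut_plane: "connected cut_plane"
proof -
  have "starlike cut_plane"
    unfolding starlike_def
  proof (intro bexI ballI subsetI)
    show "(0::complex) \<in> cut_plane" by auto
    fix z w assume z: "z \<in> cut_plane" and "w \<in> closed_segment 0 z"
    then obtain u where u: "0 \<le> u" "u \<le> 1" "w = z * of_real u"
      by (auto simp: in_segment scaleR_conv_of_real)
    show "w \<in> cut_plane"
    proof
      assume "w \<in> of_real ` {1::real..}"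
      then obtain r where "r \<ge> 1" "w = of_real r" by auto
      hence "1 - z * of_real u = of_real (1 - r)" using u by simp
      moreover have "complex_of_real (1 - r) \<in> \<real>\<^sub>\<le>\<^sub>0" using \<open>r \<ge> 1\<close> unfolding nonpos_Reals_of_real_iff by simp
      ultimately show False using cut_plane_one_minus[OF z, of u] u by simp
    qed
  qed
  thus ?thesis using starlike_imp_connected by blast
qed

lemma continuous_on_powr_slit_plane:
  fixes f :: "'a::topological_space \<Rightarrow> complex"
  assumes "continuous_on A f" and *: "\<And>w. w \<in> A \<Longrightarrow> f w \<notin> \<real>\<^sub>\<le>\<^sub>0"
  shows "continuous_on A (\<lambda>w. f w powr c)"
proof (rule continuous_on_powr_complex)
  show "A \<subseteq> {w. 0 \<le> Re (f w) \<or> Im (f w) \<noteq> 0}"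
    using * linear unfolding complex_nonpos_Reals_iff mem_Collect_eq subset_iff by blast
  show "0 < Re c" if "w \<in> A" "f w = 0" for w
    using *[of w] that nonpos_Reals_zero_I by metis
qed (use assms in auto)

text \<open>
  Differentiation under the integral sign. On a closed disc inside the cut plane the difference quotients
  of the integrand are bounded uniformly in \<open>x\<close>, so dominated convergence applies although the weight is singular at
  both end points.
\<close>

lemma Euler_integral_holomorphic:
  assumes pq: "p > 0" "q > 0"
  shows "Euler_integral a p q holomorphic_on cut_plane"
proof (unfold holomorphic_on_def, intro ballI)
  let ?w = "\<lambda>x. complex_of_real (beta_weight p q x)"
  fix z0 assume z0: "z0 \<in> cut_plane"
  obtain r where r: "r > 0" "cball z0 r \<subseteq> cut_plane"
    using open_cut_plane z0 open_contains_cball by blast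
  define h where "h x z = (1 - z * complex_of_real x) powr (- of_real a)" for x z
  define h' where "h' x z = of_real a * of_real x * (1 - z * complex_of_real x) powr (- of_real a - 1)" for x z
  have der: "(h x has_field_derivative h' x z) (at z within S)" if "z \<in> cball z0 r" "x \<in> {0..1}" for x z S
    unfolding h_def h'_def
    by (rule derivative_eq_intros refl | use cut_plane_one_minus[of z x] that r in force)+
  have "compact (cball z0 r \<times> {0..1::real})" by (intro compact_Times) auto
  moreover have "continuous_on (cball z0 r \<times> {0..1::real}) (\<lambda>(z,x). h' x z)"
    unfolding h'_def case_prod_beta
    by (intro continuous_intros continuous_on_powr_slit_plane cut_plane_one_minus) (use r in auto)
  ultimately have "bounded ((\<lambda>(z,x). h' x z) ` (cball z0 r \<times> {0..1}))"
    by (intro compact_imp_bounded compact_continuous_image)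
  then obtain C where C: "\<And>z x. z \<in> cball z0 r \<Longrightarrow> x \<in> {0..1} \<Longrightarrow> norm (h' x z) \<le> C"
    unfolding bounded_iff by fastforce
  have lip: "norm (h x z - h x z0) \<le> C * norm (z - z0)" if "z \<in> cball z0 r" "x \<in> {0..1}" for z x
    by (rule field_differentiable_bound[where S="cball z0 r" and f'="h' x"])
      (use that r der C in auto)
  have hmeas [measurable]: "(\<lambda>x. h x z) \<in> borel_measurable borel" for z
    unfolding h_def by measurable
  have hint: "integrable lborel (\<lambda>x. ?w x * h x z)" if z: "z \<in> cut_plane" for z
  proof -
    have "continuous_on {0..1} (\<lambda>x. h x z)" unfolding h_def
      by (intro continuous_intros continuous_on_powr_slit_plane cut_plane_one_minus z)
    hence "bounded ((\<lambda>x. h x z) ` {0..1})"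
      by (intro compact_imp_bounded compact_continuous_image) auto
    then obtain B where "\<forall>y\<in>(\<lambda>x. h x z) ` {0..1}. norm y \<le> B" unfolding bounded_iff ..
    hence B: "norm (h x z) \<le> B" if "x \<in> {0..1}" for x using that by blast
    show ?thesis
    proof (rule Bochner_Integration.integrable_bound)
      show "integrable lborel (\<lambda>x. B * beta_weight p q x)" using integrable_beta_weight[OF pq] by auto
      have "norm (?w x * h x z) \<le> norm (B * beta_weight p q x)" for x
      proof (cases "x \<in> {0<..<1}")
        case True
        have "norm (h x z) * beta_weight p q x \<le> \<bar>B\<bar> * beta_weight p q x"
          using B[of x] True beta_weight_nonneg[of p q x] by (intro mult_right_mono) auto
        thus ?thesis using beta_weight_nonneg[of p q x] by (simp add: norm_mult abs_mult mult.commute)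
      qed (simp add: beta_weight_def)
      thus "AE x in lborel. norm (?w x * h x z) \<le> norm (B * beta_weight p q x)" by simp
    qed measurable
  qed
  have E: "Euler_integral a p q z = (LINT x|lborel. ?w x * h x z)" for z
    by (simp add: Euler_integral_def h_def)
  have "((\<lambda>z. (Euler_integral a p q z - Euler_integral a p q z0) / (z - z0)) \<longlongrightarrow>
      (LINT x|lborel. ?w x * h' x z0)) (at z0 within cball z0 r)"
    unfolding tendsto_at_iff_sequentially
  proof (intro allI impI)
    fix Z assume Z: "\<forall>i. Z i \<in> cball z0 r - {z0}" and lim: "Z \<longlonglongrightarrow> z0"
    let ?Q = "\<lambda>i x. (h x (Z i) - h x z0) / (Z i - z0)"
    have "(\<lambda>i. LINT x|lborel. ?w x * ?Q i x) \<longlonglongrightarrow>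
      (LINT x|lborel. ?w x * h' x z0)"
    proof (rule integral_dominated_convergence)
      show "integrable lborel (\<lambda>x. C * beta_weight p q x)" using integrable_beta_weight[OF pq] by auto
      show "(\<lambda>x. ?w x * h' x z0) \<in> borel_measurable lborel"
        unfolding h'_def by measurable
      show "(\<lambda>x. ?w x * ?Q i x) \<in> borel_measurable lborel" for i
        by measurable
      have "(\<lambda>i. ?w x * ?Q i x)
          \<longlonglongrightarrow> ?w x * h' x z0" for x
      proof (cases "x \<in> {0<..<1}")
        case True
        have "(h x has_field_derivative h' x z0) (at z0)" by (rule der) (use True r in auto)
        hence "((\<lambda>z. (h x z - h x z0) / (z - z0)) \<longlongrightarrow> h' x z0) (at z0)" by (simp add: has_field_derivative_iff)
        hence "((\<lambda>z. (h x z - h x z0) / (z - z0)) \<circ> Z) \<longlonglongrightarrow> h' x z0"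
          unfolding tendsto_at_iff_sequentially using Z lim by auto
        thus ?thesis by (intro tendsto_intros) (simp add: o_def)
      qed (simp add: beta_weight_def)
      thus "AE x in lborel. (\<lambda>i. ?w x * ?Q i x)
          \<longlonglongrightarrow> ?w x * h' x z0" by simp
      have "norm (?w x * ?Q i x) \<le> C * beta_weight p q x" for i x
      proof (cases "x \<in> {0<..<1}")
        case True
        have "norm (h x (Z i) - h x z0) \<le> C * norm (Z i - z0)" by (rule lip) (use Z True in auto)
        moreover have "norm (Z i - z0) > 0" using Z by auto
        ultimately have "norm (?Q i x) \<le> C"
          by (simp add: norm_divide field_simps)
        hence "norm (?Q i x) * beta_weight p q x \<le> C * beta_weight p q x"
          by (intro mult_right_mono beta_weight_nonneg)
        thus ?thesis by (simp add: norm_mult beta_weight_nonneg mult.commute del: times_divide_eq_right)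
      qed (simp add: beta_weight_def)
      thus "AE x in lborel. norm (?w x * ?Q i x) \<le> C * beta_weight p q x" for i by simp
    qed
    moreover have "(LINT x|lborel. ?w x * ?Q i x)
       = (Euler_integral a p q (Z i) - Euler_integral a p q z0) / (Z i - z0)" for i
    proof -
      have zi: "Z i \<in> cut_plane" using Z r by blast
      have "(Euler_integral a p q (Z i) - Euler_integral a p q z0) / (Z i - z0)
        = (LINT x|lborel. (?w x * h x (Z i) - ?w x * h x z0)) / (Z i - z0)"
        unfolding E using hint[OF zi] hint[OF z0] by simp
      also have "\<dots> = (LINT x|lborel. (?w x * h x (Z i) - ?w x * h x z0) / (Z i - z0))"
        by simp
      finally show ?thesis by (simp only: right_diff_distrib times_divide_eq_right)
    qed
    ultimately show "((\<lambda>z. (Euler_integral a p q z - Euler_integral a p q z0) / (z - z0)) \<circ> Z) \<longlonglongrightarrow>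
      (LINT x|lborel. ?w x * h' x z0)" by (simp only: o_def)
  qed
  hence "(Euler_integral a p q has_field_derivative (LINT x|lborel. ?w x * h' x z0)) (at z0 within cball z0 r)"
    by (simp add: has_field_derivative_iff)
  moreover have "at z0 within cball z0 r = at z0"
    by (rule at_within_interior) (use r in \<open>simp add: interior_cball\<close>)
  ultimately show "Euler_integral a p q field_differentiable at z0 within cut_plane"
    using field_differentiable_at_within field_differentiable_def by metis
qed

text \<open>
  Euler's integral is one continuation of the series, so the choice in \<^const>\<open>Gauss_hypergeo\<close> has a
  witness; the identity theorem on the connected cut plane then identifies the chosen function with it.
\<close>

lemma Gauss_hypergeo_eq_Euler_integral:
  assumes pq: "p > 0" "q > 0" and z: "z \<in> cut_plane"
  shows "Gauss_hypergeo (of_real a) (of_real p) (of_real (p + q)) z = Euler_integral a p q z / of_real (Beta p q)"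
proof -
  let ?P = "\<lambda>F. F holomorphic_on cut_plane \<and>
     (\<forall>z\<in>ball 0 1. F z = eval_fps (fps_hypergeo [of_real a, of_real p] [of_real (p + q)] 1) z)"
  have nz: "Beta p q \<noteq> 0" using pq by (auto simp: Beta_def Gamma_eq_zero_iff elim!: nonpos_Ints_cases)
  have 1: "?P (\<lambda>z. Euler_integral a p q z / of_real (Beta p q))"
  proof (intro conjI ballI)
    show "(\<lambda>z. Euler_integral a p q z / of_real (Beta p q)) holomorphic_on cut_plane"
      by (intro holomorphic_intros Euler_integral_holomorphic pq) (use nz in auto)
    fix z :: complex assume "z \<in> ball 0 1"
    thus "Euler_integral a p q z / of_real (Beta p q) = eval_fps (fps_hypergeo [of_real a, of_real p] [of_real (p + q)] 1) z"
      using Euler_integral_series[OF pq, of z a] by (simp add: eval_fps_def sums_iff)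
  qed
  have 2: "?P (Gauss_hypergeo (of_real a) (of_real p) (of_real (p + q)))"
    unfolding Gauss_hypergeo_def by (rule someI[where P="?P", OF 1])
  show ?thesis
  proof (rule analytic_continuation_open[where s="ball 0 1" and s'=cut_plane and
        f="Gauss_hypergeo (of_real a) (of_real p) (of_real (p + q))" and
        g="\<lambda>z. Euler_integral a p q z / of_real (Beta p q)"])
    show "(ball 0 1 :: complex set) \<subseteq> cut_plane" by (auto simp: dist_norm)
    show "ball (0::complex) 1 \<noteq> {}" by simp
    show "Gauss_hypergeo (of_real a) (of_real p) (of_real (p + q)) holomorphic_on cut_plane"
      using 2 by blast
    show "(\<lambda>z. Euler_integral a p q z / of_real (Beta p q)) holomorphic_on cut_plane" using 1 by blast
    show "Gauss_hypergeo (of_real a) (of_real p) (of_real (p + q)) z = Euler_integral a p q z / of_real (Beta p q)"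
      if "z \<in> ball 0 1" for z using 1 2 that by simp
  qed (use open_cut_plane connected_cut_plane z in auto)
qed

section \<open>The kernel of fractional Brownian motion as a fractional integral\<close>

lemma nn_integral_beta_weight:
  assumes "p > 0" "q > 0"
  shows "(\<integral>\<^sup>+x. ennreal (beta_weight p q x) \<partial>lborel) = ennreal (Beta p q)"
  using has_bochner_integral_beta_weight[OF assms]
  by (subst nn_integral_eq_integral) (auto simp: has_bochner_integral_iff beta_weight_nonneg)

lemma nn_integral_affine_unit_interval:
  fixes u v :: real
  assumes uv: "u < v" and [measurable]: "f \<in> borel_measurable borel"
  shows "(\<integral>\<^sup>+r. indicator {u<..<v} r * f r \<partial>lborel)
           = (\<integral>\<^sup>+x. indicator {0<..<1} x * (ennreal (v - u) * f (u + (v - u) * x)) \<partial>lborel)"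
proof -
  have iff: "u + (v - u) * x \<in> {u<..<v} \<longleftrightarrow> x \<in> {0<..<1}" for x
  proof -
    have "u + (v - u) * x < v \<longleftrightarrow> (v - u) * x < (v - u) * 1" by (simp add: less_diff_eq add.commute)
    also have "\<dots> \<longleftrightarrow> x < 1" using uv by (subst mult_less_cancel_left_pos) auto
    finally show ?thesis using uv by (auto simp: zero_less_mult_iff)
  qed
  have "(\<integral>\<^sup>+r. indicator {u<..<v} r * f r \<partial>lborel)
     = ennreal (v - u) * (\<integral>\<^sup>+x. indicator {u<..<v} (u + (v - u) * x) * f (u + (v - u) * x) \<partial>lborel)"
    using uv by (subst nn_integral_real_affine[where c="v - u" and t=u]) auto
  also have "\<dots> = (\<integral>\<^sup>+x. ennreal (v - u) * (indicator {u<..<v} (u + (v - u) * x) * f (u + (v - u) * x)) \<partial>lborel)"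
    by (subst nn_integral_cmult) auto
  also have "\<dots> = (\<integral>\<^sup>+x. indicator {0<..<1} x * (ennreal (v - u) * f (u + (v - u) * x)) \<partial>lborel)"
    by (simp only: indicator_def iff mult.left_commute)
  finally show ?thesis .
qed

lemma nn_integral_Beta_interval:
  fixes u v :: real
  assumes pq: "p > 0" "q > 0" and uv: "u < v"
  shows "(\<integral>\<^sup>+r. indicator {u<..<v} r * ennreal ((r - u) powr (p - 1) * (v - r) powr (q - 1)) \<partial>lborel)
           = ennreal (Beta p q * (v - u) powr (p + q - 1))"
proof -
  let ?f = "\<lambda>r. ennreal ((r - u) powr (p - 1) * (v - r) powr (q - 1))"
  have "(\<integral>\<^sup>+r. indicator {u<..<v} r * ?f r \<partial>lborel) = (\<integral>\<^sup>+x. indicator {0<..<1} x * (ennreal (v - u) * ?f (u + (v - u) * x)) \<partial>lborel)"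
    by (rule nn_integral_affine_unit_interval[OF uv]) measurable
  also have "\<dots> = (\<integral>\<^sup>+x. ennreal ((v - u) powr (p + q - 1)) * ennreal (beta_weight p q x) \<partial>lborel)"
  proof (intro nn_integral_cong)
    fix x :: real
    show "indicator {0<..<1} x * (ennreal (v - u) * ?f (u + (v - u) * x)) = ennreal ((v - u) powr (p + q - 1)) * ennreal (beta_weight p q x)"
    proof (cases "x \<in> {0<..<1}")
      case True
      have "v - (u + (v - u) * x) = (v - u) * (1 - x)" by (simp add: algebra_simps)
      hence "(v - u) * (((u + (v - u) * x) - u) powr (p - 1) * (v - (u + (v - u) * x)) powr (q - 1))
        = (v - u) powr 1 * (((v - u) powr (p - 1) * x powr (p - 1)) * ((v - u) powr (q - 1) * (1 - x) powr (q - 1)))"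
        using uv True by (simp add: powr_mult)
      also have "\<dots> = ((v - u) powr 1 * (v - u) powr (p - 1) * (v - u) powr (q - 1)) * (x powr (p - 1) * (1 - x) powr (q - 1))"
        by (simp only: mult_ac)
      also have "(v - u) powr 1 * (v - u) powr (p - 1) * (v - u) powr (q - 1) = (v - u) powr (p + q - 1)"
        unfolding powr_add[symmetric] by (simp add: algebra_simps)
      finally show ?thesis
        using True uv by (simp add: ennreal_mult[symmetric] beta_weight_def)
    qed (simp add: beta_weight_def)
  qed
  also have "\<dots> = ennreal ((v - u) powr (p + q - 1)) * ennreal (Beta p q)"
    by (subst nn_integral_cmult) (simp_all add: nn_integral_beta_weight pq)
  finally show ?thesis by (simp add: ennreal_mult'' mult.commute)
qed

text \<open>
  The substitution \<open>s = q * x / (x - (x - q) * y)\<close> maps \<open>{0..1}\<close> onto \<open>{q..x}\<close>. All powers of the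
  denominator cancel because the three exponents and the derivative add up to zero, and the plain Beta integral remains.
\<close>

lemma nn_integral_Beta_Moebius:
  fixes p q x :: real
  assumes p: "p > 0" and q: "0 < q" "q < x"
  shows "(\<integral>\<^sup>+s. indicator {q<..<x} s * ennreal ((x - s) powr (p - 1) * (s - q) powr (p - 1) * s powr (- 2 * p)) \<partial>lborel)
           = ennreal (Beta p p * (x - q) powr (2 * p - 1) * (x * q) powr (- p))"
proof -
  define f where "f s = (x - s) powr (p - 1) * (s - q) powr (p - 1) * s powr (- 2 * p)" for s
  define D where "D y = x - (x - q) * y" for y
  define g where "g y = q * x / D y" for y
  define g' where "g' y = q * x * (x - q) / (D y)\<^sup>2" for y
  have D: "D y > 0" if "y \<in> {0..1}" for y
  proof -
    have "(x - q) * y \<le> (x - q) * 1" using that q by (intro mult_left_mono) auto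
    hence "(x - q) * y \<le> x - q" by simp
    thus ?thesis using q unfolding D_def by linarith
  qed
  have g01: "g 0 = q" "g 1 = x" using q by (simp_all add: g_def D_def)
  have [measurable]: "f \<in> borel_measurable borel" unfolding f_def by measurable
  have "(\<integral>\<^sup>+s. indicator {q<..<x} s * ennreal (f s) \<partial>lborel) = (\<integral>\<^sup>+s. ennreal (f s * indicator {g 0..g 1} s) \<partial>lborel)"
  proof (intro nn_integral_cong_AE)
    have "AE s in lborel. s \<noteq> q" "AE s in lborel. s \<noteq> x" by (rule AE_lborel_singleton)+
    thus "AE s in lborel. indicator {q<..<x} s * ennreal (f s) = ennreal (f s * indicator {g 0..g 1} s)"
      unfolding g01 by eventually_elim (auto simp: indicator_def)
  qed
  also have "\<dots> = (\<integral>\<^sup>+y. ennreal (f (g y) * g' y * indicator {0..1} y) \<partial>lborel)"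
  proof (rule nn_integral_substitution)
    show "set_borel_measurable borel {g 0..g 1} f" unfolding set_borel_measurable_def by measurable
    show "(g has_real_derivative g' y) (at y)" if "y \<in> {0..1}" for y
    proof -
      have "x - (x - q) * y \<noteq> 0" using D[OF that] by (simp add: D_def)
      thus ?thesis unfolding g_def g'_def D_def
        by (auto intro!: derivative_eq_intros simp: power2_eq_square right_diff_distrib diff_divide_distrib)
    qed
    show "continuous_on {0..1} g'" unfolding g'_def D_def
      by (intro continuous_intros ballI) (use D in \<open>force simp: D_def\<close>)
    show "g' y \<ge> 0" if "y \<in> {0..1}" for y using q by (simp add: g'_def)
  qed auto
  also have "\<dots> = (\<integral>\<^sup>+y. ennreal ((x - q) powr (2 * p - 1) * (x * q) powr (- p)) * ennreal (beta_weight p p y) \<partial>lborel)"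
  proof (intro nn_integral_cong_AE)
    have "AE y in lborel. (y::real) \<noteq> 0" "AE y in lborel. (y::real) \<noteq> 1" by (rule AE_lborel_singleton)+
    thus "AE y in lborel. ennreal (f (g y) * g' y * indicator {0..1} y) =
       ennreal ((x - q) powr (2 * p - 1) * (x * q) powr (- p)) * ennreal (beta_weight p p y)"
    proof eventually_elim
      fix y :: real assume y: "y \<noteq> 0" "y \<noteq> 1"
      show "ennreal (f (g y) * g' y * indicator {0..1} y) =
       ennreal ((x - q) powr (2 * p - 1) * (x * q) powr (- p)) * ennreal (beta_weight p p y)"
      proof (cases "y \<in> {0<..<1}")
        case False thus ?thesis using y by (auto simp: beta_weight_def indicator_def)
      next
        case True
        let ?d = "D y"
        have d: "?d > 0" using True D by auto
        have e1: "x - g y = x * ((x - q) * (1 - y)) / ?d"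
          unfolding g_def using d by (simp add: field_simps) (simp add: D_def algebra_simps)
        have e2: "g y - q = q * ((x - q) * y) / ?d"
          unfolding g_def using d by (simp add: field_simps) (simp add: D_def algebra_simps)
        have "f (g y) * g' y = (x powr (p - 1) * ((x - q) powr (p - 1) * (1 - y) powr (p - 1)) / ?d powr (p - 1)) *
           (q powr (p - 1) * ((x - q) powr (p - 1) * y powr (p - 1)) / ?d powr (p - 1)) *
           (q powr (- 2 * p) * x powr (- 2 * p) / ?d powr (- 2 * p)) * (q powr 1 * x powr 1 * (x - q) powr 1 / ?d powr 2)"
          unfolding f_def e1 e2 g'_def unfolding g_def
          using q True d by (simp add: powr_mult powr_divide)
        also have "\<dots> = (x powr (p - 1) * x powr (- 2 * p) * x powr 1) * (q powr (p - 1) * q powr (- 2 * p) * q powr 1)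
           * ((x - q) powr (p - 1) * (x - q) powr (p - 1) * (x - q) powr 1)
           / (?d powr (p - 1) * ?d powr (p - 1) * ?d powr (- 2 * p) * ?d powr 2) * (y powr (p - 1) * (1 - y) powr (p - 1))"
          by (simp only: times_divide_eq_left times_divide_eq_right divide_divide_eq_left mult_ac)
        also have "x powr (p - 1) * x powr (- 2 * p) * x powr 1 = x powr (- p)"
          unfolding powr_add[symmetric] by simp
        also have "q powr (p - 1) * q powr (- 2 * p) * q powr 1 = q powr (- p)"
          unfolding powr_add[symmetric] by simp
        also have "(x - q) powr (p - 1) * (x - q) powr (p - 1) * (x - q) powr 1 = (x - q) powr (2 * p - 1)"
          unfolding powr_add[symmetric] by (simp add: algebra_simps)
        also have "?d powr (p - 1) * ?d powr (p - 1) * ?d powr (- 2 * p) * ?d powr 2 = 1"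
          unfolding powr_add[symmetric] using d by simp
        finally have "f (g y) * g' y = (x - q) powr (2 * p - 1) * (x * q) powr (- p) * (y powr (p - 1) * (1 - y) powr (p - 1))"
          using q by (simp add: powr_mult mult_ac)
        thus ?thesis using True by (simp add: ennreal_mult[symmetric] beta_weight_def)
      qed
    qed
  qed
  also have "\<dots> = ennreal ((x - q) powr (2 * p - 1) * (x * q) powr (- p)) * ennreal (Beta p p)"
    by (subst nn_integral_cmult) (simp_all add: nn_integral_beta_weight p)
  finally show ?thesis unfolding f_def by (simp add: ennreal_mult'' mult_ac)
qed

text \<open>
  The integrand of the Riemann--Liouville form of the kernel: \<^const>\<open>K_H\<close> is the kernel of the composition of the
  fractional integral of order \<open>2 * H\<close>, multiplication by \<open>r powr (1/2 - H)\<close>, the fractional integral of order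
  \<open>1/2 - H\<close>, and multiplication by \<open>s powr (H - 1/2)\<close>.
\<close>

definition K_H_integrand :: "real \<Rightarrow> real \<Rightarrow> real \<Rightarrow> real \<Rightarrow> real" where
  "K_H_integrand H t s r = s powr (H - 1/2) * (t - r) powr (2 * H - 1) *
     r powr (1/2 - H) * (r - s) powr (- 1/2 - H) / (Gamma (1/2 - H) * Gamma (2 * H))"

text \<open>
  Euler's integral at the real point \<open>1 - t / s\<close>, transported to \<open>{s<..<t}\<close> by \<open>r = s + (t - s) * x\<close>.
\<close>

lemma K_H_integral_form:
  assumes H: "0 < H" "H < 1/2" and st: "0 < s" "s < t"
  shows "K_H H t s \<ge> 0" (is ?nonneg)
    and "ennreal (K_H H t s) = (\<integral>\<^sup>+r. indicator {s<..<t} r * ennreal (K_H_integrand H t s r) \<partial>lborel)" (is ?eq)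
proof -
  define p where "p = 1/2 - H"
  define z where "z = 1 - t / s"
  have p: "p > 0" "2 * H > 0" using H by (auto simp: p_def)
  have z: "z < 0" using st by (simp add: z_def)
  have zc: "complex_of_real z \<in> cut_plane" using z by (auto simp: image_iff simp del: of_real_diff)
  \<comment> \<open>The integrand at the real point \<open>z\<close>, where the complex power is a real one.\<close>
  define J where "J x = beta_weight p (2 * H) x * (1 - z * x) powr p" for x
  have Jnn: "J x \<ge> 0" for x by (simp add: J_def beta_weight_nonneg)
  have [measurable]: "J \<in> borel_measurable borel" unfolding J_def by measurable
  have Jint: "integrable lborel J"
  proof (rule Bochner_Integration.integrable_bound)
    show "integrable lborel (\<lambda>x. (1 - z) powr p * beta_weight p (2 * H) x)"
      using integrable_beta_weight[OF p] by auto
    have "norm (J x) \<le> norm ((1 - z) powr p * beta_weight p (2 * H) x)" for x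
    proof (cases "x \<in> {0<..<1}")
      case True
      have "z * x \<le> 0" "(- z) * x \<le> (- z) * 1" using z True by (auto simp: mult_nonpos_nonneg intro!: mult_left_mono)
      hence "(1 - z * x) powr p \<le> (1 - z) powr p" using p z by (intro powr_mono2) auto
      hence "(1 - z * x) powr p * beta_weight p (2 * H) x \<le> (1 - z) powr p * beta_weight p (2 * H) x"
        by (intro mult_right_mono beta_weight_nonneg)
      thus ?thesis using Jnn[of x] by (simp add: J_def abs_mult beta_weight_nonneg mult.commute)
    qed (simp add: J_def beta_weight_def)
    thus "AE x in lborel. norm (J x) \<le> norm ((1 - z) powr p * beta_weight p (2 * H) x)" by simp
  qed measurable
  have "Euler_integral (H - 1/2) p (2 * H) (of_real z) = (LINT x|lborel. complex_of_real (J x))"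
    unfolding Euler_integral_def
  proof (intro Bochner_Integration.integral_cong refl)
    fix x :: real
    show "complex_of_real (beta_weight p (2 * H) x) * (1 - complex_of_real z * complex_of_real x) powr - complex_of_real (H - 1/2)
       = complex_of_real (J x)"
    proof (cases "x \<in> {0<..<1}")
      case True
      have "z * x \<le> 0" using z True by (auto simp: mult_nonpos_nonneg)
      hence "complex_of_real ((1 - z * x) powr p) = complex_of_real (1 - z * x) powr complex_of_real p"
        by (subst powr_of_real) auto
      thus ?thesis by (simp add: J_def p_def)
    qed (simp add: J_def beta_weight_def)
  qed
  also have "\<dots> = of_real (LINT x|lborel. J x)" by simp
  finally have E: "Euler_integral (H - 1/2) p (2 * H) (of_real z) = of_real (LINT x|lborel. J x)" .
  have "Gauss_hypergeo (of_real (H - 1 / 2)) (of_real (1 / 2 - H)) (of_real (H + 1 / 2)) (of_real (1 - t / s))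
     = of_real ((LINT x|lborel. J x) / Beta p (2 * H))"
    using Gauss_hypergeo_eq_Euler_integral[OF p zc, of "H - 1/2"] E by (simp add: p_def z_def)
  hence "K_H H t s = inverse (Gamma (H + 1 / 2)) * (t - s) powr (H - 1 / 2) * ((LINT x|lborel. J x) / Beta p (2 * H))"
    using st unfolding K_H_def by simp
  also have "Beta p (2 * H) = Gamma p * Gamma (2 * H) / Gamma (H + 1/2)" by (simp add: Beta_def p_def)
  also have "inverse (Gamma (H + 1 / 2)) * (t - s) powr (H - 1 / 2) * ((LINT x|lborel. J x) / (Gamma p * Gamma (2 * H) / Gamma (H + 1/2)))
     = (t - s) powr (H - 1/2) / (Gamma p * Gamma (2 * H)) * (LINT x|lborel. J x)"
    using H by (simp add: field_simps Gamma_eq_zero_iff) (auto elim!: nonpos_Ints_cases)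
  finally have K: "K_H H t s = (t - s) powr (H - 1/2) / (Gamma p * Gamma (2 * H)) * (LINT x|lborel. J x)" .
  have G: "Gamma p > 0" "Gamma (2 * H) > 0" using p by auto
  show ?nonneg unfolding K using G Jnn by (intro mult_nonneg_nonneg Bochner_Integration.integral_nonneg divide_nonneg_nonneg) auto
  have "ennreal (K_H H t s) = ennreal ((t - s) powr (H - 1/2) / (Gamma p * Gamma (2 * H))) * (\<integral>\<^sup>+x. ennreal (J x) \<partial>lborel)"
    unfolding K using G Jnn by (subst nn_integral_eq_integral[OF Jint]) (auto simp: ennreal_mult'[symmetric])
  also have "\<dots> = (\<integral>\<^sup>+x. ennreal ((t - s) powr (H - 1/2) / (Gamma p * Gamma (2 * H))) * ennreal (J x) \<partial>lborel)"
    by (subst nn_integral_cmult) auto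
  also have "\<dots> = (\<integral>\<^sup>+x. indicator {0<..<1} x * (ennreal (t - s) * ennreal (K_H_integrand H t s (s + (t - s) * x))) \<partial>lborel)"
  proof (intro nn_integral_cong)
    fix x :: real
    show "ennreal ((t - s) powr (H - 1/2) / (Gamma p * Gamma (2 * H))) * ennreal (J x) =
      indicator {0<..<1} x * (ennreal (t - s) * ennreal (K_H_integrand H t s (s + (t - s) * x)))"
    proof (cases "x \<in> {0<..<1}")
      case True
      have e1: "t - (s + (t - s) * x) = (t - s) * (1 - x)" by (simp add: algebra_simps)
      have e2: "s + (t - s) * x = s * (1 - z * x)" using st by (simp add: z_def field_simps)
      have "z * x \<le> 0" using z True by (auto simp: mult_nonpos_nonneg)
      hence e3: "(s + (t - s) * x) powr p = s powr p * (1 - z * x) powr p"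
        unfolding e2 using st by (simp add: powr_mult)
      have "(t - s) * K_H_integrand H t s (s + (t - s) * x)
        = (t - s) powr 1 * (s powr (H - 1/2) * ((t - s) powr (2 * H - 1) * (1 - x) powr (2 * H - 1)) *
            (s powr p * (1 - z * x) powr p) * ((t - s) powr (- 1/2 - H) * x powr (- 1/2 - H)) / (Gamma p * Gamma (2 * H)))"
        unfolding K_H_integrand_def e1 p_def[symmetric] e3 using st True
        by (simp add: powr_mult)
      also have "\<dots> = ((t - s) powr 1 * (t - s) powr (2 * H - 1) * (t - s) powr (- 1/2 - H)) * (s powr (H - 1/2) * s powr p)
          / (Gamma p * Gamma (2 * H)) * (x powr (- 1/2 - H) * (1 - x) powr (2 * H - 1) * (1 - z * x) powr p)"
        by (simp only: times_divide_eq_left times_divide_eq_right mult_ac)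
      also have "(t - s) powr 1 * (t - s) powr (2 * H - 1) * (t - s) powr (- 1/2 - H) = (t - s) powr (H - 1/2)"
        unfolding powr_add[symmetric] by (simp add: field_simps)
      also have "s powr (H - 1/2) * s powr p = 1" unfolding powr_add[symmetric] using st by (simp add: p_def)
      also have "x powr (- 1/2 - H) * (1 - x) powr (2 * H - 1) * (1 - z * x) powr p = J x"
        using True by (simp add: J_def beta_weight_def p_def)
      finally have "(t - s) * K_H_integrand H t s (s + (t - s) * x)
         = (t - s) powr (H - 1/2) / (Gamma p * Gamma (2 * H)) * J x" unfolding mult_1_right .
      hence "ennreal (t - s) * ennreal (K_H_integrand H t s (s + (t - s) * x))
         = ennreal ((t - s) powr (H - 1/2) / (Gamma p * Gamma (2 * H)) * J x)"
        using st by (subst ennreal_mult'[symmetric]) auto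
      also have "\<dots> = ennreal ((t - s) powr (H - 1/2) / (Gamma p * Gamma (2 * H))) * ennreal (J x)"
        using G by (intro ennreal_mult') simp
      finally show ?thesis using True by simp
    qed (simp add: J_def beta_weight_def)
  qed
  also have "\<dots> = (\<integral>\<^sup>+r. indicator {s<..<t} r * ennreal (K_H_integrand H t s r) \<partial>lborel)"
    by (rule nn_integral_affine_unit_interval[OF st(2), symmetric]) (simp add: K_H_integrand_def)
  finally show ?eq .
qed

section \<open>Inverting the kernel\<close>

text \<open>
  The kernel of the weighted fractional integral \<open>s powr (-p) * I^p (q powr p * \<eta>)\<close> with \<open>p = 1/2 - H\<close>.
\<close>

definition frac_kernel :: "real \<Rightarrow> real \<Rightarrow> real \<Rightarrow> real" where
  "frac_kernel H s q = indicator {0<..<s} q *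
     (s powr (H - 1/2) / Gamma (1/2 - H) * (q powr (1/2 - H) * (s - q) powr (- 1/2 - H)))"

text \<open>
  The preimage of the function \<open>t \<mapsto> \<integral>\<eta>\<close> (over \<open>{0..t}\<close>) under the integral operator with kernel \<^const>\<open>K_H\<close>, that is, the
  shift density of the Wiener process which shifts the fractional Brownian motion by \<open>\<integral>\<eta>\<close>.
\<close>

definition K_H_inv :: "real \<Rightarrow> (real \<Rightarrow> real) \<Rightarrow> real \<Rightarrow> real" where
  "K_H_inv H \<eta> s = (LINT q|lborel. frac_kernel H s q * \<eta> q)"

definition frac_const :: "real \<Rightarrow> real" where
  "frac_const H = Beta (3/2 - H) (1/2 - H) / Gamma (1/2 - H)"

lemma frac_kernel_measurable [measurable]:
  "(\<lambda>(s, q). frac_kernel H s q) \<in> borel_measurable (borel \<Otimes>\<^sub>M borel)"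
proof -
  have "(\<lambda>(s, q). frac_kernel H s q) = (\<lambda>z. if 0 < snd z \<and> snd z < fst z then
     (fst z powr (H - 1/2) / Gamma (1/2 - H) * (snd z powr (1/2 - H) * (fst z - snd z) powr (- 1/2 - H))) else 0)"
    by (auto simp: frac_kernel_def indicator_def)
  thus ?thesis by simp
qed

lemma frac_kernel_nonneg: "H < 1/2 \<Longrightarrow> 0 \<le> frac_kernel H s q"
  by (simp add: frac_kernel_def)

lemma has_bochner_integral_frac_kernel:
  assumes H: "0 < H" "H < 1/2" and s: "0 < s"
  shows "has_bochner_integral lborel (frac_kernel H s) (frac_const H * s powr (1/2 - H))"
proof (rule has_bochner_integral_nn_integral)
  show "frac_kernel H s \<in> borel_measurable lborel" by measurable
  show "AE x in lborel. 0 \<le> frac_kernel H s x" using H frac_kernel_nonneg by auto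
  have G: "Gamma (1/2 - H) > 0" using H by auto
  have B: "Beta (3/2 - H) (1/2 - H) \<ge> 0" using H by (simp add: Beta_def)
  show "0 \<le> frac_const H * s powr (1/2 - H)" using G B by (simp add: frac_const_def)
  have "(\<integral>\<^sup>+q. ennreal (frac_kernel H s q) \<partial>lborel) =
    (\<integral>\<^sup>+q. ennreal (s powr (H - 1/2) / Gamma (1/2 - H)) * (indicator {0<..<s} q *
        ennreal ((q - 0) powr ((3/2 - H) - 1) * (s - q) powr ((1/2 - H) - 1))) \<partial>lborel)"
    using G by (intro nn_integral_cong) (auto simp: frac_kernel_def indicator_def ennreal_mult[symmetric])
  also have "\<dots> = ennreal (s powr (H - 1/2) / Gamma (1/2 - H)) * ennreal (Beta (3/2 - H) (1/2 - H) * (s - 0) powr ((3/2 - H) + (1/2 - H) - 1))"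
    using H s by (subst nn_integral_cmult, simp, subst nn_integral_Beta_interval) auto
  also have "\<dots> = ennreal (s powr (H - 1/2) / Gamma (1/2 - H) * (Beta (3/2 - H) (1/2 - H) * s powr (1 - 2 * H)))"
    using G B by (simp add: ennreal_mult[symmetric])
  also have "s powr (H - 1/2) / Gamma (1/2 - H) * (Beta (3/2 - H) (1/2 - H) * s powr (1 - 2 * H))
     = frac_const H * (s powr (H - 1/2) * s powr (1 - 2 * H))" by (simp add: frac_const_def)
  also have "s powr (H - 1/2) * s powr (1 - 2 * H) = s powr (1/2 - H)"
    unfolding powr_add[symmetric] by (simp add: field_simps)
  finally show "(\<integral>\<^sup>+q. ennreal (frac_kernel H s q) \<partial>lborel) = ennreal (frac_const H * s powr (1/2 - H))" .
qed

lemma frac_const_nonneg: "H < 1/2 \<Longrightarrow> 0 \<le> frac_const H"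
  by (simp add: frac_const_def Beta_def)

lemma frac_kernel_zero: "s \<le> 0 \<Longrightarrow> frac_kernel H s q = 0"
  by (auto simp: frac_kernel_def)

lemma integrable_frac_kernel:
  assumes H: "0 < H" "H < 1/2" and [measurable]: "\<eta> \<in> borel_measurable borel" and N: "\<And>q. \<bar>\<eta> q\<bar> \<le> N"
  shows "integrable lborel (\<lambda>q. frac_kernel H s q * \<eta> q)"
proof (cases "s > 0")
  case True
  show ?thesis
  proof (rule Bochner_Integration.integrable_bound)
    show "integrable lborel (\<lambda>q. N * frac_kernel H s q)"
      using has_bochner_integral_frac_kernel[OF H True] by (auto simp: has_bochner_integral_iff)
    have "0 \<le> N" using N[of 0] by linarith
    hence "norm (frac_kernel H s q * \<eta> q) \<le> norm (N * frac_kernel H s q)" for q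
      using mult_right_mono[OF N[of q] frac_kernel_nonneg[OF H(2), of s q]] frac_kernel_nonneg[OF H(2), of s q]
      by (simp add: abs_mult mult.commute)
    thus "AE q in lborel. norm (frac_kernel H s q * \<eta> q) \<le> norm (N * frac_kernel H s q)" by simp
  qed measurable
qed (simp add: frac_kernel_zero)

lemma K_H_inv_bound:
  assumes H: "0 < H" "H < 1/2" and [measurable]: "\<eta> \<in> borel_measurable borel" and N: "\<And>q. \<bar>\<eta> q\<bar> \<le> N"
  shows "\<bar>K_H_inv H \<eta> s\<bar> \<le> N * frac_const H * s powr (1/2 - H)"
proof (cases "s > 0")
  case True
  have k: "has_bochner_integral lborel (\<lambda>q. N * frac_kernel H s q) (N * (frac_const H * s powr (1/2 - H)))"
    by (rule has_bochner_integral_mult_right) (rule has_bochner_integral_frac_kernel[OF H True])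
  have "\<bar>K_H_inv H \<eta> s\<bar> \<le> (LINT q|lborel. N * frac_kernel H s q)"
    unfolding K_H_inv_def real_norm_def[symmetric]
  proof (rule Bochner_Integration.integral_norm_bound_integral)
    show "integrable lborel (\<lambda>q. N * frac_kernel H s q)" using k by (auto simp: has_bochner_integral_iff)
    show "integrable lborel (\<lambda>q. frac_kernel H s q * \<eta> q)" by (rule integrable_frac_kernel[OF H _ N]) measurable
    show "norm (frac_kernel H s q * \<eta> q) \<le> N * frac_kernel H s q" for q
      using mult_right_mono[OF N[of q] frac_kernel_nonneg[OF H(2), of s q]] frac_kernel_nonneg[OF H(2), of s q]
      by (simp add: abs_mult mult.commute)
  qed
  also have "\<dots> = N * (frac_const H * s powr (1/2 - H))" using k by (simp add: has_bochner_integral_iff)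
  finally show ?thesis by (simp add: mult_ac)
next
  case False
  have "N \<ge> 0" using N[of 0] by linarith
  thus ?thesis using False frac_const_nonneg[OF H(2)] by (simp add: K_H_inv_def frac_kernel_zero)
qed

lemma K_H_inv_parametric_measurable [measurable (raw)]:
  assumes [measurable]: "(\<lambda>(w, q). \<eta> w q) \<in> borel_measurable (N \<Otimes>\<^sub>M borel)" and [measurable]: "f \<in> borel_measurable N"
  shows "(\<lambda>w. K_H_inv H (\<eta> w) (f w)) \<in> borel_measurable N"
  unfolding K_H_inv_def by measurable

lemma K_H_measurable:
  assumes H: "0 < H" "H < 1/2"
  shows "(\<lambda>s. K_H H t s) \<in> borel_measurable borel"
proof -
  have "K_H H t s = (if 0 < s \<and> s < t then enn2real (\<integral>\<^sup>+r. (if s < r \<and> r < t then ennreal (K_H_integrand H t s r) else 0) \<partial>lborel) else 0)" for s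
  proof (cases "0 < s \<and> s < t")
    case True
    have "K_H H t s = enn2real (ennreal (K_H H t s))" using K_H_integral_form(1)[OF H, of s t] True by simp
    also have "ennreal (K_H H t s) = (\<integral>\<^sup>+r. (if s < r \<and> r < t then ennreal (K_H_integrand H t s r) else 0) \<partial>lborel)"
      using True by (subst K_H_integral_form(2)[OF H]) (auto intro!: nn_integral_cong simp: indicator_def)
    finally show ?thesis using True by simp
  qed (auto simp: K_H_def)
  thus ?thesis unfolding K_H_integrand_def by simp
qed

lemma K_H_nonneg: "0 < H \<Longrightarrow> H < 1/2 \<Longrightarrow> 0 \<le> K_H H t s"
  using K_H_integral_form(1)[of H s t] by (cases "0 < s \<and> s < t") (auto simp: K_H_def)

text \<open>
  By Tonelli the left-hand side is an integral over \<open>0 < q < s < r < t\<close>. Integrating first over \<open>s\<close> (Moebius form of the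
  Beta integral) removes the weights in \<open>q\<close> and \<open>r\<close>; the integral over \<open>r\<close> is then a Beta integral whose exponents add up
  to \<open>0\<close>, so its value does not depend on \<open>q\<close>, and the Gamma factors cancel.
\<close>

lemma nn_integral_K_H_frac_kernel:
  assumes H: "0 < H" "H < 1/2" and [measurable]: "\<eta> \<in> borel_measurable borel"
  shows "(\<integral>\<^sup>+s. ennreal (K_H H t s) * (\<integral>\<^sup>+q. ennreal (frac_kernel H s q) * \<eta> q \<partial>lborel) \<partial>lborel)
           = (\<integral>\<^sup>+q. indicator {0<..<t} q * \<eta> q \<partial>lborel)"
proof -
  define p where "p = 1/2 - H"
  have p: "p > 0" "2 * p > 0" "2 * H > 0" using H by (auto simp: p_def)
  have G: "Gamma p > 0" "Gamma (2 * H) > 0" using p by auto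
  define c where "c = 1 / (Gamma p * Gamma p * Gamma (2 * H))"
  have c: "c > 0" using G by (simp add: c_def)
  define k1 where "k1 s r = s powr (- p) * (t - r) powr (2 * H - 1) * r powr p * (r - s) powr (p - 1) / (Gamma p * Gamma (2 * H))"
    for s r :: real
  define \<Phi> where "\<Phi> s r q = (if 0 < q \<and> q < s \<and> s < r \<and> r < t then ennreal (k1 s r) * (ennreal (frac_kernel H s q) * \<eta> q) else 0)" for s r q
  have meas: "(\<lambda>(s, r, q). \<Phi> s r q) \<in> borel_measurable (borel \<Otimes>\<^sub>M borel \<Otimes>\<^sub>M borel)"
    unfolding \<Phi>_def k1_def by measurable
  have [measurable (raw)]: "(\<lambda>x. \<Phi> (f x) (g x) (h x)) \<in> borel_measurable N"
    if [measurable]: "f \<in> borel_measurable N" "g \<in> borel_measurable N" "h \<in> borel_measurable N" for f g h and N :: "'x measure"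
    using measurable_compose[OF _ meas, of "\<lambda>x. (f x, g x, h x)" N] by simp
  have "(\<integral>\<^sup>+s. ennreal (K_H H t s) * (\<integral>\<^sup>+q. ennreal (frac_kernel H s q) * \<eta> q \<partial>lborel) \<partial>lborel)
     = (\<integral>\<^sup>+s. (\<integral>\<^sup>+r. (\<integral>\<^sup>+q. \<Phi> s r q \<partial>lborel) \<partial>lborel) \<partial>lborel)"
  proof (intro nn_integral_cong)
    fix s :: real
    show "ennreal (K_H H t s) * (\<integral>\<^sup>+q. ennreal (frac_kernel H s q) * \<eta> q \<partial>lborel) = (\<integral>\<^sup>+r. (\<integral>\<^sup>+q. \<Phi> s r q \<partial>lborel) \<partial>lborel)"
    proof (cases "0 < s \<and> s < t")
      case False
      hence "K_H H t s = 0" by (auto simp: K_H_def)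
      moreover have "\<Phi> s r q = 0" for r q using False by (auto simp: \<Phi>_def)
      ultimately show ?thesis by simp
    next
      case True
      have "ennreal (K_H H t s) = (\<integral>\<^sup>+r. indicator {s<..<t} r * ennreal (k1 s r) \<partial>lborel)"
        using True by (subst K_H_integral_form(2)[OF H]) (auto intro!: nn_integral_cong simp: k1_def p_def K_H_integrand_def)
      hence "ennreal (K_H H t s) * (\<integral>\<^sup>+q. ennreal (frac_kernel H s q) * \<eta> q \<partial>lborel)
        = (\<integral>\<^sup>+r. indicator {s<..<t} r * ennreal (k1 s r) * (\<integral>\<^sup>+q. ennreal (frac_kernel H s q) * \<eta> q \<partial>lborel) \<partial>lborel)"
        by (subst nn_integral_multc) (auto simp: k1_def)
      also have "\<dots> = (\<integral>\<^sup>+r. (\<integral>\<^sup>+q. \<Phi> s r q \<partial>lborel) \<partial>lborel)"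
      proof (intro nn_integral_cong)
        fix r :: real
        have "indicator {s<..<t} r * ennreal (k1 s r) * (\<integral>\<^sup>+q. ennreal (frac_kernel H s q) * \<eta> q \<partial>lborel)
           = (\<integral>\<^sup>+q. indicator {s<..<t} r * ennreal (k1 s r) * (ennreal (frac_kernel H s q) * \<eta> q) \<partial>lborel)"
          by (subst nn_integral_cmult) auto
        also have "\<dots> = (\<integral>\<^sup>+q. \<Phi> s r q \<partial>lborel)"
          by (intro nn_integral_cong) (auto simp: \<Phi>_def frac_kernel_def indicator_def)
        finally show "indicator {s<..<t} r * ennreal (k1 s r) * (\<integral>\<^sup>+q. ennreal (frac_kernel H s q) * \<eta> q \<partial>lborel)
           = (\<integral>\<^sup>+q. \<Phi> s r q \<partial>lborel)" .
      qed
      finally show ?thesis .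
    qed
  qed
  also have "\<dots> = (\<integral>\<^sup>+s. (\<integral>\<^sup>+q. (\<integral>\<^sup>+r. \<Phi> s r q \<partial>lborel) \<partial>lborel) \<partial>lborel)"
    by (intro nn_integral_cong lborel_pair.Fubini') measurable
  also have "\<dots> = (\<integral>\<^sup>+q. (\<integral>\<^sup>+s. (\<integral>\<^sup>+r. \<Phi> s r q \<partial>lborel) \<partial>lborel) \<partial>lborel)"
    by (intro lborel_pair.Fubini') measurable
  also have "\<dots> = (\<integral>\<^sup>+q. (\<integral>\<^sup>+r. (\<integral>\<^sup>+s. \<Phi> s r q \<partial>lborel) \<partial>lborel) \<partial>lborel)"
    by (intro nn_integral_cong lborel_pair.Fubini') measurable
  also have "\<dots> = (\<integral>\<^sup>+q. indicator {0<..<t} q * \<eta> q \<partial>lborel)"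
  proof (intro nn_integral_cong)
    fix q :: real
    show "(\<integral>\<^sup>+r. (\<integral>\<^sup>+s. \<Phi> s r q \<partial>lborel) \<partial>lborel) = indicator {0<..<t} q * \<eta> q"
    proof (cases "0 < q \<and> q < t")
      case False
      hence "\<Phi> s r q = 0" for s r by (auto simp: \<Phi>_def)
      thus ?thesis using False by auto
    next
      case True
      have Bpp: "Beta p p \<ge> 0" using p by (simp add: Beta_def)
      have inner: "(\<integral>\<^sup>+s. \<Phi> s r q \<partial>lborel) = \<eta> q * (ennreal (c * Beta p p) * (indicator {q<..<t} r * ennreal ((r - q) powr (2 * p - 1) * (t - r) powr (2 * H - 1))))" for r
      proof (cases "q < r \<and> r < t")
        case False
        hence "\<Phi> s r q = 0" for s by (auto simp: \<Phi>_def)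
        thus ?thesis using False by auto
      next
        case r: True
        have "(\<integral>\<^sup>+s. \<Phi> s r q \<partial>lborel) = (\<integral>\<^sup>+s. \<eta> q * (ennreal (c * (t - r) powr (2 * H - 1) * r powr p * q powr p) *
            (indicator {q<..<r} s * ennreal ((r - s) powr (p - 1) * (s - q) powr (p - 1) * s powr (- 2 * p)))) \<partial>lborel)"
        proof (intro nn_integral_cong)
          fix s :: real
          show "\<Phi> s r q = \<eta> q * (ennreal (c * (t - r) powr (2 * H - 1) * r powr p * q powr p) *
            (indicator {q<..<r} s * ennreal ((r - s) powr (p - 1) * (s - q) powr (p - 1) * s powr (- 2 * p))))"
          proof (cases "q < s \<and> s < r")
            case s: True
            have "k1 s r * frac_kernel H s q = (s powr (- p) * s powr (- p)) * c * (t - r) powr (2 * H - 1) * r powr p * (r - s) powr (p - 1) * (q powr p * (s - q) powr (p - 1))"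
              using s True by (simp add: k1_def frac_kernel_def c_def p_def mult_ac)
            also have "s powr (- p) * s powr (- p) = s powr (- 2 * p)" unfolding powr_add[symmetric] by simp
            finally have "k1 s r * frac_kernel H s q = c * (t - r) powr (2 * H - 1) * r powr p * q powr p * ((r - s) powr (p - 1) * (s - q) powr (p - 1) * s powr (- 2 * p))"
              by (simp only: mult_ac)
            moreover have "k1 s r \<ge> 0" using G by (simp add: k1_def)
            ultimately have "ennreal (k1 s r) * ennreal (frac_kernel H s q) = ennreal (c * (t - r) powr (2 * H - 1) * r powr p * q powr p) * ennreal ((r - s) powr (p - 1) * (s - q) powr (p - 1) * s powr (- 2 * p))"
              by (metis ennreal_mult' ennreal_mult'' mult_nonneg_nonneg powr_ge_zero)
            thus ?thesis using s r True by (simp add: \<Phi>_def mult_ac)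
          qed (auto simp: \<Phi>_def)
        qed
        also have "\<dots> = \<eta> q * (ennreal (c * (t - r) powr (2 * H - 1) * r powr p * q powr p) *
            ennreal (Beta p p * (r - q) powr (2 * p - 1) * (r * q) powr (- p)))"
          using True r p by (subst nn_integral_cmult, simp, subst nn_integral_cmult, simp, subst nn_integral_Beta_Moebius) auto
        also have "ennreal (c * (t - r) powr (2 * H - 1) * r powr p * q powr p) *
            ennreal (Beta p p * (r - q) powr (2 * p - 1) * (r * q) powr (- p)) =
            ennreal ((c * (t - r) powr (2 * H - 1) * r powr p * q powr p) * (Beta p p * (r - q) powr (2 * p - 1) * (r * q) powr (- p)))"
          using c by (intro ennreal_mult'[symmetric]) simp
        also have "(c * (t - r) powr (2 * H - 1) * r powr p * q powr p) * (Beta p p * (r - q) powr (2 * p - 1) * (r * q) powr (- p))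
           = c * Beta p p * ((r - q) powr (2 * p - 1) * (t - r) powr (2 * H - 1))"
          using r True by (simp add: powr_mult powr_minus field_simps)
        also have "ennreal \<dots> = ennreal (c * Beta p p) * ennreal ((r - q) powr (2 * p - 1) * (t - r) powr (2 * H - 1))"
          using c Bpp by (intro ennreal_mult') simp
        finally show ?thesis using r by simp
      qed
      have "(\<integral>\<^sup>+r. (\<integral>\<^sup>+s. \<Phi> s r q \<partial>lborel) \<partial>lborel) = \<eta> q * (ennreal (c * Beta p p) * ennreal (Beta (2 * p) (2 * H) * (t - q) powr (2 * p + 2 * H - 1)))"
        unfolding inner using True p
        by (subst nn_integral_cmult, simp, subst nn_integral_cmult, simp, subst nn_integral_Beta_interval) auto
      also have "ennreal (c * Beta p p) * ennreal (Beta (2 * p) (2 * H) * (t - q) powr (2 * p + 2 * H - 1))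
         = ennreal (c * Beta p p * (Beta (2 * p) (2 * H) * (t - q) powr (2 * p + 2 * H - 1)))"
        using c Bpp by (intro ennreal_mult'[symmetric]) simp
      also have "c * Beta p p * (Beta (2 * p) (2 * H) * (t - q) powr (2 * p + 2 * H - 1)) = 1"
      proof -
        have e: "2 * p + 2 * H = 1" by (simp add: p_def)
        have "Gamma (2 * p) \<noteq> 0" using p by (simp add: Gamma_eq_zero_iff) (auto elim!: nonpos_Ints_cases)
        thus ?thesis using G True unfolding Beta_def e c_def by (simp add: mult_2[symmetric])
      qed
      finally show ?thesis using True by simp
    qed
  qed
  finally show ?thesis .
qed

lemma has_bochner_integral_K_H_inv_nonneg:
  assumes H: "0 < H" "H < 1/2" and [measurable]: "\<eta> \<in> borel_measurable borel" and N: "\<And>q. \<bar>\<eta> q\<bar> \<le> N" and nn: "\<And>q. 0 \<le> \<eta> q"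
  shows "has_bochner_integral lborel (\<lambda>s. K_H H t s * K_H_inv H \<eta> s) (LINT q:{0<..<t}|lborel. \<eta> q)"
proof (rule has_bochner_integral_nn_integral)
  note [measurable] = K_H_measurable[OF H]
  show "(\<lambda>s. K_H H t s * K_H_inv H \<eta> s) \<in> borel_measurable lborel" by measurable
  have inn: "K_H_inv H \<eta> s \<ge> 0" for s
    unfolding K_H_inv_def by (intro Bochner_Integration.integral_nonneg mult_nonneg_nonneg frac_kernel_nonneg H nn)
  show "AE s in lborel. 0 \<le> K_H H t s * K_H_inv H \<eta> s" using inn K_H_nonneg[OF H] by auto
  show "0 \<le> (LINT q:{0<..<t}|lborel. \<eta> q)" unfolding set_lebesgue_integral_def
    by (intro Bochner_Integration.integral_nonneg) (auto simp: nn)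
  have "ennreal (K_H_inv H \<eta> s) = (\<integral>\<^sup>+q. ennreal (frac_kernel H s q) * ennreal (\<eta> q) \<partial>lborel)" for s
  proof -
    have "integrable lborel (\<lambda>q. frac_kernel H s q * \<eta> q)" by (rule integrable_frac_kernel[OF H _ N]) measurable
    from nn_integral_eq_integral[OF this] show ?thesis
      using frac_kernel_nonneg[OF H(2), of s] nn by (simp add: K_H_inv_def ennreal_mult)
  qed
  hence "(\<integral>\<^sup>+s. ennreal (K_H H t s * K_H_inv H \<eta> s) \<partial>lborel) =
     (\<integral>\<^sup>+s. ennreal (K_H H t s) * (\<integral>\<^sup>+q. ennreal (frac_kernel H s q) * ennreal (\<eta> q) \<partial>lborel) \<partial>lborel)"
    using K_H_nonneg[OF H] inn by (intro nn_integral_cong) (simp add: ennreal_mult)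
  also have "\<dots> = (\<integral>\<^sup>+q. indicator {0<..<t} q * ennreal (\<eta> q) \<partial>lborel)"
    by (rule nn_integral_K_H_frac_kernel[OF H]) measurable
  also have "\<dots> = (\<integral>\<^sup>+q. ennreal (indicator {0<..<t} q *\<^sub>R \<eta> q) \<partial>lborel)"
    by (intro nn_integral_cong) (auto simp: indicator_def)
  also have "\<dots> = ennreal (LINT q:{0<..<t}|lborel. \<eta> q)"
    unfolding set_lebesgue_integral_def
  proof (rule nn_integral_eq_integral)
    show "integrable lborel (\<lambda>q. indicator {0<..<t} q *\<^sub>R \<eta> q)"
    proof (rule integrableI_bounded_set_indicator[where B=N, folded scaleR_conv_of_real])
      show "emeasure lborel {0<..<t} < \<infinity>" by (cases "0 \<le> t") auto
    qed (use N in auto)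
  qed (auto simp: nn)
  finally show "(\<integral>\<^sup>+s. ennreal (K_H H t s * K_H_inv H \<eta> s) \<partial>lborel) = ennreal (LINT q:{0<..<t}|lborel. \<eta> q)" .
qed

text \<open>
  The signed case follows from the nonnegative one by adding the constant \<open>N\<close> to \<open>\<eta>\<close> and subtracting it again.
\<close>

lemma has_bochner_integral_K_H_inv:
  assumes H: "0 < H" "H < 1/2" and [measurable]: "\<eta> \<in> borel_measurable borel" and N: "\<And>q. \<bar>\<eta> q\<bar> \<le> N"
  shows "has_bochner_integral lborel (\<lambda>s. K_H H t s * K_H_inv H \<eta> s) (LINT q:{0<..<t}|lborel. \<eta> q)"
proof -
  have N0: "N \<ge> 0" using N[of 0] by linarith
  have b: "\<bar>\<eta> q + N\<bar> \<le> 2 * N" "0 \<le> \<eta> q + N" for q using N[of q] by auto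
  have 1: "has_bochner_integral lborel (\<lambda>s. K_H H t s * K_H_inv H (\<lambda>q. \<eta> q + N) s) (LINT q:{0<..<t}|lborel. \<eta> q + N)"
    by (rule has_bochner_integral_K_H_inv_nonneg[OF H _ b]) measurable
  have 2: "has_bochner_integral lborel (\<lambda>s. K_H H t s * K_H_inv H (\<lambda>q. N) s) (LINT q:{0<..<t}|lborel. N)"
    by (rule has_bochner_integral_K_H_inv_nonneg[OF H, where N=N]) (use N0 in auto)
  have "has_bochner_integral lborel (\<lambda>s. K_H H t s * K_H_inv H (\<lambda>q. \<eta> q + N) s - K_H H t s * K_H_inv H (\<lambda>q. N) s)
     ((LINT q:{0<..<t}|lborel. \<eta> q + N) - (LINT q:{0<..<t}|lborel. N))"
    by (rule has_bochner_integral_diff[OF 1 2])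
  moreover have "K_H H t s * K_H_inv H (\<lambda>q. \<eta> q + N) s - K_H H t s * K_H_inv H (\<lambda>q. N) s = K_H H t s * K_H_inv H \<eta> s" for s
  proof -
    have i1: "integrable lborel (\<lambda>q. frac_kernel H s q * \<eta> q)" by (rule integrable_frac_kernel[OF H _ N]) measurable
    have i2: "integrable lborel (\<lambda>q. frac_kernel H s q * N)" by (rule integrable_frac_kernel[OF H, where N=N]) (use N0 in auto)
    have "K_H_inv H (\<lambda>q. \<eta> q + N) s = K_H_inv H \<eta> s + K_H_inv H (\<lambda>q. N) s"
      unfolding K_H_inv_def distrib_left by (rule Bochner_Integration.integral_add[OF i1 i2])
    thus ?thesis by (simp add: algebra_simps)
  qed
  moreover have "(LINT q:{0<..<t}|lborel. \<eta> q + N) - (LINT q:{0<..<t}|lborel. N) = (LINT q:{0<..<t}|lborel. \<eta> q)"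
  proof -
    have fin: "emeasure lborel {0<..<t} < \<infinity>" by (cases "0 \<le> t") auto
    have i: "set_integrable lborel {0<..<t} \<eta>" unfolding set_integrable_def
      by (rule integrableI_bounded_set_indicator[where B=N, folded scaleR_conv_of_real, OF _ _ fin]) (use N in auto)
    have j: "set_integrable lborel {0<..<t} (\<lambda>q. N)" unfolding set_integrable_def
      by (rule integrableI_bounded_set_indicator[where B=N, folded scaleR_conv_of_real, OF _ _ fin]) (use N0 in auto)
    show ?thesis using set_integral_add(2)[OF i j] by simp
  qed
  ultimately show ?thesis by simp
qed

text \<open>
  The square integral over \<open>{0..T}\<close> of \<^const>\<open>K_H_inv\<close> applied to the constant function \<open>N\<close>.
\<close>

definition energy_bound :: "real \<Rightarrow> real \<Rightarrow> real \<Rightarrow> real" where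
  "energy_bound H T N = (N * frac_const H)\<^sup>2 * (T powr (2 - 2 * H) / (2 - 2 * H))"

lemma nn_integral_K_H_inv_square_le:
  assumes H: "0 < H" "H < 1/2" and [measurable]: "\<eta> \<in> borel_measurable borel" and N: "\<And>q. \<bar>\<eta> q\<bar> \<le> N" and T: "0 < T"
  shows "(\<integral>\<^sup>+s\<in>{0..T}. ennreal ((K_H_inv H \<eta> s)\<^sup>2) \<partial>lborel) \<le> ennreal (energy_bound H T N)"
proof -
  have "(\<integral>\<^sup>+s\<in>{0..T}. ennreal ((K_H_inv H \<eta> s)\<^sup>2) \<partial>lborel) \<le>
     (\<integral>\<^sup>+s. ennreal ((N * frac_const H)\<^sup>2) * (indicator {0<..<T} s * ennreal ((s - 0) powr ((2 - 2 * H) - 1) * (T - s) powr (1 - 1))) \<partial>lborel)"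
  proof (intro nn_integral_mono_AE)
    have "AE s in lborel. s \<noteq> 0" "AE s in lborel. s \<noteq> T" by (rule AE_lborel_singleton)+
    thus "AE s in lborel. ennreal ((K_H_inv H \<eta> s)\<^sup>2) * indicator {0..T} s \<le>
      ennreal ((N * frac_const H)\<^sup>2) * (indicator {0<..<T} s * ennreal ((s - 0) powr ((2 - 2 * H) - 1) * (T - s) powr (1 - 1)))"
    proof eventually_elim
      fix s assume s: "s \<noteq> 0" "s \<noteq> T"
      show "ennreal ((K_H_inv H \<eta> s)\<^sup>2) * indicator {0..T} s \<le>
        ennreal ((N * frac_const H)\<^sup>2) * (indicator {0<..<T} s * ennreal ((s - 0) powr ((2 - 2 * H) - 1) * (T - s) powr (1 - 1)))"
      proof (cases "s \<in> {0<..<T}")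
        case True
        have "\<bar>K_H_inv H \<eta> s\<bar> \<le> N * frac_const H * s powr (1/2 - H)"
          by (rule K_H_inv_bound[OF H _ N]) measurable
        hence "(K_H_inv H \<eta> s)\<^sup>2 \<le> (N * frac_const H * s powr (1/2 - H))\<^sup>2"
          by (metis abs_ge_zero power2_abs power_mono)
        also have "\<dots> = (N * frac_const H)\<^sup>2 * (s powr (1/2 - H) * s powr (1/2 - H))"
          by (simp add: power_mult_distrib power2_eq_square)
        also have "s powr (1/2 - H) * s powr (1/2 - H) = s powr ((2 - 2 * H) - 1)"
          unfolding powr_add[symmetric] by simp
        finally have "ennreal ((K_H_inv H \<eta> s)\<^sup>2) \<le> ennreal ((N * frac_const H)\<^sup>2 * s powr ((2 - 2 * H) - 1))"
          by (rule ennreal_leI)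
        thus ?thesis using True by (simp add: ennreal_mult)
      qed (use s in auto)
    qed
  qed
  also have "\<dots> = ennreal ((N * frac_const H)\<^sup>2) * ennreal (Beta (2 - 2 * H) 1 * (T - 0) powr ((2 - 2 * H) + 1 - 1))"
    using H T by (subst nn_integral_cmult, simp, subst nn_integral_Beta_interval) auto
  also have "\<dots> = ennreal ((N * frac_const H)\<^sup>2 * (Beta (2 - 2 * H) 1 * T powr (2 - 2 * H)))"
    by (simp add: ennreal_mult')
  also have "Beta (2 - 2 * H) 1 = 1 / (2 - 2 * H)"
  proof -
    have "Gamma (2 - 2 * H + 1) = (2 - 2 * H) * Gamma (2 - 2 * H)"
      by (rule Gamma_plus1) (use H in \<open>auto elim!: nonpos_Ints_cases\<close>)
    moreover have "Gamma (2 - 2 * H) \<noteq> 0" using H Gamma_real_pos[of "2 - 2 * H"] by linarith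
    ultimately show ?thesis using H by (simp add: Beta_def)
  qed
  finally show ?thesis by (simp add: energy_bound_def)
qed

section \<open>The Girsanov theorem for finitely many Gaussian increments\<close>

text \<open>
  Independence of \<open>Z\<close> and the sigma-algebra \<open>F\<close> says that \<open>w \<mapsto> (w, Z w)\<close> has a product law on \<open>F \<Otimes> borel\<close>; taking the
  identity as the first component keeps \<open>G\<close> completely general.
\<close>

lemma (in prob_space) nn_integral_indep_normal:
  assumes sub: "subalgebra M F" and Z: "distributed M lborel Z (normal_density 0 \<sigma>)"
    and ind: "indep_set (sets F) (sets (vimage_algebra (space M) Z borel))"
    and G [measurable]: "(\<lambda>(w, z). G w z) \<in> borel_measurable (F \<Otimes>\<^sub>M borel)"
  shows "(\<integral>\<^sup>+w. G w (Z w) \<partial>M) = (\<integral>\<^sup>+w. (\<integral>\<^sup>+z. ennreal (normal_density 0 \<sigma> z) * G w z \<partial>lborel) \<partial>M)"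
proof -
  have Zm [measurable]: "Z \<in> borel_measurable M" and dZ: "distr M lborel Z = density lborel (normal_density 0 \<sigma>)"
    using Z by (auto simp: distributed_def)
  have idm [measurable]: "id \<in> measurable M F" using sub by (auto simp: subalgebra_def measurable_def)
  have dZ': "distr M borel Z = density lborel (normal_density 0 \<sigma>)"
    using dZ by (metis distr_cong sets_lborel)
  interpret Zp: prob_space "distr M borel Z" by (rule prob_space_distr) measurable
  have pm: "(\<lambda>x. (id x, Z x)) \<in> measurable M (F \<Otimes>\<^sub>M borel)"
    by (rule measurable_Pair[OF idm Zm])
  interpret Fp: prob_space "distr M F id" by (rule prob_space_distr) measurable
  have spF: "space F = space M" using sub by (simp add: subalgebra_def)
  have eq: "distr M F id \<Otimes>\<^sub>M distr M borel Z = distr M (F \<Otimes>\<^sub>M borel) (\<lambda>x. (id x, Z x))"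
  proof (rule pair_measure_eqI)
    show "sigma_finite_measure (distr M F id)" "sigma_finite_measure (distr M borel Z)" by unfold_locales
    show "sets (distr M F id \<Otimes>\<^sub>M distr M borel Z) = sets (distr M (F \<Otimes>\<^sub>M borel) (\<lambda>x. (id x, Z x)))"
      by (simp cong: sets_pair_measure_cong)
    fix A B assume "A \<in> sets (distr M F id)" "B \<in> sets (distr M borel Z)"
    hence [measurable]: "A \<in> sets F" "B \<in> sets borel" by auto
    have AM: "A \<in> sets M" "A \<subseteq> space M" using sub \<open>A \<in> sets F\<close> sets.sets_into_space[of A F] by (auto simp: subalgebra_def)
    have "Z -` B \<inter> space M \<in> sets (vimage_algebra (space M) Z borel)"
      by (rule in_vimage_algebra) simp
    hence 1: "prob (A \<inter> (Z -` B \<inter> space M)) = prob A * prob (Z -` B \<inter> space M)"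
      using indep_setD[OF ind] \<open>A \<in> sets F\<close> by blast
    have 2: "(\<lambda>x. (id x, Z x)) -` (A \<times> B) \<inter> space M = A \<inter> (Z -` B \<inter> space M)" by auto
    have 3: "id -` A \<inter> space M = A" using AM by auto
    show "emeasure (distr M F id) A * emeasure (distr M borel Z) B =
        emeasure (distr M (F \<Otimes>\<^sub>M borel) (\<lambda>x. (id x, Z x))) (A \<times> B)"
      using \<open>A \<in> sets F\<close> \<open>B \<in> sets borel\<close>
      by (simp only: emeasure_distr[OF idm] emeasure_distr[OF Zm] emeasure_distr[OF pm] pair_measureI 1 2 3
          emeasure_eq_measure ennreal_mult measure_nonneg)
  qed
  have G' [measurable]: "(\<lambda>(w, z). G w z) \<in> borel_measurable (distr M F id \<Otimes>\<^sub>M distr M borel Z)"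
    using G by (simp cong: measurable_cong_sets)
  have "(\<integral>\<^sup>+w. G w (Z w) \<partial>M) = (\<integral>\<^sup>+x. (case x of (w, z) \<Rightarrow> G w z) \<partial>distr M (F \<Otimes>\<^sub>M borel) (\<lambda>x. (id x, Z x)))"
    by (subst nn_integral_distr[OF pm]) (use G in simp_all)
  also have "\<dots> = (\<integral>\<^sup>+w. (\<integral>\<^sup>+z. G w z \<partial>distr M borel Z) \<partial>distr M F id)"
    unfolding eq[symmetric] by (subst Zp.nn_integral_fst[symmetric]) (use G' in auto)
  also have "\<dots> = (\<integral>\<^sup>+w. (\<integral>\<^sup>+z. G w z \<partial>distr M borel Z) \<partial>M)"
  proof -
    have "(\<lambda>w. \<integral>\<^sup>+z. G w z \<partial>distr M borel Z) \<in> borel_measurable F"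
      using Zp.borel_measurable_nn_integral[of G F] G by (simp cong: measurable_cong_sets)
    thus ?thesis using nn_integral_distr[OF idm, of "\<lambda>w. \<integral>\<^sup>+z. G w z \<partial>distr M borel Z"] by simp
  qed
  also have "\<dots> = (\<integral>\<^sup>+w. (\<integral>\<^sup>+z. ennreal (normal_density 0 \<sigma> z) * G w z \<partial>lborel) \<partial>M)"
  proof (intro nn_integral_cong)
    fix w assume "w \<in> space M"
    hence "w \<in> space F" using sub by (simp add: subalgebra_def)
    hence [measurable]: "G w \<in> borel_measurable borel" using measurable_Pair2[OF G] by simp
    show "(\<integral>\<^sup>+z. G w z \<partial>distr M borel Z) = (\<integral>\<^sup>+z. ennreal (normal_density 0 \<sigma> z) * G w z \<partial>lborel)"
      unfolding dZ' by (subst nn_integral_density) auto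
  qed
  finally show ?thesis .
qed

lemma nn_integral_normal_shift:
  assumes \<sigma>: "\<sigma> > 0" and [measurable]: "f \<in> borel_measurable borel"
  shows "(\<integral>\<^sup>+z. ennreal (normal_density 0 \<sigma> z) * (f (z + v) * ennreal (exp (- (v * z / \<sigma>\<^sup>2) - v\<^sup>2 / (2 * \<sigma>\<^sup>2)))) \<partial>lborel)
           = (\<integral>\<^sup>+z. ennreal (normal_density 0 \<sigma> z) * f z \<partial>lborel)"
proof -
  let ?\<phi> = "\<lambda>z. ennreal (normal_density 0 \<sigma> z)"
  let ?r = "\<lambda>z. exp (- (v * z / \<sigma>\<^sup>2) - v\<^sup>2 / (2 * \<sigma>\<^sup>2))"
  have "(\<integral>\<^sup>+z. ?\<phi> z * f z \<partial>lborel) = ennreal \<bar>1\<bar> * (\<integral>\<^sup>+z. ?\<phi> (v + 1 * z) * f (v + 1 * z) \<partial>lborel)"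
    by (rule nn_integral_real_affine) auto
  also have "\<dots> = (\<integral>\<^sup>+z. ?\<phi> z * (f (z + v) * ennreal (?r z)) \<partial>lborel)"
  proof (simp, intro nn_integral_cong)
    fix z :: real
    have "normal_density 0 \<sigma> (v + z) = normal_density 0 \<sigma> z * ?r z"
      using \<sigma> by (simp add: normal_density_def exp_add[symmetric] power2_eq_square field_simps)
    hence "?\<phi> (v + z) = ?\<phi> z * ennreal (?r z)"
      by (simp add: ennreal_mult)
    thus "?\<phi> (v + z) * f (v + z) = ?\<phi> z * (f (z + v) * ennreal (?r z))"
      by (simp add: mult_ac add.commute)
  qed
  finally show ?thesis by simp
qed

locale gaussian_increments = prob_space M for M :: "'w measure" +
  fixes F :: "nat \<Rightarrow> 'w measure" and \<zeta> :: "nat \<Rightarrow> 'w \<Rightarrow> real" and \<delta> :: "nat \<Rightarrow> real" and m :: nat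
  assumes sub: "\<And>j. j \<le> m \<Longrightarrow> subalgebra M (F j)"
    and mono: "\<And>i j. i \<le> j \<Longrightarrow> j \<le> m \<Longrightarrow> sets (F i) \<subseteq> sets (F j)"
    and adapted: "\<And>j. j < m \<Longrightarrow> \<zeta> j \<in> borel_measurable (F (Suc j))"
    and pos: "\<And>j. j < m \<Longrightarrow> \<delta> j > 0"
    and normal: "\<And>j. j < m \<Longrightarrow> distributed M lborel (\<zeta> j) (normal_density 0 (sqrt (\<delta> j)))"
    and indep: "\<And>j. j < m \<Longrightarrow> indep_set (sets (F j)) (sets (vimage_algebra (space M) (\<zeta> j) borel))"
begin

lemma measurable_mono:
  assumes "f \<in> borel_measurable (F i)" "i \<le> j" "j \<le> m"
  shows "f \<in> borel_measurable (F j)"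
proof (rule measurable_from_subalg[OF _ assms(1)])
  show "subalgebra (F j) (F i)" using sub[of i] sub[of j] mono[of i j] assms by (auto simp: subalgebra_def)
qed

lemma measurable_M: "f \<in> borel_measurable (F i) \<Longrightarrow> i \<le> m \<Longrightarrow> f \<in> borel_measurable M"
  using measurable_from_subalg sub by blast

definition girsanov_density :: "(nat \<Rightarrow> 'w \<Rightarrow> real) \<Rightarrow> nat \<Rightarrow> 'w \<Rightarrow> real" where
  "girsanov_density v k w = (\<Prod>j<k. exp (- (v j w * \<zeta> j w / \<delta> j) - (v j w)\<^sup>2 / (2 * \<delta> j)))"

definition predictable :: "(nat \<Rightarrow> 'w \<Rightarrow> real) \<Rightarrow> bool" where
  "predictable v \<longleftrightarrow> (\<forall>j<m. v j \<in> borel_measurable (F j))"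

lemma shifted_measurable:
  assumes v: "predictable v" and k: "k \<le> m"
  shows "(\<lambda>w. \<lambda>j\<in>{..<k}. \<zeta> j w + v j w) \<in> measurable (F k) (Pi\<^sub>M {..<k} (\<lambda>_. borel))"
proof (rule measurable_restrict)
  fix j assume "j \<in> {..<k}"
  hence [measurable]: "\<zeta> j \<in> borel_measurable (F k)" "v j \<in> borel_measurable (F k)"
    using measurable_mono[OF adapted, of j k] measurable_mono[of "v j" j k] v k by (auto simp: predictable_def)
  show "(\<lambda>w. \<zeta> j w + v j w) \<in> borel_measurable (F k)" by measurable
qed

lemma girsanov_density_measurable:
  assumes v: "predictable v" and k: "k \<le> m"
  shows "girsanov_density v k \<in> borel_measurable (F k)"
  unfolding girsanov_density_def[abs_def]
proof (rule borel_measurable_prod)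
  fix j assume "j \<in> {..<k}"
  hence [measurable]: "\<zeta> j \<in> borel_measurable (F k)" "v j \<in> borel_measurable (F k)"
    using measurable_mono[OF adapted, of j k] measurable_mono[of "v j" j k] v k by (auto simp: predictable_def)
  show "(\<lambda>w. exp (- (v j w * \<zeta> j w / \<delta> j) - (v j w)\<^sup>2 / (2 * \<delta> j))) \<in> borel_measurable (F k)" by measurable
qed

text \<open>
  Induction on the number of increments, for all test functions at once. Conditionally on the past, the last
  increment is normal and its shift is a constant, so the one-dimensional formula removes its factor of the density
  and leaves the average \<open>\<Psi>\<close> of \<open>\<Phi>\<close> over the last coordinate, to which the induction hypothesis applies.
\<close>

lemma girsanov:
  assumes v: "predictable v"
  shows "k \<le> m \<Longrightarrow> \<Phi> \<in> borel_measurable (Pi\<^sub>M {..<k} (\<lambda>_. borel)) \<Longrightarrow>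
     (\<integral>\<^sup>+w. \<Phi> (\<lambda>j\<in>{..<k}. \<zeta> j w + v j w) * ennreal (girsanov_density v k w) \<partial>M) = (\<integral>\<^sup>+w. \<Phi> (\<lambda>j\<in>{..<k}. \<zeta> j w) \<partial>M)"
proof (induction k arbitrary: \<Phi>)
  case 0
  thus ?case by (simp add: girsanov_density_def)
next
  case (Suc k)
  hence k: "k < m" "k \<le> m" by auto
  have [measurable]: "\<Phi> \<in> borel_measurable (Pi\<^sub>M {..<Suc k} (\<lambda>_. borel))" by fact
  have eqset: "{..<Suc k} = insert k {..<k}" by auto
  have upd [measurable]: "(\<lambda>(x, y). \<Phi> (x(k := y))) \<in> borel_measurable (Pi\<^sub>M {..<k} (\<lambda>_. borel) \<Otimes>\<^sub>M borel)"
  proof -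
    have "(\<lambda>(x, y). x(k := y)) \<in> measurable (Pi\<^sub>M {..<k} (\<lambda>_. borel) \<Otimes>\<^sub>M borel) (Pi\<^sub>M {..<Suc k} (\<lambda>_. borel :: real measure))"
      unfolding eqset by (rule measurable_add_dim)
    from measurable_compose[OF this \<open>\<Phi> \<in> _\<close>] show ?thesis by (simp add: case_prod_beta')
  qed
  have "predictable (\<lambda>_ _. 0)" by (simp add: predictable_def)
  note th [measurable] = shifted_measurable[OF v k(2)] and th0' = shifted_measurable[OF this k(2)]
  have th0 [measurable]: "(\<lambda>w. \<lambda>j\<in>{..<k}. \<zeta> j w) \<in> measurable (F k) (Pi\<^sub>M {..<k} (\<lambda>_. borel))" using th0' by simp
  have [measurable]: "girsanov_density v k \<in> borel_measurable (F k)" by (rule girsanov_density_measurable[OF v k(2)])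
  have vk [measurable]: "v k \<in> borel_measurable (F k)" using v k by (auto simp: predictable_def)
  have split: "(\<lambda>j\<in>{..<Suc k}. f j) = (\<lambda>j\<in>{..<k}. f j)(k := f k)" for f :: "nat \<Rightarrow> real"
    by (auto simp: restrict_def fun_eq_iff)
  define \<sigma> where "\<sigma> = sqrt (\<delta> k)"
  have \<sigma>: "\<sigma> > 0" "\<sigma>\<^sup>2 = \<delta> k" using pos[OF k(1)] by (auto simp: \<sigma>_def)
  let ?\<phi> = "\<lambda>z. ennreal (normal_density 0 \<sigma> z)"
  let ?r = "\<lambda>w z. exp (- (v k w * z / \<sigma>\<^sup>2) - (v k w)\<^sup>2 / (2 * \<sigma>\<^sup>2))"
  note Zk = nn_integral_indep_normal[OF sub[OF k(2)] normal[OF k(1)] indep[OF k(1)], folded \<sigma>_def]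
  \<comment> \<open>The test function of the induction hypothesis.\<close>
  define \<Psi> where "\<Psi> x = (\<integral>\<^sup>+z. ?\<phi> z * \<Phi> (x(k := z)) \<partial>lborel)" for x
  have \<Psi>m: "\<Psi> \<in> borel_measurable (Pi\<^sub>M {..<k} (\<lambda>_. borel))" unfolding \<Psi>_def by measurable
  have "(\<integral>\<^sup>+w. \<Phi> (\<lambda>j\<in>{..<Suc k}. \<zeta> j w + v j w) * ennreal (girsanov_density v (Suc k) w) \<partial>M)
    = (\<integral>\<^sup>+w. \<Phi> ((\<lambda>j\<in>{..<k}. \<zeta> j w + v j w)(k := \<zeta> k w + v k w)) *
       ennreal (girsanov_density v k w * ?r w (\<zeta> k w)) \<partial>M)"
    unfolding split \<sigma>(2) by (simp add: girsanov_density_def)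
  also have "\<dots> = (\<integral>\<^sup>+w. (\<integral>\<^sup>+z. ?\<phi> z * (\<Phi> ((\<lambda>j\<in>{..<k}. \<zeta> j w + v j w)(k := z + v k w)) *
       ennreal (girsanov_density v k w * ?r w z)) \<partial>lborel) \<partial>M)"
    by (rule Zk) measurable
  also have "\<dots> = (\<integral>\<^sup>+w. \<Psi> (\<lambda>j\<in>{..<k}. \<zeta> j w + v j w) * ennreal (girsanov_density v k w) \<partial>M)"
  proof (intro nn_integral_cong)
    fix w assume w: "w \<in> space M"
    have xsp: "(\<lambda>j\<in>{..<k}. \<zeta> j w + v j w) \<in> space (Pi\<^sub>M {..<k} (\<lambda>_. borel :: real measure))" by (auto simp: space_PiM)
    let ?x = "\<lambda>j\<in>{..<k}. \<zeta> j w + v j w"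
    have [measurable]: "(\<lambda>z. \<Phi> (?x(k := z))) \<in> borel_measurable borel" using measurable_Pair2[OF upd xsp] by simp
    have gp: "girsanov_density v k w \<ge> 0" by (auto simp: girsanov_density_def intro!: prod_nonneg)
    have "(\<integral>\<^sup>+z. ?\<phi> z * (\<Phi> (?x(k := z + v k w)) *
       ennreal (girsanov_density v k w * ?r w z)) \<partial>lborel)
      = (\<integral>\<^sup>+z. ennreal (girsanov_density v k w) * (?\<phi> z * (\<Phi> (?x(k := z + v k w)) *
       ennreal (?r w z))) \<partial>lborel)"
      using gp by (intro nn_integral_cong) (simp add: ennreal_mult mult_ac)
    also have "\<dots> = ennreal (girsanov_density v k w) * (\<integral>\<^sup>+z. ?\<phi> z * (\<Phi> (?x(k := z + v k w)) *
       ennreal (?r w z)) \<partial>lborel)"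
      by (rule nn_integral_cmult) measurable
    also have "(\<integral>\<^sup>+z. ?\<phi> z * (\<Phi> (?x(k := z + v k w)) *
       ennreal (?r w z)) \<partial>lborel) = \<Psi> ?x"
      unfolding \<Psi>_def by (rule nn_integral_normal_shift[OF \<sigma>(1), of "\<lambda>z. \<Phi> (?x(k := z))"]) measurable
    finally show "(\<integral>\<^sup>+z. ?\<phi> z * (\<Phi> (?x(k := z + v k w)) *
       ennreal (girsanov_density v k w * ?r w z)) \<partial>lborel)
       = \<Psi> ?x * ennreal (girsanov_density v k w)" by (simp only: mult.commute)
  qed
  also have "\<dots> = (\<integral>\<^sup>+w. \<Psi> (\<lambda>j\<in>{..<k}. \<zeta> j w) \<partial>M)" by (rule Suc.IH[OF k(2) \<Psi>m])
  also have "\<dots> = (\<integral>\<^sup>+w. \<Phi> ((\<lambda>j\<in>{..<k}. \<zeta> j w)(k := \<zeta> k w)) \<partial>M)"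
    unfolding \<Psi>_def by (rule Zk[symmetric]) measurable
  also have "\<dots> = (\<integral>\<^sup>+w. \<Phi> (\<lambda>j\<in>{..<Suc k}. \<zeta> j w) \<partial>M)" unfolding split ..
  finally show ?case .
qed

lemma girsanov_density_pos: "girsanov_density v k w > 0"
  by (auto simp: girsanov_density_def intro!: prod_pos)

lemma girsanov_density_total:
  assumes v: "predictable v"
  shows "(\<integral>\<^sup>+w. ennreal (girsanov_density v m w) \<partial>M) = 1"
  using girsanov[OF v order_refl, of "\<lambda>_. 1"] by (simp add: emeasure_space_1)

text \<open>
  The square of the density is the density for the doubled shift \<open>2 v\<close> times \<open>exp (\<Sum> v\<^sup>2 / \<delta>)\<close>, and every such density has mean \<open>1\<close>.
\<close>

lemma girsanov_density_L2:
  assumes v: "predictable v" and A: "\<And>w. w \<in> space M \<Longrightarrow> (\<Sum>j<m. (v j w)\<^sup>2 / \<delta> j) \<le> A"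
  shows "(\<integral>\<^sup>+w. ennreal ((girsanov_density v m w)\<^sup>2) \<partial>M) \<le> ennreal (exp A)"
proof -
  have v2: "predictable (\<lambda>j w. 2 * v j w)" using v by (auto simp: predictable_def)
  have "(girsanov_density v m w)\<^sup>2 = girsanov_density (\<lambda>j w. 2 * v j w) m w * exp (\<Sum>j<m. (v j w)\<^sup>2 / \<delta> j)" for w
  proof -
    have D: "girsanov_density u m w = exp (\<Sum>j<m. - (u j w * \<zeta> j w / \<delta> j) - (u j w)\<^sup>2 / (2 * \<delta> j))" for u
      by (simp add: girsanov_density_def exp_sum)
    show ?thesis
      unfolding D exp_double[symmetric] exp_add[symmetric] sum_distrib_left sum.distrib[symmetric]
      by (intro arg_cong[of _ _ exp] sum.cong refl) (simp add: power_mult_distrib field_simps)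
  qed
  hence "(\<integral>\<^sup>+w. ennreal ((girsanov_density v m w)\<^sup>2) \<partial>M) \<le> (\<integral>\<^sup>+w. ennreal (girsanov_density (\<lambda>j w. 2 * v j w) m w) * ennreal (exp A) \<partial>M)"
    using A girsanov_density_pos[of "\<lambda>j w. 2 * v j w" m]
    by (intro nn_integral_mono) (auto simp: ennreal_mult[symmetric] less_imp_le intro!: ennreal_leI mult_left_mono)
  also have "\<dots> = ennreal (exp A)"
    using measurable_M[OF girsanov_density_measurable[OF v2 order_refl]] girsanov_density_total[OF v2]
    by (subst nn_integral_multc) auto
  finally show ?thesis .
qed

text \<open>
  With \<open>R\<close> the Girsanov density, the difference of the expectations is \<open>E (\<Phi> (\<zeta> + v) * (R - 1))\<close>, and
  \<open>E \<bar>R - 1\<bar> \<le> sqrt (E R\<^sup>2 - 1)\<close>.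
\<close>

lemma shift_total_variation:
  assumes v: "predictable v" and A: "\<And>w. w \<in> space M \<Longrightarrow> (\<Sum>j<m. (v j w)\<^sup>2 / \<delta> j) \<le> A"
    and \<Phi> [measurable]: "\<Phi> \<in> borel_measurable (Pi\<^sub>M {..<m} (\<lambda>_. borel))" and c: "\<And>x. \<bar>\<Phi> x\<bar> \<le> c"
  shows "\<bar>expectation (\<lambda>w. \<Phi> (\<lambda>j\<in>{..<m}. \<zeta> j w)) - expectation (\<lambda>w. \<Phi> (\<lambda>j\<in>{..<m}. \<zeta> j w + v j w))\<bar> \<le> c * sqrt (exp A - 1)"
proof -
  let ?R = "girsanov_density v m"
  have [measurable]: "?R \<in> borel_measurable M" using measurable_M[OF girsanov_density_measurable[OF v order_refl]] by simp
  have "predictable (\<lambda>_ _. 0)" by (simp add: predictable_def)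
  from shifted_measurable[OF this order_refl] shifted_measurable[OF v order_refl]
  have [measurable]: "(\<lambda>w. \<lambda>j\<in>{..<m}. \<zeta> j w) \<in> measurable M (Pi\<^sub>M {..<m} (\<lambda>_. borel))"
     "(\<lambda>w. \<lambda>j\<in>{..<m}. \<zeta> j w + v j w) \<in> measurable M (Pi\<^sub>M {..<m} (\<lambda>_. borel))"
    using measurable_from_subalg[OF sub[OF order_refl]] by auto
  define X where "X w = \<Phi> (\<lambda>j\<in>{..<m}. \<zeta> j w)" for w
  define Y where "Y w = \<Phi> (\<lambda>j\<in>{..<m}. \<zeta> j w + v j w)" for w
  have [measurable]: "X \<in> borel_measurable M" "Y \<in> borel_measurable M" unfolding X_def Y_def by measurable
  have c0: "c \<ge> 0" using c[of undefined] by linarith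
  have XY: "\<bar>X w\<bar> \<le> c" "\<bar>Y w\<bar> \<le> c" for w using c by (auto simp: X_def Y_def)
  have iX: "integrable M X" and iY: "integrable M Y"
    by (rule integrable_const_bound[where B=c]; use XY in auto)+
  have Rpos: "?R w \<ge> 0" for w using girsanov_density_pos[of v m w] by simp
  have iR: "integrable M ?R" using girsanov_density_total[OF v] Rpos by (intro integrableI_nonneg) auto
  have ER: "expectation ?R = 1"
    using girsanov_density_total[OF v] Rpos nn_integral_eq_integral[OF iR] by (simp add: ennreal_eq_1)
  have iR2: "integrable M (\<lambda>w. (?R w)\<^sup>2)"
    using girsanov_density_L2[OF v A] by (intro integrableI_nonneg) (auto simp: top_unique less_top[symmetric])
  have ER2: "expectation (\<lambda>w. (?R w)\<^sup>2) \<le> exp A"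
    using girsanov_density_L2[OF v A] nn_integral_eq_integral[OF iR2] by simp
  have iYR: "integrable M (\<lambda>w. Y w * ?R w)"
    by (rule Bochner_Integration.integrable_bound[OF integrable_mult_right[OF iR, of c]])
      (use XY Rpos c0 in \<open>auto simp: abs_mult intro!: mult_right_mono\<close>)
  have g: "expectation (\<lambda>w. (Y w + c) * ?R w) = expectation (\<lambda>w. X w + c)"
  proof -
    have "(\<integral>\<^sup>+w. ennreal ((Y w + c) * ?R w) \<partial>M) = (\<integral>\<^sup>+w. ennreal (X w + c) \<partial>M)"
      using girsanov[OF v order_refl, of "\<lambda>x. ennreal (\<Phi> x + c)"] Rpos
      by (simp add: X_def Y_def ennreal_mult'' )
    moreover have "Y w + c \<ge> 0" "X w + c \<ge> 0" for w using XY[of w] by auto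
    ultimately show ?thesis using Rpos by (simp add: integral_eq_nn_integral)
  qed
  have "expectation (\<lambda>w. (Y w + c) * ?R w) = expectation (\<lambda>w. Y w * ?R w) + c"
    unfolding distrib_right using iYR iR ER by simp
  moreover have "expectation (\<lambda>w. X w + c) = expectation X + c" using iX by (simp add: prob_space)
  ultimately have "expectation X = expectation (\<lambda>w. Y w * ?R w)" using g by simp
  hence "expectation X - expectation Y = expectation (\<lambda>w. Y w * (?R w - 1))"
    unfolding right_diff_distrib using iYR iY by simp
  also have "\<bar>\<dots>\<bar> \<le> expectation (\<lambda>w. \<bar>Y w * (?R w - 1)\<bar>)" by (rule integral_abs_bound)
  also have "\<dots> \<le> expectation (\<lambda>w. c * \<bar>?R w - 1\<bar>)"
  proof (rule integral_mono)
    show "integrable M (\<lambda>w. \<bar>Y w * (?R w - 1)\<bar>)" unfolding right_diff_distrib using iYR iY by auto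
    show "integrable M (\<lambda>w. c * \<bar>?R w - 1\<bar>)" using iR by auto
  qed (use XY in \<open>auto simp: abs_mult intro!: mult_right_mono\<close>)
  also have "\<dots> = c * expectation (\<lambda>w. \<bar>?R w - 1\<bar>)" by simp
  also have "expectation (\<lambda>w. \<bar>?R w - 1\<bar>) \<le> sqrt (exp A - 1)"
  proof -
    have i1: "integrable M (\<lambda>w. (\<bar>?R w - 1\<bar>)\<^sup>2)" using iR iR2 by (simp add: power2_diff)
    have i2: "integrable M (\<lambda>w. \<bar>?R w - 1\<bar>)" using iR by auto
    have "0 \<le> variance (\<lambda>w. \<bar>?R w - 1\<bar>)" by (rule variance_positive)
    also have "\<dots> = expectation (\<lambda>w. (\<bar>?R w - 1\<bar>)\<^sup>2) - (expectation (\<lambda>w. \<bar>?R w - 1\<bar>))\<^sup>2"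
      by (rule variance_eq[OF i2 i1])
    also have "expectation (\<lambda>w. (\<bar>?R w - 1\<bar>)\<^sup>2) = expectation (\<lambda>w. (?R w)\<^sup>2) - 1"
      using iR iR2 ER by (simp add: power2_diff prob_space)
    finally have "(expectation (\<lambda>w. \<bar>?R w - 1\<bar>))\<^sup>2 \<le> exp A - 1" using ER2 by linarith
    thus ?thesis by (rule real_le_rsqrt)
  qed
  finally have "\<bar>expectation X - expectation Y\<bar> \<le> c * sqrt (exp A - 1)" using c0 by (simp add: mult_left_mono)
  thus ?thesis unfolding X_def[abs_def] Y_def[abs_def] .
qed

end

section \<open>Euler schemes and partitions\<close>

text \<open>
  The accumulated drift of the Euler scheme, kept apart from the noise \<open>\<beta>\<close>. The noise then enters through its values and not its
  increments, so perturbing all \<open>\<beta> i\<close> by \<open>\<epsilon>\<close> does not accumulate errors over the steps.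
\<close>

primrec euler_drift :: "(nat \<Rightarrow> real \<Rightarrow> real) \<Rightarrow> real \<Rightarrow> (nat \<Rightarrow> real) \<Rightarrow> nat \<Rightarrow> real" where
  "euler_drift D x \<beta> 0 = 0"
| "euler_drift D x \<beta> (Suc i) = euler_drift D x \<beta> i + D i (x + euler_drift D x \<beta> i + \<beta> i)"

definition euler :: "(nat \<Rightarrow> real \<Rightarrow> real) \<Rightarrow> real \<Rightarrow> (nat \<Rightarrow> real) \<Rightarrow> nat \<Rightarrow> real" where
  "euler D x \<beta> i = x + euler_drift D x \<beta> i + \<beta> i"

lemma discrete_Gronwall:
  fixes e :: "nat \<Rightarrow> real"
  assumes "\<kappa> \<ge> 0" "e 0 \<le> 0" "\<And>i. i < n \<Longrightarrow> e (Suc i) \<le> (1 + \<kappa>) * e i + \<kappa> * w"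
  shows "i \<le> n \<Longrightarrow> e i \<le> w * ((1 + \<kappa>) ^ i - 1)"
proof (induction i)
  case (Suc i)
  have "e (Suc i) \<le> (1 + \<kappa>) * e i + \<kappa> * w" using assms(3) Suc by simp
  also have "\<dots> \<le> (1 + \<kappa>) * (w * ((1 + \<kappa>) ^ i - 1)) + \<kappa> * w"
    using Suc assms(1) by (intro add_right_mono mult_left_mono) auto
  finally show ?case by (simp add: algebra_simps)
qed (use assms in simp)

lemma one_plus_power_le_exp: "(\<kappa>::real) \<ge> 0 \<Longrightarrow> (1 + \<kappa>) ^ n \<le> exp (real n * \<kappa>)"
  using power_mono[of "1 + \<kappa>" "exp \<kappa>" n] exp_ge_add_one_self[of \<kappa>] by (simp add: exp_of_nat_mult)

lemma euler_Lipschitz_noise: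
  assumes D: "\<And>i z z'. i < n \<Longrightarrow> \<bar>D i z - D i z'\<bar> \<le> \<kappa> * \<bar>z - z'\<bar>" and \<kappa>: "\<kappa> \<ge> 0"
    and \<beta>: "\<And>i. i \<le> n \<Longrightarrow> \<bar>\<beta> i - \<beta>' i\<bar> \<le> \<epsilon>"
  shows "\<bar>euler D x \<beta> n - euler D x \<beta>' n\<bar> \<le> exp (real n * \<kappa>) * \<epsilon>"
proof -
  let ?e = "\<lambda>i. \<bar>euler_drift D x \<beta> i - euler_drift D x \<beta>' i\<bar>"
  have \<epsilon>: "\<epsilon> \<ge> 0" using \<beta>[of 0] by linarith
  have "?e (Suc i) \<le> (1 + \<kappa>) * ?e i + \<kappa> * \<epsilon>" if "i < n" for i
  proof -
    have "?e (Suc i) \<le> ?e i + \<bar>D i (x + euler_drift D x \<beta> i + \<beta> i) - D i (x + euler_drift D x \<beta>' i + \<beta>' i)\<bar>" by simp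
    also have "\<dots> \<le> ?e i + \<kappa> * \<bar>(x + euler_drift D x \<beta> i + \<beta> i) - (x + euler_drift D x \<beta>' i + \<beta>' i)\<bar>"
      by (intro add_left_mono D[OF that])
    also have "\<dots> \<le> ?e i + \<kappa> * (?e i + \<epsilon>)"
      using \<beta>[of i] that \<kappa> by (intro add_left_mono mult_left_mono) auto
    finally show ?thesis by (simp add: algebra_simps)
  qed
  from discrete_Gronwall[where e="?e" and n=n and w=\<epsilon>, OF \<kappa> _ this, of n]
  have "?e n \<le> \<epsilon> * ((1 + \<kappa>) ^ n - 1)" by simp
  also have "\<dots> \<le> \<epsilon> * (exp (real n * \<kappa>) - 1)"
    using one_plus_power_le_exp[OF \<kappa>, of n] \<epsilon> by (intro mult_left_mono) auto
  finally have "?e n \<le> \<epsilon> * exp (real n * \<kappa>) - \<epsilon>" by (simp add: algebra_simps)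
  thus ?thesis using \<beta>[of n] by (simp add: euler_def mult.commute)
qed

text \<open>
  If the noise is shifted by \<open>h\<close> with exactly these increments, the scheme started at \<open>y\<close> follows the one started at
  \<open>x\<close> at the prescribed distance \<open>g\<close>.
\<close>

lemma euler_coupling:
  assumes h: "h 0 = 0" "\<And>i. i < n \<Longrightarrow> h (Suc i) - h i = g (Suc i) - g i + D i (euler D x \<beta> i) - D i (euler D x \<beta> i + g i)"
    and y: "y = x + g 0"
  shows "i \<le> n \<Longrightarrow> euler D y (\<lambda>i. \<beta> i + h i) i = euler D x \<beta> i + g i"
proof (induction i)
  case 0
  thus ?case using h y by (simp add: euler_def)
next
  case (Suc i)
  let ?\<beta> = "\<lambda>i. \<beta> i + h i"
  have IH: "euler D y ?\<beta> i = euler D x \<beta> i + g i" using Suc by simp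
  have step: "euler D z \<gamma> (Suc i) = euler D z \<gamma> i + D i (euler D z \<gamma> i) + (\<gamma> (Suc i) - \<gamma> i)" for z \<gamma>
    by (simp add: euler_def add_ac)
  show ?case unfolding step[of y] step[of x] IH using h(2)[of i] Suc(2) by simp
qed

lemma euler_measurable:
  assumes [measurable]: "\<And>i. D i \<in> borel_measurable borel" and "\<And>j. j \<le> i \<Longrightarrow> (\<lambda>w. \<beta> w j) \<in> borel_measurable N"
  shows "(\<lambda>w. euler D x (\<beta> w) i) \<in> borel_measurable N"
proof -
  have "(\<lambda>w. euler_drift D x (\<beta> w) i) \<in> borel_measurable N" using assms(2)
  proof (induction i)
    case (Suc i)
    hence [measurable]: "(\<lambda>w. euler_drift D x (\<beta> w) i) \<in> borel_measurable N" "(\<lambda>w. \<beta> w i) \<in> borel_measurable N" by auto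
    show ?case by simp
  qed simp
  moreover have "(\<lambda>w. \<beta> w i) \<in> borel_measurable N" by (rule assms(2)) simp
  ultimately show ?thesis unfolding euler_def by measurable
qed

lemma finite_set_increasing_enumeration:
  fixes P :: "real set"
  assumes "finite P" "P \<noteq> {}"
  obtains m :: nat and s where "\<And>i j. i < j \<Longrightarrow> j \<le> m \<Longrightarrow> s i < s j" "s ` {..m} = P"
proof (rule that[of "card P - 1" "(!) (sorted_list_of_set P)"])
  let ?l = "sorted_list_of_set P"
  have len: "length ?l = card P" "card P > 0" using assms by (auto simp: card_gt_0_iff)
  show "?l ! i < ?l ! j" if "i < j" "j \<le> card P - 1" for i j
    using strict_sorted_list_of_set[of P] that len by (auto simp: sorted_wrt_iff_nth_less)
  have "(!) ?l ` {..card P - 1} = (!) ?l ` {..<length ?l}" using len by (intro arg_cong[of _ _ "image _"]) auto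
  also have "\<dots> = set ?l" by (auto simp: set_conv_nth)
  finally show "(!) ?l ` {..card P - 1} = P" using assms by simp
qed

text \<open>
  On a partition that contains all break points, an integral of a step function is a sum over the cells of the partition,
  with the value of the step function at the right end point of a cell. This applies to any integrator \<open>F\<close>: below,
  to the Wiener process and to its shift.
\<close>

lemma step_integral_refine:
  fixes s :: "nat \<Rightarrow> real" and F :: "real \<Rightarrow> 'w \<Rightarrow> real"
  assumes s: "\<And>i j. i < j \<Longrightarrow> j \<le> m \<Longrightarrow> s i < s j"
    and P: "\<And>i. i \<le> n \<Longrightarrow> \<tau> i \<in> s ` {..m}" and mono: "\<And>i. i < n \<Longrightarrow> \<tau> i \<le> \<tau> (Suc i)"
  shows "step_integral F n \<tau> c w = (\<Sum>j<m. step_fun n \<tau> c (s (Suc j)) * (F (s (Suc j)) w - F (s j) w))"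
proof -
  have tel: "F (\<tau> (Suc i)) w - F (\<tau> i) w = (\<Sum>j<m. indicator {\<tau> i<..\<tau> (Suc i)} (s (Suc j)) * (F (s (Suc j)) w - F (s j) w))"
    if i: "i < n" for i
  proof -
    obtain a b where ab: "a \<le> m" "b \<le> m" "\<tau> i = s a" "\<tau> (Suc i) = s b"
      using P[of i] P[of "Suc i"] i by auto
    have le: "s i' \<le> s j' \<longleftrightarrow> i' \<le> j'" if "i' \<le> m" "j' \<le> m" for i' j'
      using s[of i' j'] s[of j' i'] that by (metis le_less linorder_not_le order.asym)
    have "a \<le> b" using mono[OF i] ab le by auto
    have "(\<Sum>j<m. indicator {\<tau> i<..\<tau> (Suc i)} (s (Suc j)) * (F (s (Suc j)) w - F (s j) w))
       = (\<Sum>j<m. if j \<in> {a..<b} then F (s (Suc j)) w - F (s j) w else 0)"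
    proof (intro sum.cong refl)
      fix j assume "j \<in> {..<m}"
      hence "s a < s (Suc j) \<longleftrightarrow> a \<le> j" "s (Suc j) \<le> s b \<longleftrightarrow> j < b"
        using le[of "Suc j" a] le[of "Suc j" b] ab by auto
      thus "indicator {\<tau> i<..\<tau> (Suc i)} (s (Suc j)) * (F (s (Suc j)) w - F (s j) w) = (if j \<in> {a..<b} then F (s (Suc j)) w - F (s j) w else 0)"
        by (auto simp: ab indicator_def)
    qed
    also have "\<dots> = (\<Sum>j\<in>{a..<b}. F (s (Suc j)) w - F (s j) w)"
      using ab by (subst sum.inter_filter[symmetric]) (auto intro!: sum.cong)
    also have "\<dots> = F (s b) w - F (s a) w" using \<open>a \<le> b\<close> by (rule sum_Suc_diff')
    finally show ?thesis using ab by simp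
  qed
  have "step_integral F n \<tau> c w = (\<Sum>i<n. \<Sum>j<m. c i * indicator {\<tau> i<..\<tau> (Suc i)} (s (Suc j)) * (F (s (Suc j)) w - F (s j) w))"
    unfolding step_integral_def by (intro sum.cong refl) (simp only: tel lessThan_iff sum_distrib_left mult.assoc)
  also have "\<dots> = (\<Sum>j<m. \<Sum>i<n. c i * indicator {\<tau> i<..\<tau> (Suc i)} (s (Suc j)) * (F (s (Suc j)) w - F (s j) w))"
    by (rule sum.swap)
  also have "\<dots> = (\<Sum>j<m. step_fun n \<tau> c (s (Suc j)) * (F (s (Suc j)) w - F (s j) w))"
    by (simp only: step_fun_def sum_distrib_right)
  finally show ?thesis .
qed

lemma integral_Cauchy_Schwarz:
  fixes f g :: "'a \<Rightarrow> real"
  assumes [measurable]: "f \<in> borel_measurable M" "g \<in> borel_measurable M"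
    and f: "integrable M (\<lambda>x. (f x)\<^sup>2)" and g: "integrable M (\<lambda>x. (g x)\<^sup>2)"
  shows "integrable M (\<lambda>x. f x * g x)" "(LINT x|M. f x * g x)\<^sup>2 \<le> (LINT x|M. (f x)\<^sup>2) * (LINT x|M. (g x)\<^sup>2)"
proof -
  have "(\<integral>\<^sup>+x. ennreal \<bar>f x\<bar> * ennreal \<bar>g x\<bar> \<partial>M)\<^sup>2 \<le> (\<integral>\<^sup>+x. (ennreal \<bar>f x\<bar>)\<^sup>2 \<partial>M) * (\<integral>\<^sup>+x. (ennreal \<bar>g x\<bar>)\<^sup>2 \<partial>M)"
    by (rule Cauchy_Schwarz_nn_integral) measurable
  also have "(\<integral>\<^sup>+x. (ennreal \<bar>f x\<bar>)\<^sup>2 \<partial>M) = ennreal (LINT x|M. (f x)\<^sup>2)"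
    using nn_integral_eq_integral[OF f] by (simp add: ennreal_power)
  also have "(\<integral>\<^sup>+x. (ennreal \<bar>g x\<bar>)\<^sup>2 \<partial>M) = ennreal (LINT x|M. (g x)\<^sup>2)"
    using nn_integral_eq_integral[OF g] by (simp add: ennreal_power)
  finally have CS: "(\<integral>\<^sup>+x. ennreal (norm (f x * g x)) \<partial>M)\<^sup>2 \<le> ennreal ((LINT x|M. (f x)\<^sup>2) * (LINT x|M. (g x)\<^sup>2))"
    by (simp add: ennreal_mult[symmetric] abs_mult)
  hence "(\<integral>\<^sup>+x. ennreal (norm (f x * g x)) \<partial>M) < \<infinity>"
    using power_eq_top_ennreal[of "\<integral>\<^sup>+x. ennreal (norm (f x * g x)) \<partial>M" 2]
    by (auto simp: top_unique less_top[symmetric] simp del: real_norm_def)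
  thus int: "integrable M (\<lambda>x. f x * g x)" by (intro integrableI_bounded) auto
  have "(\<integral>\<^sup>+x. ennreal (norm (f x * g x)) \<partial>M) = ennreal (LINT x|M. \<bar>f x * g x\<bar>)"
    using nn_integral_eq_integral[OF integrable_norm[OF int]] by simp
  with CS have "(LINT x|M. \<bar>f x * g x\<bar>)\<^sup>2 \<le> (LINT x|M. (f x)\<^sup>2) * (LINT x|M. (g x)\<^sup>2)"
    by (simp add: ennreal_power)
  moreover have "(LINT x|M. f x * g x)\<^sup>2 \<le> (LINT x|M. \<bar>f x * g x\<bar>)\<^sup>2"
    using integral_abs_bound[of M "\<lambda>x. f x * g x"] by (simp add: abs_le_square_iff[symmetric])
  ultimately show "(LINT x|M. f x * g x)\<^sup>2 \<le> (LINT x|M. (f x)\<^sup>2) * (LINT x|M. (g x)\<^sup>2)" by linarith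
qed

section \<open>The coupling of two Euler schemes\<close>

text \<open>
  The distance at which the second path is kept: it equals \<open>d\<close> at time \<open>0\<close> and \<open>0\<close> at time \<open>T\<close>.
\<close>

definition hyp_shift :: "real \<Rightarrow> real \<Rightarrow> real \<Rightarrow> real \<Rightarrow> real" where
  "hyp_shift K T d s = d * sinh (K * (T - s)) / sinh (K * T)"

definition hyp_shift_deriv :: "real \<Rightarrow> real \<Rightarrow> real \<Rightarrow> real \<Rightarrow> real" where
  "hyp_shift_deriv K T d s = - d * K * cosh (K * (T - s)) / sinh (K * T)"

lemma hyp_shift_deriv_measurable [measurable]: "hyp_shift_deriv K T d \<in> borel_measurable borel"
  unfolding hyp_shift_deriv_def cosh_def by measurable

lemma hyp_shift_has_deriv:
  "(hyp_shift K T d has_real_derivative hyp_shift_deriv K T d s) (at s)"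
proof -
  have "((\<lambda>s. (d / sinh (K * T)) * sinh (K * (T - s))) has_real_derivative (d / sinh (K * T)) * (cosh (K * (T - s)) * (- K))) (at s)"
    by (intro DERIV_cmult) (auto intro!: derivative_eq_intros)
  thus ?thesis by (simp add: hyp_shift_def[abs_def] hyp_shift_deriv_def mult_ac)
qed

lemma hyp_shift_ends:
  assumes "K > 0" "T > 0"
  shows "hyp_shift K T d 0 = d" "hyp_shift K T d T = 0"
  using assms by (simp_all add: hyp_shift_def)

text \<open>
  The hyperbolic profile makes \<open>\<bar>g'\<bar> + K \<bar>g\<bar>\<close> an exponential, decreasing in time, whose value at \<open>0\<close> is the stated constant.
  The two time arguments allow \<open>g\<close> to be frozen at the left end point of a grid cell at no cost.
\<close>

lemma hyp_shift_bound:
  assumes K: "K > 0" and T: "T > 0" and s: "0 \<le> t" "t \<le> s" "s \<le> T"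
  shows "\<bar>hyp_shift_deriv K T d s\<bar> + K * \<bar>hyp_shift K T d t\<bar> \<le> 2 * K * \<bar>d\<bar> / (1 - exp (- 2 * K * T))"
proof -
  have sh: "sinh (K * T) > 0" using K T by simp
  have le: "K * (T - s) \<le> K * (T - t)" "0 \<le> K * (T - s)" "0 \<le> K * (T - t)" "K * (T - t) \<le> K * T" using K s by auto
  have c1: "cosh (K * (T - s)) \<le> cosh (K * (T - t))" using le by (subst cosh_real_nonneg_le_iff) auto
  have "\<bar>hyp_shift_deriv K T d s\<bar> + K * \<bar>hyp_shift K T d t\<bar> = K * \<bar>d\<bar> / sinh (K * T) * (cosh (K * (T - s)) + sinh (K * (T - t)))"
    using K sh le by (simp add: hyp_shift_def hyp_shift_deriv_def abs_mult algebra_simps add_divide_distrib)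
  also have "\<dots> \<le> K * \<bar>d\<bar> / sinh (K * T) * (cosh (K * (T - t)) + sinh (K * (T - t)))"
    using K sh c1 by (intro mult_left_mono) auto
  also have "cosh (K * (T - t)) + sinh (K * (T - t)) = exp (K * (T - t))" by (rule cosh_plus_sinh)
  also have "K * \<bar>d\<bar> / sinh (K * T) * exp (K * (T - t)) \<le> K * \<bar>d\<bar> / sinh (K * T) * exp (K * T)"
    using K sh le by (intro mult_left_mono) auto
  also have "\<dots> = 2 * K * \<bar>d\<bar> / (1 - exp (- 2 * K * T))"
  proof -
    have "exp (- 2 * K * T) = exp (- (K * T)) * exp (- (K * T))" unfolding exp_add[symmetric] by simp
    hence sh': "sinh (K * T) = exp (K * T) * (1 - exp (- 2 * K * T)) / 2"
      by (simp add: sinh_def algebra_simps exp_add[symmetric] flip: mult.assoc)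
    show ?thesis unfolding sh' by simp
  qed
  finally show ?thesis .
qed

lemma emeasure_lborel_Ioc_finite: "emeasure lborel {u<..v::real} < top"
  by (cases "u \<le> v") auto

text \<open>
  The drift is assumed to be defined, measurable and Lipschitz for all times; a drift on \<open>{0..T}\<close> is extended by \<open>0\<close>.
\<close>

locale lipschitz_drift =
  fixes b :: "real \<Rightarrow> real \<Rightarrow> real" and K T \<beta>0 :: real
  assumes b_meas [measurable]: "(\<lambda>(t, x). b t x) \<in> borel_measurable (borel \<Otimes>\<^sub>M borel)"
    and K: "K > 0" and T: "T > 0"
    and b_Lip: "\<And>t x y. \<bar>b t x - b t y\<bar> \<le> K * \<bar>x - y\<bar>"
    and b_0: "\<And>t. \<bar>b t 0\<bar> \<le> \<beta>0"
begin

definition grid :: "nat \<Rightarrow> nat \<Rightarrow> real" where "grid n i = real i * (T / real n)"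

text \<open>
  The drift is integrated over a cell, since it is only measurable in time and its values at the grid points carry no information.
\<close>

definition mean_drift :: "nat \<Rightarrow> nat \<Rightarrow> real \<Rightarrow> real" where
  "mean_drift n i z = (LINT s:{grid n i<..grid n (Suc i)}|lborel. b s z)"

lemma grid_mono: "i \<le> j \<Longrightarrow> grid n i \<le> grid n j"
  using T by (simp add: grid_def divide_right_mono mult_right_mono)

lemma grid_0 [simp]: "grid n 0 = 0" by (simp add: grid_def)

lemma grid_n: "n > 0 \<Longrightarrow> grid n n = T" by (simp add: grid_def)

lemma grid_bounds: "n > 0 \<Longrightarrow> i \<le> n \<Longrightarrow> grid n i \<in> {0..T}"
  using grid_mono[of 0 i n] grid_mono[of i n n] grid_n[of n] by simp

lemma grid_step: "grid n (Suc i) - grid n i = T / real n"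
  by (simp add: grid_def algebra_simps add_divide_distrib)

lemma b_bound: "\<bar>b t z\<bar> \<le> \<beta>0 + K * \<bar>z\<bar>"
  using b_0[of t] b_Lip[of t z 0] by simp

lemma set_integrable_bounded_interval:
  fixes f :: "real \<Rightarrow> real"
  assumes [measurable]: "f \<in> borel_measurable borel" and f: "\<And>s. s \<in> A \<Longrightarrow> \<bar>f s\<bar> \<le> c"
    and [measurable]: "A \<in> sets borel" and A: "emeasure lborel A < \<infinity>"
  shows "set_integrable lborel A f"
  unfolding set_integrable_def
  by (rule integrableI_bounded_set_indicator[where B=c]) (use f A in auto)

lemma b_section [measurable]: "(\<lambda>s. b s z) \<in> borel_measurable borel"
  by measurable

lemma set_integrable_b: "set_integrable lborel {u<..v} (\<lambda>s. b s z)"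
  by (rule set_integrable_bounded_interval[where c="\<beta>0 + K * \<bar>z\<bar>"]) (auto simp: b_bound emeasure_lborel_Ioc_finite)

lemma mean_drift_measurable [measurable]: "mean_drift n i \<in> borel_measurable borel"
  unfolding mean_drift_def[abs_def] set_lebesgue_integral_def by measurable

lemma mean_drift_Lipschitz:
  "\<bar>mean_drift n i z - mean_drift n i z'\<bar> \<le> K * T / real n * \<bar>z - z'\<bar>"
proof -
  have "mean_drift n i z - mean_drift n i z' = (LINT s:{grid n i<..grid n (Suc i)}|lborel. b s z - b s z')"
    unfolding mean_drift_def using set_integrable_b by (subst set_integral_diff) auto
  also have "\<bar>\<dots>\<bar> \<le> (LINT s:{grid n i<..grid n (Suc i)}|lborel. K * \<bar>z - z'\<bar>)"
    unfolding set_lebesgue_integral_def real_norm_def[symmetric]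
  proof (rule Bochner_Integration.integral_norm_bound_integral)
    show "integrable lborel (\<lambda>s. indicat_real {grid n i<..grid n (Suc i)} s *\<^sub>R (b s z - b s z'))"
      using set_integral_diff(1)[OF set_integrable_b set_integrable_b] by (simp add: set_integrable_def)
    show "integrable lborel (\<lambda>s. indicat_real {grid n i<..grid n (Suc i)} s *\<^sub>R (K * norm (z - z')))"
      by (rule integrableI_bounded_set_indicator[where B="K * \<bar>z - z'\<bar>"]) (use K in \<open>auto simp: abs_mult emeasure_lborel_Ioc_finite\<close>)
    show "norm (indicat_real {grid n i<..grid n (Suc i)} s *\<^sub>R (b s z - b s z')) \<le> indicat_real {grid n i<..grid n (Suc i)} s *\<^sub>R (K * norm (z - z'))" for s
      using b_Lip[of s z z'] by (simp add: indicator_def)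
  qed
  also have "\<dots> = K * T / real n * \<bar>z - z'\<bar>"
    using grid_mono[of i "Suc i" n] grid_step[of n i] by (simp add: set_integral_const)
  finally show ?thesis .
qed

lemma euler_Lipschitz:
  assumes n: "n > 0" and \<beta>: "\<And>i. i \<le> n \<Longrightarrow> \<bar>\<beta> i - \<beta>' i\<bar> \<le> \<epsilon>"
  shows "\<bar>euler (mean_drift n) x \<beta> n - euler (mean_drift n) x \<beta>' n\<bar> \<le> exp (K * T) * \<epsilon>"
  using euler_Lipschitz_noise[of n "mean_drift n" "K * T / real n" \<beta> \<beta>' \<epsilon> x] mean_drift_Lipschitz \<beta> n K T by simp

text \<open>
  The function \<open>\<eta>\<close> for the Euler scheme: \<open>e i\<close> is the position of the scheme at the left end of the cell, so on
  each cell \<open>\<eta>\<close> depends on the past only.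
\<close>

definition coupling_drift :: "nat \<Rightarrow> real \<Rightarrow> (nat \<Rightarrow> real) \<Rightarrow> real \<Rightarrow> real" where
  "coupling_drift n d e s = (\<Sum>i<n. indicator {grid n i<..grid n (Suc i)} s *
     (hyp_shift_deriv K T d s + b s (e i) - b s (e i + hyp_shift K T d (grid n i))))"

lemma coupling_drift_on:
  assumes i: "i < n" and s: "s \<in> {grid n i<..grid n (Suc i)}"
  shows "coupling_drift n d e s = hyp_shift_deriv K T d s + b s (e i) - b s (e i + hyp_shift K T d (grid n i))"
proof -
  have "indicator {grid n j<..grid n (Suc j)} s = (if j = i then 1 else (0::real))" if "j < n" for j
  proof -
    consider "j < i" | "j = i" | "i < j" by linarith
    thus ?thesis
      using s grid_mono[of "Suc j" i n] grid_mono[of "Suc i" j n] by cases (auto simp: indicator_def)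
  qed
  hence "coupling_drift n d e s = (\<Sum>j<n. if j = i then hyp_shift_deriv K T d s + b s (e j) - b s (e j + hyp_shift K T d (grid n j)) else 0)"
    unfolding coupling_drift_def by (intro sum.cong) auto
  thus ?thesis using i by simp
qed

lemma coupling_drift_bound:
  assumes n: "n > 0"
  shows "\<bar>coupling_drift n d e s\<bar> \<le> 2 * K * \<bar>d\<bar> / (1 - exp (- 2 * K * T))"
proof (cases "\<exists>i<n. s \<in> {grid n i<..grid n (Suc i)}")
  case True
  then obtain i where i: "i < n" "s \<in> {grid n i<..grid n (Suc i)}" by blast
  have "\<bar>coupling_drift n d e s\<bar> \<le> \<bar>hyp_shift_deriv K T d s\<bar> + \<bar>b s (e i) - b s (e i + hyp_shift K T d (grid n i))\<bar>"
    unfolding coupling_drift_on[OF i] by linarith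
  also have "\<dots> \<le> \<bar>hyp_shift_deriv K T d s\<bar> + K * \<bar>hyp_shift K T d (grid n i)\<bar>"
    using b_Lip[of s "e i" "e i + hyp_shift K T d (grid n i)"] by simp
  also have "\<dots> \<le> 2 * K * \<bar>d\<bar> / (1 - exp (- 2 * K * T))"
    using grid_bounds[OF n, of i] grid_bounds[OF n, of "Suc i"] i by (intro hyp_shift_bound[OF K T]) auto
  finally show ?thesis .
next
  case False
  hence "coupling_drift n d e s = 0" unfolding coupling_drift_def by (intro sum.neutral) auto
  thus ?thesis using K T by simp
qed

lemma coupling_drift_measurable [measurable]: "coupling_drift n d e \<in> borel_measurable borel"
  unfolding coupling_drift_def[abs_def] by measurable

text \<open>
  The increment over a cell of the noise shift \<open>\<integral>\<eta>\<close> is the one required by \<open>euler_coupling\<close>; this is where the averaged drift is needed.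
\<close>

lemma coupling_drift_increment:
  assumes n: "n > 0" and i: "i < n"
  shows "(LINT s:{0<..<grid n (Suc i)}|lborel. coupling_drift n d e s) - (LINT s:{0<..<grid n i}|lborel. coupling_drift n d e s)
    = hyp_shift K T d (grid n (Suc i)) - hyp_shift K T d (grid n i) + mean_drift n i (e i) - mean_drift n i (e i + hyp_shift K T d (grid n i))"
proof -
  let ?c = "coupling_drift n d e" let ?u = "grid n i" let ?v = "grid n (Suc i)"
  have uv: "0 \<le> ?u" "?u \<le> ?v" using grid_mono[of 0 i n] grid_mono[of i "Suc i" n] by auto
  have int: "set_integrable lborel {p<..q} ?c" for p q
    by (rule set_integrable_bounded_interval[OF _ coupling_drift_bound[OF n]]) (auto simp: emeasure_lborel_Ioc_finite)
  \<comment> \<open>Open and half-open intervals differ by a null set.\<close>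
  have eqo: "(LINT s:{0<..<q}|lborel. ?c s) = (LINT s:{0<..q}|lborel. ?c s)" for q
  proof (rule set_integral_cong_set)
    show "set_borel_measurable lborel {0<..<q} ?c" "set_borel_measurable lborel {0<..q} ?c"
      unfolding set_borel_measurable_def by measurable
    have "AE s in lborel. s \<noteq> q" by (rule AE_lborel_singleton)
    thus "AE s in lborel. (s \<in> {0<..q}) = (s \<in> {0<..<q})" by eventually_elim auto
  qed
  have "{0<..?v} = {0<..?u} \<union> {?u<..?v}" using uv by auto
  hence "(LINT s:{0<..?v}|lborel. ?c s) = (LINT s:{0<..?u}|lborel. ?c s) + (LINT s:{?u<..?v}|lborel. ?c s)"
    using int by (simp, intro set_integral_Un) auto
  hence "(LINT s:{0<..<?v}|lborel. ?c s) - (LINT s:{0<..<?u}|lborel. ?c s) = (LINT s:{?u<..?v}|lborel. ?c s)"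
    unfolding eqo by simp
  also have "\<dots> = (LINT s:{?u<..?v}|lborel. (hyp_shift_deriv K T d s + b s (e i)) - b s (e i + hyp_shift K T d ?u))"
    by (rule set_lebesgue_integral_cong) (auto simp: coupling_drift_on[OF i])
  also have "\<dots> = (LINT s:{?u<..?v}|lborel. hyp_shift_deriv K T d s) + mean_drift n i (e i) - mean_drift n i (e i + hyp_shift K T d ?u)"
  proof -
    have cont: "continuous_on UNIV (hyp_shift_deriv K T d)"
      unfolding hyp_shift_deriv_def cosh_def by (intro continuous_intros) (use K T in auto)
    have "set_integrable lborel {?u..?v} (hyp_shift_deriv K T d)"
      by (rule borel_integrable_compact[folded set_integrable_def]) (auto intro: continuous_on_subset[OF cont])
    hence i1: "set_integrable lborel {?u<..?v} (hyp_shift_deriv K T d)"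
      by (rule set_integrable_subset) auto
    note ib = set_integrable_b[of ?u ?v]
    show ?thesis unfolding mean_drift_def
      using set_integral_diff(2)[OF set_integral_add(1)[OF i1 ib[of "e i"]] ib[of "e i + hyp_shift K T d ?u"]]
        set_integral_add(2)[OF i1 ib[of "e i"]] by simp
  qed
  also have "(LINT s:{?u<..?v}|lborel. hyp_shift_deriv K T d s) = hyp_shift K T d ?v - hyp_shift K T d ?u"
  proof -
    have "(LINT s:{?u<..?v}|lborel. hyp_shift_deriv K T d s) = (LINT s:{?u..?v}|lborel. hyp_shift_deriv K T d s)"
    proof (rule set_integral_cong_set)
      show "set_borel_measurable lborel {?u..?v} (hyp_shift_deriv K T d)" "set_borel_measurable lborel {?u<..?v} (hyp_shift_deriv K T d)"
        unfolding set_borel_measurable_def by measurable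
      have "AE s in lborel. s \<noteq> ?u" by (rule AE_lborel_singleton)
      thus "AE s in lborel. (s \<in> {?u..?v}) = (s \<in> {?u<..?v})" by eventually_elim auto
    qed
    also have "\<dots> = hyp_shift K T d ?v - hyp_shift K T d ?u"
      unfolding set_lebesgue_integral_def
    proof (rule integral_FTC_Icc)
      show "(hyp_shift K T d has_vector_derivative hyp_shift_deriv K T d x) (at x within {?u..?v})" for x
        using hyp_shift_has_deriv[of K T d x] has_field_derivative_at_within has_real_derivative_iff_has_vector_derivative by blast
      show "continuous_on {?u..?v} (hyp_shift_deriv K T d)"
        unfolding hyp_shift_deriv_def cosh_def by (intro continuous_intros) (use K T in auto)
    qed (use uv in auto)
    finally show ?thesis .
  qed
  finally show ?thesis by simp
qed

lemma coupled_euler: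
  assumes n: "n > 0" and \<beta>: "\<And>i. e i = euler (mean_drift n) x \<beta> i"
  shows "euler (mean_drift n) (x + d) (\<lambda>i. \<beta> i + (LINT s:{0<..<grid n i}|lborel. coupling_drift n d e s)) n
         = euler (mean_drift n) x \<beta> n"
proof -
  let ?h = "\<lambda>i. LINT s:{0<..<grid n i}|lborel. coupling_drift n d e s"
  have "euler (mean_drift n) (x + d) (\<lambda>i. \<beta> i + ?h i) n = euler (mean_drift n) x \<beta> n + hyp_shift K T d (grid n n)"
  proof (rule euler_coupling[where n=n and i=n and h="?h" and g="\<lambda>i. hyp_shift K T d (grid n i)"])
    show "?h 0 = 0" by (simp add: set_lebesgue_integral_def)
    show "?h (Suc i) - ?h i = hyp_shift K T d (grid n (Suc i)) - hyp_shift K T d (grid n i) +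
       mean_drift n i (euler (mean_drift n) x \<beta> i) - mean_drift n i (euler (mean_drift n) x \<beta> i + hyp_shift K T d (grid n i))"
      if "i < n" for i using coupling_drift_increment[OF n that, of d e] unfolding \<beta> .
    show "x + d = x + hyp_shift K T d (grid n 0)" using hyp_shift_ends(1)[OF K T] by simp
  qed simp
  thus ?thesis using hyp_shift_ends(2)[OF K T] grid_n[OF n] by simp
qed

end

section \<open>The energy of the shift of the Wiener process\<close>

lemma set_integral_Icc_diff:
  fixes g :: "real \<Rightarrow> real"
  assumes g: "set_integrable lborel {0..b} g" and ab: "0 \<le> a" "a \<le> b"
  shows "(LINT q:{0..b}|lborel. g q) - (LINT q:{0..a}|lborel. g q) = (LINT q:{a<..b}|lborel. g q)"
proof -
  have "{0..b} = {0..a} \<union> {a<..b}" using ab by auto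
  moreover have "set_integrable lborel {0..a} g" "set_integrable lborel {a<..b} g"
    by (rule set_integrable_subset[OF g]; use ab in auto)+
  ultimately have "(LINT q:{0..b}|lborel. g q) = (LINT q:{0..a}|lborel. g q) + (LINT q:{a<..b}|lborel. g q)"
    by (simp, intro set_integral_Un) auto
  thus ?thesis by simp
qed

context
  fixes H T N :: real and \<eta> :: "real \<Rightarrow> real"
  assumes H: "0 < H" "H < 1/2" and T: "T > 0" and \<eta> [measurable]: "\<eta> \<in> borel_measurable borel" and N: "\<And>q. \<bar>\<eta> q\<bar> \<le> N"
begin

lemma K_H_inv_measurable [measurable]: "K_H_inv H \<eta> \<in> borel_measurable borel"
  unfolding K_H_inv_def[abs_def] by measurable

lemma K_H_inv_integrable:
  "set_integrable lborel {0..T} (K_H_inv H \<eta>)" "set_integrable lborel {0..T} (\<lambda>q. (K_H_inv H \<eta> q)\<^sup>2)"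
proof -
  define B where "B = N * frac_const H * T powr (1/2 - H)"
  have N0: "N \<ge> 0" using N[of 0] by linarith
  have b: "\<bar>K_H_inv H \<eta> q\<bar> \<le> B" if "q \<in> {0..T}" for q
  proof -
    have "\<bar>K_H_inv H \<eta> q\<bar> \<le> N * frac_const H * q powr (1/2 - H)" by (rule K_H_inv_bound[OF H \<eta> N])
    also have "\<dots> \<le> B" unfolding B_def
      using that H N0 frac_const_nonneg[of H] by (intro mult_left_mono powr_mono2) auto
    finally show ?thesis .
  qed
  show "set_integrable lborel {0..T} (K_H_inv H \<eta>)"
    unfolding set_integrable_def by (rule integrableI_bounded_set_indicator[where B=B]) (use b T in auto)
  have "(K_H_inv H \<eta> q)\<^sup>2 \<le> B\<^sup>2" if "q \<in> {0..T}" for q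
    using b[OF that] power_mono[of "\<bar>K_H_inv H \<eta> q\<bar>" B 2] by simp
  thus "set_integrable lborel {0..T} (\<lambda>q. (K_H_inv H \<eta> q)\<^sup>2)"
    unfolding set_integrable_def by (intro integrableI_bounded_set_indicator[where B="B\<^sup>2"]) (use T in auto)
qed

lemma K_H_inv_square_integral:
  "(LINT q:{0..T}|lborel. (K_H_inv H \<eta> q)\<^sup>2) \<le> energy_bound H T N"
proof -
  have "ennreal (LINT q:{0..T}|lborel. (K_H_inv H \<eta> q)\<^sup>2) = (\<integral>\<^sup>+s\<in>{0..T}. ennreal ((K_H_inv H \<eta> s)\<^sup>2) \<partial>lborel)"
  proof -
    have "(\<integral>\<^sup>+q. ennreal (indicator {0..T} q *\<^sub>R (K_H_inv H \<eta> q)\<^sup>2) \<partial>lborel) = ennreal (LINT q:{0..T}|lborel. (K_H_inv H \<eta> q)\<^sup>2)"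
      unfolding set_lebesgue_integral_def
      by (rule nn_integral_eq_integral) (use K_H_inv_integrable(2) in \<open>auto simp: set_integrable_def\<close>)
    moreover have "(\<integral>\<^sup>+q. ennreal (indicator {0..T} q *\<^sub>R (K_H_inv H \<eta> q)\<^sup>2) \<partial>lborel) = (\<integral>\<^sup>+s\<in>{0..T}. ennreal ((K_H_inv H \<eta> s)\<^sup>2) \<partial>lborel)"
      by (intro nn_integral_cong) (auto simp: indicator_def)
    ultimately show ?thesis by simp
  qed
  also have "\<dots> \<le> ennreal (energy_bound H T N)"
    by (rule nn_integral_K_H_inv_square_le[OF H \<eta> N T])
  finally show ?thesis using H by (subst (asm) ennreal_le_iff) (auto simp: energy_bound_def)
qed

definition "control_primitive t = (LINT q:{0..t}|lborel. K_H_inv H \<eta> q)"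

lemma primitive_increment:
  assumes "0 \<le> a" "a \<le> b" "b \<le> T"
  shows "control_primitive b - control_primitive a = (LINT q:{a<..b}|lborel. K_H_inv H \<eta> q)"
  unfolding control_primitive_def
  by (rule set_integral_Icc_diff) (use assms in \<open>auto intro: set_integrable_subset[OF K_H_inv_integrable(1)]\<close>)

text \<open>
  By Cauchy--Schwarz on each cell, the energy of the discretized shift is at most the integral of its squared density.
\<close>

lemma sum_increments_square:
  assumes s: "\<And>j. j < m \<Longrightarrow> s j < s (Suc j)" "\<And>j. j \<le> m \<Longrightarrow> s j \<in> {0..T}"
  shows "(\<Sum>j<m. (control_primitive (s (Suc j)) - control_primitive (s j))\<^sup>2 / (s (Suc j) - s j))
     \<le> energy_bound H T N"
proof -
  let ?u = "K_H_inv H \<eta>"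
  define Q where "Q t = (LINT q:{0..t}|lborel. (?u q)\<^sup>2)" for t
  have "(control_primitive (s (Suc j)) - control_primitive (s j))\<^sup>2 / (s (Suc j) - s j) \<le> Q (s (Suc j)) - Q (s j)" if j: "j < m" for j
  proof -
    let ?I = "{s j<..s (Suc j)}"
    have sj: "0 \<le> s j" "s j < s (Suc j)" "s (Suc j) \<le> T" using s(1)[OF j] s(2)[of j] s(2)[of "Suc j"] j by auto
    have iu2: "integrable lborel (\<lambda>q. (indicator ?I q * ?u q)\<^sup>2)"
    proof -
      have "set_integrable lborel ?I (\<lambda>q. (?u q)\<^sup>2)"
        by (rule set_integrable_subset[OF K_H_inv_integrable(2)]) (use sj in auto)
      moreover have "(indicator ?I q * ?u q)\<^sup>2 = indicator ?I q *\<^sub>R (?u q)\<^sup>2" for q by (simp add: indicator_def)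
      ultimately show ?thesis by (simp add: set_integrable_def)
    qed
    have i1: "integrable lborel (\<lambda>q. (indicator ?I q :: real)\<^sup>2)"
      using emeasure_lborel_Ioc_finite by (simp add: power2_eq_square indicator_inter_arith[symmetric])
    have "(LINT q|lborel. indicator ?I q * (indicator ?I q * ?u q))\<^sup>2 \<le> (LINT q|lborel. (indicator ?I q :: real)\<^sup>2) * (LINT q|lborel. (indicator ?I q * ?u q)\<^sup>2)"
      by (rule integral_Cauchy_Schwarz(2)[OF _ _ i1 iu2]) measurable
    also have "(LINT q|lborel. (indicator ?I q :: real)\<^sup>2) = s (Suc j) - s j"
      using sj by (simp add: power2_eq_square indicator_inter_arith[symmetric])
    also have "(LINT q|lborel. (indicator ?I q * ?u q)\<^sup>2) = (LINT q:?I|lborel. (?u q)\<^sup>2)"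
      unfolding set_lebesgue_integral_def by (intro Bochner_Integration.integral_cong) (auto simp: indicator_def)
    also have "\<dots> = Q (s (Suc j)) - Q (s j)"
      unfolding Q_def by (rule set_integral_Icc_diff[symmetric]) (use sj in \<open>auto intro: set_integrable_subset[OF K_H_inv_integrable(2)]\<close>)
    also have "(LINT q|lborel. indicator ?I q * (indicator ?I q * ?u q)) = control_primitive (s (Suc j)) - control_primitive (s j)"
      using primitive_increment[of "s j" "s (Suc j)"] sj
      by (simp add: set_lebesgue_integral_def mult.assoc[symmetric] indicator_inter_arith[symmetric])
    finally show ?thesis using sj by (simp add: field_simps)
  qed
  hence "(\<Sum>j<m. (control_primitive (s (Suc j)) - control_primitive (s j))\<^sup>2 / (s (Suc j) - s j)) \<le> (\<Sum>j<m. Q (s (Suc j)) - Q (s j))"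
    by (intro sum_mono) auto
  also have "\<dots> = Q (s m) - Q (s 0)" by (rule sum_lessThan_telescope)
  also have "\<dots> \<le> Q T"
  proof -
    have "Q (s 0) \<ge> 0" unfolding Q_def set_lebesgue_integral_def by (intro Bochner_Integration.integral_nonneg) auto
    moreover have "Q T - Q (s m) \<ge> 0"
    proof -
      have "Q T - Q (s m) = (LINT q:{s m<..T}|lborel. (?u q)\<^sup>2)"
        unfolding Q_def by (rule set_integral_Icc_diff[OF K_H_inv_integrable(2)]) (use s(2)[of m] in auto)
      thus ?thesis unfolding set_lebesgue_integral_def by (simp add: Bochner_Integration.integral_nonneg)
    qed
    ultimately show ?thesis by simp
  qed
  also have "Q T \<le> energy_bound H T N" unfolding Q_def by (rule K_H_inv_square_integral)
  finally show ?thesis .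
qed

lemma step_integral_primitive:
  assumes t: "t \<in> {0..T}" and \<tau>: "\<And>j. j \<le> \<nu> \<Longrightarrow> \<tau> j \<in> {0..t}" "\<And>j. j < \<nu> \<Longrightarrow> \<tau> j \<le> \<tau> (Suc j)"
  shows "has_bochner_integral lborel (\<lambda>q. step_fun \<nu> \<tau> c q * K_H_inv H \<eta> q) (step_integral (\<lambda>t w. control_primitive t) \<nu> \<tau> c w)"
proof -
  have "has_bochner_integral lborel (\<lambda>q. \<Sum>i<\<nu>. c i * (indicator {\<tau> i<..\<tau> (Suc i)} q * K_H_inv H \<eta> q))
     (\<Sum>i<\<nu>. c i * (control_primitive (\<tau> (Suc i)) - control_primitive (\<tau> i)))"
  proof (intro has_bochner_integral_sum has_bochner_integral_mult_right)
    fix i assume "i \<in> {..<\<nu>}"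
    hence i: "0 \<le> \<tau> i" "\<tau> i \<le> \<tau> (Suc i)" "\<tau> (Suc i) \<le> T" using \<tau>(1)[of i] \<tau>(1)[of "Suc i"] \<tau>(2)[of i] t by auto
    have "set_integrable lborel {\<tau> i<..\<tau> (Suc i)} (K_H_inv H \<eta>)"
      by (rule set_integrable_subset[OF K_H_inv_integrable(1)]) (use i in auto)
    thus "has_bochner_integral lborel (\<lambda>q. indicator {\<tau> i<..\<tau> (Suc i)} q * K_H_inv H \<eta> q) (control_primitive (\<tau> (Suc i)) - control_primitive (\<tau> i))"
      unfolding primitive_increment[OF i] by (simp add: has_bochner_integral_iff set_integrable_def set_lebesgue_integral_def)
  qed
  thus ?thesis by (simp only: step_integral_def step_fun_def sum_distrib_right mult.assoc)
qed

text \<open>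
  Cauchy--Schwarz: an \<open>L\<^sup>2\<close> error in the kernel costs at most that error times the square root of the energy in the shift of the noise.
\<close>

lemma step_integral_primitive_error:
  assumes t: "t \<in> {0..T}" and \<tau>: "\<And>j. j \<le> \<nu> \<Longrightarrow> \<tau> j \<in> {0..t}" "\<And>j. j < \<nu> \<Longrightarrow> \<tau> j \<le> \<tau> (Suc j)"
    and \<epsilon>: "\<epsilon> \<ge> 0" "(\<integral>\<^sup>+s\<in>{0..t}. ennreal ((K_H H t s - step_fun \<nu> \<tau> c s)\<^sup>2) \<partial>lborel) \<le> ennreal (\<epsilon>\<^sup>2)"
  shows "\<bar>step_integral (\<lambda>t w. control_primitive t) \<nu> \<tau> c w - (LINT q:{0<..<t}|lborel. \<eta> q)\<bar>
      \<le> \<epsilon> * sqrt (energy_bound H T N)"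
proof -
  let ?err = "step_integral (\<lambda>t w. control_primitive t) \<nu> \<tau> c w - (LINT q:{0<..<t}|lborel. \<eta> q)"
  let ?u = "K_H_inv H \<eta>" let ?\<sigma> = "step_fun \<nu> \<tau> c"
  let ?A = "energy_bound H T N"
  note [measurable] = K_H_measurable[OF H]
  have [measurable]: "?\<sigma> \<in> borel_measurable borel" unfolding step_fun_def[abs_def] by measurable
  define f where "f q = indicator {0..t} q * (?\<sigma> q - K_H H t q)" for q
  define g where "g q = indicator {0..T} q * ?u q" for q
  have [measurable]: "f \<in> borel_measurable borel" "g \<in> borel_measurable borel" unfolding f_def g_def by measurable
  have "(\<integral>\<^sup>+q. ennreal ((f q)\<^sup>2) \<partial>lborel) = (\<integral>\<^sup>+s\<in>{0..t}. ennreal ((K_H H t s - ?\<sigma> s)\<^sup>2) \<partial>lborel)"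
    by (intro nn_integral_cong) (auto simp: f_def indicator_def power2_commute)
  hence le: "(\<integral>\<^sup>+q. ennreal ((f q)\<^sup>2) \<partial>lborel) \<le> ennreal (\<epsilon>\<^sup>2)" using \<epsilon>(2) by simp
  have if2: "integrable lborel (\<lambda>q. (f q)\<^sup>2)"
    by (rule integrableI_bounded) (use le in \<open>auto intro: le_less_trans\<close>)
  have f2: "(LINT q|lborel. (f q)\<^sup>2) \<le> \<epsilon>\<^sup>2"
    using le nn_integral_eq_integral[OF if2] by (simp add: ennreal_le_iff)
  have g2eq: "(g q)\<^sup>2 = indicator {0..T} q *\<^sub>R (?u q)\<^sup>2" for q by (simp add: g_def indicator_def)
  have ig2: "integrable lborel (\<lambda>q. (g q)\<^sup>2)" using K_H_inv_integrable(2) by (simp add: g2eq set_integrable_def)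
  have g2: "(LINT q|lborel. (g q)\<^sup>2) \<le> ?A" using K_H_inv_square_integral by (simp add: g2eq set_lebesgue_integral_def)
  have "?err = (LINT q|lborel. ?\<sigma> q * ?u q - K_H H t q * ?u q)"
    using has_bochner_integral_diff[OF step_integral_primitive[of t \<nu> \<tau> c w] has_bochner_integral_K_H_inv[OF H \<eta> N, of t]]
      t \<tau> by (simp add: has_bochner_integral_iff)
  also have "\<dots> = (LINT q|lborel. f q * g q)"
  proof (intro Bochner_Integration.integral_cong refl)
    fix q
    have "?\<sigma> q = 0" if "q \<notin> {0..t}"
      unfolding step_fun_def
    proof (rule sum.neutral, intro ballI)
      fix i assume "i \<in> {..<\<nu>}"
      hence "q \<notin> {\<tau> i<..\<tau> (Suc i)}" using \<tau>(1)[of i] \<tau>(1)[of "Suc i"] that by auto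
      thus "c i * indicator {\<tau> i<..\<tau> (Suc i)} q = 0" by simp
    qed
    moreover have "K_H H t q = 0" if "q \<notin> {0..t}" using that by (auto simp: K_H_def)
    ultimately show "?\<sigma> q * ?u q - K_H H t q * ?u q = f q * g q"
      using t by (auto simp: f_def g_def indicator_def algebra_simps)
  qed
  finally have "(?err)\<^sup>2 \<le> (LINT q|lborel. (f q)\<^sup>2) * (LINT q|lborel. (g q)\<^sup>2)"
    using integral_Cauchy_Schwarz(2)[OF _ _ if2 ig2] by simp
  also have "\<dots> \<le> \<epsilon>\<^sup>2 * ?A" by (intro mult_mono f2 g2) auto
  finally have "sqrt ((?err)\<^sup>2) \<le> sqrt (\<epsilon>\<^sup>2 * ?A)"
    by (rule real_sqrt_le_mono)
  thus ?thesis using \<epsilon>(1) by (simp only: real_sqrt_abs real_sqrt_mult abs_of_nonneg)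
qed

end

section \<open>Coupling under a step function approximation of the noise\<close>

context lipschitz_drift
begin

text \<open>
  The energy for the bound on \<open>\<eta>\<close>; it is the quantity \<open>A\<close> of the introduction.
\<close>

definition shift_cost :: "real \<Rightarrow> real \<Rightarrow> real" where
  "shift_cost H d = energy_bound H T (2 * K * \<bar>d\<bar> / (1 - exp (- 2 * K * T)))"

lemma shift_cost_eq: "H < 1/2 \<Longrightarrow> shift_cost H d = 2 * Harnack_const T K H * d\<^sup>2"
proof -
  assume H: "H < 1/2"
  have k: "K powr (- 2) = 1 / K\<^sup>2" using K by (simp add: powr_minus_divide powr_numeral)
  have E: "1 - exp (- 2 * K * T) \<noteq> 0" using K T by simp
  have "(2 * K * \<bar>d\<bar> / E * F)\<^sup>2 * (X / (2 * q)) = 2 * (F\<^sup>2 * (X / (1 / K\<^sup>2 * E\<^sup>2 * q))) * d\<^sup>2"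
    if "E \<noteq> 0" "q \<noteq> 0" for E F X q :: real
    using that K by (simp add: power_mult_distrib power_divide field_simps)
  from this[OF E, of "1 - H" "frac_const H" "T powr (2 - 2 * H)"] show ?thesis
    unfolding shift_cost_def energy_bound_def Harnack_const_def frac_const_def[symmetric] k using H by (simp add: right_diff_distrib)
qed

lemma euler_noise_cong:
  assumes "n > 0" "\<And>i. i \<le> n \<Longrightarrow> \<beta> i = \<beta>' i"
  shows "euler (mean_drift n) x \<beta> n = euler (mean_drift n) x \<beta>' n"
  using euler_Lipschitz[of n \<beta> \<beta>' 0 x] assms by simp

text \<open>
  The shift of the Wiener process up to time \<open>b'\<close> involves \<open>\<eta>\<close> up to time \<open>b'\<close> only. As no grid point lies strictly between \<open>a\<close> and
  \<open>b'\<close>, this part of \<open>\<eta>\<close> is determined by the positions of the scheme up to time \<open>a\<close>: the increment of the shift over the cell is predictable.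
\<close>

lemma coupling_drift_adapted:
  assumes G: "\<And>i. i < n \<Longrightarrow> grid n i \<le> a \<Longrightarrow> (\<lambda>w. e w i) \<in> borel_measurable G"
    and gap: "\<And>i. i < n \<Longrightarrow> a < grid n i \<Longrightarrow> b' \<le> grid n i"
    and ab: "0 \<le> a" "a < b'" "b' \<le> T" and H: "0 < H" "H < 1/2" and n: "n > 0"
  shows "(\<lambda>w. control_primitive H (coupling_drift n d (e w)) b' - control_primitive H (coupling_drift n d (e w)) a) \<in> borel_measurable G"
proof -
  \<comment> \<open>The terms of the cells that start by time \<open>a\<close>; the others vanish before time \<open>b'\<close>.\<close>
  define tr where "tr w s = (\<Sum>i\<in>{i. i < n \<and> grid n i \<le> a}. indicator {grid n i<..grid n (Suc i)} s *
     (hyp_shift_deriv K T d s + b s (e w i) - b s (e w i + hyp_shift K T d (grid n i))))" for w s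
  have [measurable]: "(\<lambda>(w, s). tr w s) \<in> borel_measurable (G \<Otimes>\<^sub>M borel)"
    unfolding tr_def case_prod_beta
  proof (rule borel_measurable_sum)
    fix i assume "i \<in> {i. i < n \<and> grid n i \<le> a}"
    hence [measurable]: "(\<lambda>w. e w i) \<in> borel_measurable G" using G by auto
    show "(\<lambda>x. indicat_real {grid n i<..grid n (Suc i)} (snd x) *
           (hyp_shift_deriv K T d (snd x) + b (snd x) (e (fst x) i) - b (snd x) (e (fst x) i + hyp_shift K T d (grid n i))))
       \<in> borel_measurable (G \<Otimes>\<^sub>M borel)" by measurable
  qed
  have tr_eq: "coupling_drift n d (e w) s = tr w s" if "s < b'" for w s
    unfolding coupling_drift_def tr_def
  proof (rule sum.mono_neutral_right)
    show "\<forall>i\<in>{..<n} - {i. i < n \<and> grid n i \<le> a}. indicat_real {grid n i<..grid n (Suc i)} s *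
       (hyp_shift_deriv K T d s + b s (e w i) - b s (e w i + hyp_shift K T d (grid n i))) = 0"
    proof
      fix i assume "i \<in> {..<n} - {i. i < n \<and> grid n i \<le> a}"
      hence "b' \<le> grid n i" using gap[of i] by auto
      thus "indicat_real {grid n i<..grid n (Suc i)} s *
       (hyp_shift_deriv K T d s + b s (e w i) - b s (e w i + hyp_shift K T d (grid n i))) = 0" using that by simp
    qed
  qed auto
  have "control_primitive H (coupling_drift n d (e w)) b' - control_primitive H (coupling_drift n d (e w)) a
     = (LINT q|lborel. indicator {a<..b'} q * K_H_inv H (tr w) q)" for w
  proof -
    have "control_primitive H (coupling_drift n d (e w)) b' - control_primitive H (coupling_drift n d (e w)) a
      = (LINT q:{a<..b'}|lborel. K_H_inv H (coupling_drift n d (e w)) q)"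
      by (rule primitive_increment[OF H T coupling_drift_measurable coupling_drift_bound[OF n]]) (use ab in auto)
    also have "\<dots> = (LINT q|lborel. indicator {a<..b'} q * K_H_inv H (tr w) q)"
      unfolding set_lebesgue_integral_def
    proof (intro Bochner_Integration.integral_cong refl)
      fix q
      show "indicat_real {a<..b'} q *\<^sub>R K_H_inv H (coupling_drift n d (e w)) q = indicator {a<..b'} q * K_H_inv H (tr w) q"
      proof (cases "q \<le> b'")
        case True
        have "K_H_inv H (coupling_drift n d (e w)) q = K_H_inv H (tr w) q"
          unfolding K_H_inv_def
        proof (intro Bochner_Integration.integral_cong refl)
          fix r
          show "frac_kernel H q r * coupling_drift n d (e w) r = frac_kernel H q r * tr w r"
            using tr_eq[of r w] True by (cases "r < q") (auto simp: frac_kernel_def)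
        qed
        thus ?thesis by simp
      qed simp
    qed
    finally show ?thesis .
  qed
  moreover have "(\<lambda>w. LINT q|lborel. indicator {a<..b'} q * K_H_inv H (tr w) q) \<in> borel_measurable G"
  proof -
    have [measurable]: "(\<lambda>(w, q). K_H_inv H (tr w) q) \<in> borel_measurable (G \<Otimes>\<^sub>M borel)"
    proof -
      have [measurable]: "(\<lambda>(z, r). tr (fst z) r) \<in> borel_measurable ((G \<Otimes>\<^sub>M borel) \<Otimes>\<^sub>M borel)"
        by measurable
      have "(\<lambda>z. K_H_inv H (tr (fst z)) (snd z)) \<in> borel_measurable (G \<Otimes>\<^sub>M borel)"
        by (rule K_H_inv_parametric_measurable) measurable
      thus ?thesis by (simp add: case_prod_beta')
    qed
    show ?thesis by measurable
  qed
  ultimately show ?thesis by simp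
qed

end

locale fractional_equation = lipschitz_drift b K T \<beta>0 + prob_space M
  for b :: "real \<Rightarrow> real \<Rightarrow> real" and K T \<beta>0 :: real and M :: "'w measure" +
  fixes \<F> :: "real \<Rightarrow> 'w measure" and H :: real and W B :: "real \<Rightarrow> 'w \<Rightarrow> real"
    and X :: "real \<Rightarrow> real \<Rightarrow> 'w \<Rightarrow> real"
  assumes H: "0 < H" "H < 1/2" and sp: "filtered_prob_space M \<F>" and W: "wiener_process M \<F> T W"
    and B: "fractional_brownian_motion M H T W B" and X: "\<And>x. is_solution M \<F> T b B x (X x)"
begin

text \<open>
  All grid points and break points together form one partition of \<open>{0..T}\<close>. The increments of \<open>W\<close> over its cells drive the scheme, and
  shifting them by the increments of \<open>\<integral>u\<close> changes the law by at most the Girsanov bound. The shift of the approximate noise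
  produced in this way differs from \<open>\<integral>\<eta>\<close> by the \<open>L\<^sup>2\<close> error of the step functions; with \<open>\<integral>\<eta>\<close> itself the coupling would be exact.
\<close>

lemma step_approximation_coupling:
  fixes \<nu> :: "nat \<Rightarrow> nat" and \<tau> c :: "nat \<Rightarrow> nat \<Rightarrow> real"
  assumes n: "n > 0"
    and \<tau>: "\<And>i j. i \<le> n \<Longrightarrow> j \<le> \<nu> i \<Longrightarrow> \<tau> i j \<in> {0..grid n i}" "\<And>i j. i \<le> n \<Longrightarrow> j < \<nu> i \<Longrightarrow> \<tau> i j \<le> \<tau> i (Suc j)"
    and \<epsilon>: "\<epsilon> \<ge> 0" "\<And>i. i \<le> n \<Longrightarrow> (\<integral>\<^sup>+s\<in>{0..grid n i}. ennreal ((K_H H (grid n i) s - step_fun (\<nu> i) (\<tau> i) (c i) s)\<^sup>2) \<partial>lborel) \<le> ennreal (\<epsilon>\<^sup>2)"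
    and f [measurable]: "f \<in> borel_measurable borel" and fC: "\<And>z. \<bar>f z\<bar> \<le> C" and fL: "L \<ge> 0" "\<And>z z'. \<bar>f z - f z'\<bar> \<le> L * \<bar>z - z'\<bar>"
  defines "\<beta> \<equiv> \<lambda>w i. step_integral W (\<nu> i) (\<tau> i) (c i) w"
  shows "\<bar>(LINT w|M. f (euler (mean_drift n) (x + d) (\<beta> w) n)) - (LINT w|M. f (euler (mean_drift n) x (\<beta> w) n))\<bar>
     \<le> C * sqrt (exp (shift_cost H d) - 1) + L * (exp (K * T) * (\<epsilon> * sqrt (shift_cost H d)))"
proof -
  let ?err = "L * (exp (K * T) * (\<epsilon> * sqrt (shift_cost H d)))"
  have sub: "subalgebra M (\<F> t)" for t using sp by (simp add: filtered_prob_space_def)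
  have Fmono: "sets (\<F> a) \<subseteq> sets (\<F> b)" if "a \<le> b" for a b
    using sp that unfolding filtered_prob_space_def filtration_def by blast
  have lift: "g \<in> borel_measurable (\<F> b)" if "g \<in> borel_measurable (\<F> a)" "a \<le> b" for g :: "'w \<Rightarrow> real" and a b
  proof (rule measurable_from_subalg[OF _ that(1)])
    show "subalgebra (\<F> b) (\<F> a)" using sub[of a] sub[of b] Fmono[OF that(2)] by (auto simp: subalgebra_def)
  qed
  have liftM: "g \<in> borel_measurable M" if "g \<in> borel_measurable (\<F> a)" for g :: "'w \<Rightarrow> real" and a
    using measurable_from_subalg[OF sub that] .
  have Wm: "W t \<in> borel_measurable (\<F> t)" if "t \<in> {0..T}" for t using W that by (simp add: wiener_process_def)
  have Wi: "distributed M lborel (\<lambda>\<omega>. W t \<omega> - W s \<omega>) (normal_density 0 (sqrt (t - s)))"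
    "indep_set (sets (\<F> s)) (sets (vimage_algebra (space M) (\<lambda>\<omega>. W t \<omega> - W s \<omega>) borel))"
    if "0 \<le> s" "s < t" "t \<le> T" for s t
    using W that unfolding wiener_process_def by blast+
  \<comment> \<open>A common refinement expresses all step integrals, and the past at each grid point, through the same increments.\<close>
  define P where "P = grid n ` {..n} \<union> (\<Union>i\<in>{..n}. \<tau> i ` {..\<nu> i})"
  have P: "finite P" "P \<noteq> {}" by (auto simp: P_def)
  have PT: "P \<subseteq> {0..T}" using grid_bounds[OF n] \<tau>(1) unfolding P_def by force
  obtain m :: nat and s where s: "\<And>i j. i < j \<Longrightarrow> j \<le> m \<Longrightarrow> s i < s j" "s ` {..m} = P"
    using finite_set_increasing_enumeration[OF P] by metis
  have sT: "s j \<in> {0..T}" if "j \<le> m" for j using s(2) PT that by auto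
  have s_le: "s i \<le> s j \<longleftrightarrow> i \<le> j" if "i \<le> m" "j \<le> m" for i j
    using s(1)[of i j] s(1)[of j i] that by (metis le_less linorder_not_le order.asym)
  have sP: "grid n i \<in> s ` {..m}" if "i \<le> n" for i using that unfolding s(2) P_def by auto
  have \<tau>P: "\<tau> i j \<in> s ` {..m}" if "i \<le> n" "j \<le> \<nu> i" for i j using that unfolding s(2) P_def by auto
  define F where "F j = \<F> (s j)" for j
  define \<zeta> where "\<zeta> j w = W (s (Suc j)) w - W (s j) w" for j w
  define \<delta> where "\<delta> j = s (Suc j) - s j" for j
  interpret g: gaussian_increments M F \<zeta> \<delta> m
  proof
    show "subalgebra M (F j)" if "j \<le> m" for j using sub by (simp add: F_def)
    show "sets (F i) \<subseteq> sets (F j)" if "i \<le> j" "j \<le> m" for i j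
      unfolding F_def by (rule Fmono) (use that s_le in auto)
    fix j assume j: "j < m"
    have sj: "0 \<le> s j" "s j < s (Suc j)" "s (Suc j) \<le> T" using sT[of j] sT[of "Suc j"] s(1)[of j "Suc j"] j by auto
    have [measurable]: "W (s (Suc j)) \<in> borel_measurable (F (Suc j))" "W (s j) \<in> borel_measurable (F (Suc j))"
      unfolding F_def using Wm[of "s (Suc j)"] lift[OF Wm[of "s j"]] sj by auto
    show "\<zeta> j \<in> borel_measurable (F (Suc j))" unfolding \<zeta>_def[abs_def] by measurable
    show "\<delta> j > 0" using sj by (simp add: \<delta>_def)
    show "distributed M lborel (\<zeta> j) (normal_density 0 (sqrt (\<delta> j)))"
      "indep_set (sets (F j)) (sets (vimage_algebra (space M) (\<zeta> j) borel))"
      unfolding \<zeta>_def[abs_def] \<delta>_def F_def using Wi[OF sj] by auto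
  qed
  have \<beta>m: "(\<lambda>w. \<beta> w i) \<in> borel_measurable (\<F> (grid n i))" if i: "i \<le> n" for i
    unfolding \<beta>_def step_integral_def
  proof (intro borel_measurable_sum borel_measurable_times borel_measurable_const borel_measurable_diff)
    fix j assume "j \<in> {..<\<nu> i}"
    thus "W (\<tau> i (Suc j)) \<in> borel_measurable (\<F> (grid n i))" "W (\<tau> i j) \<in> borel_measurable (\<F> (grid n i))"
      using \<tau>(1)[of i j] \<tau>(1)[of i "Suc j"] i grid_bounds[OF n i] by (auto intro!: lift[OF Wm])
  qed
  define e where "e w i = euler (mean_drift n) x (\<beta> w) i" for w i
  have em: "(\<lambda>w. e w i) \<in> borel_measurable (\<F> (grid n i))" if "i \<le> n" for i
    unfolding e_def
    by (rule euler_measurable[OF mean_drift_measurable]) (use that in \<open>auto intro!: lift[OF \<beta>m] grid_mono\<close>)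
  define \<eta> where "\<eta> w = coupling_drift n d (e w)" for w
  let ?U = "\<lambda>w. control_primitive H (\<eta> w)"
  define v where "v j w = ?U w (s (Suc j)) - ?U w (s j)" for j w
  have \<eta>m: "\<eta> w \<in> borel_measurable borel" for w unfolding \<eta>_def by measurable
  have \<eta>N: "\<bar>\<eta> w q\<bar> \<le> 2 * K * \<bar>d\<bar> / (1 - exp (- 2 * K * T))" for w q
    unfolding \<eta>_def by (rule coupling_drift_bound[OF n])
  have pred: "g.predictable v"
    unfolding g.predictable_def
  proof (intro allI impI)
    fix j assume j: "j < m"
    have sj: "0 \<le> s j" "s j < s (Suc j)" "s (Suc j) \<le> T" using sT[of j] sT[of "Suc j"] s(1)[of j "Suc j"] j by auto
    show "v j \<in> borel_measurable (F j)"
      unfolding v_def[abs_def] \<eta>_def F_def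
    proof (rule coupling_drift_adapted[OF _ _ sj H n])
      show "(\<lambda>w. e w i) \<in> borel_measurable (\<F> (s j))" if "i < n" "grid n i \<le> s j" for i
        using lift[OF em] that by auto
      show "s (Suc j) \<le> grid n i" if "i < n" "s j < grid n i" for i
      proof -
        have "grid n i \<in> s ` {..m}" using sP[of i] that by simp
        then obtain k where k: "k \<le> m" "grid n i = s k" by auto
        hence "j < k" using that s_le[of k j] j by auto
        thus ?thesis using k s_le[of "Suc j" k] j by auto
      qed
    qed
  qed
  have energy: "(\<Sum>j<m. (v j w)\<^sup>2 / \<delta> j) \<le> shift_cost H d" for w
    unfolding v_def \<delta>_def shift_cost_def
    by (rule sum_increments_square[OF H T \<eta>m \<eta>N]) (use s(1) sT in auto)
  let ?sh = "\<lambda>w. \<lambda>j\<in>{..<m}. \<zeta> j w + v j w"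
  define a where "a i j = step_fun (\<nu> i) (\<tau> i) (c i) (s (Suc j))" for i j
  define \<Phi> where "\<Phi> z = f (euler (mean_drift n) (x + d) (\<lambda>i. \<Sum>j<m. a i j * z j) n)" for z :: "nat \<Rightarrow> real"
  have \<Phi>m: "\<Phi> \<in> borel_measurable (Pi\<^sub>M {..<m} (\<lambda>_. borel))"
  proof -
    have "(\<lambda>z. euler (mean_drift n) (x + d) (\<lambda>i. \<Sum>j<m. a i j * z j) n) \<in> borel_measurable (Pi\<^sub>M {..<m} (\<lambda>_. borel))"
      by (rule euler_measurable[OF mean_drift_measurable])
        (intro borel_measurable_sum borel_measurable_times borel_measurable_const measurable_component_singleton)
    thus ?thesis unfolding \<Phi>_def[abs_def] by measurable
  qed
  have refine: "step_integral G (\<nu> i) (\<tau> i) (c i) w = (\<Sum>j<m. a i j * (G (s (Suc j)) w - G (s j) w))"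
    if "i \<le> n" for i w and G :: "real \<Rightarrow> 'w \<Rightarrow> real"
    unfolding a_def by (rule step_integral_refine[OF s(1)]) (use \<tau>P \<tau>(2) that in auto)
  have \<Phi>1: "\<Phi> (\<lambda>j\<in>{..<m}. \<zeta> j w) = f (euler (mean_drift n) (x + d) (\<beta> w) n)" for w
    unfolding \<Phi>_def
    by (intro arg_cong[of _ _ f] euler_noise_cong n) (simp add: \<beta>_def refine \<zeta>_def)
  have \<Phi>2: "\<Phi> (?sh w)
      = f (euler (mean_drift n) (x + d) (\<lambda>i. \<beta> w i + step_integral (\<lambda>t w'. ?U w t) (\<nu> i) (\<tau> i) (c i) w) n)" for w
    unfolding \<Phi>_def
    by (intro arg_cong[of _ _ f] euler_noise_cong n)
      (simp add: \<beta>_def refine \<zeta>_def v_def sum.distrib[symmetric] distrib_left)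
  have dev: "\<bar>\<Phi> (?sh w) - f (euler (mean_drift n) x (\<beta> w) n)\<bar> \<le> ?err" for w
  proof -
    let ?y1 = "euler (mean_drift n) (x + d) (\<lambda>i. \<beta> w i + step_integral (\<lambda>t w'. ?U w t) (\<nu> i) (\<tau> i) (c i) w) n"
    let ?y2 = "euler (mean_drift n) (x + d) (\<lambda>i. \<beta> w i + (LINT q:{0<..<grid n i}|lborel. \<eta> w q)) n"
    have y2: "?y2 = euler (mean_drift n) x (\<beta> w) n"
      unfolding \<eta>_def by (rule coupled_euler[OF n]) (simp add: e_def)
    have "\<bar>?y1 - ?y2\<bar> \<le> exp (K * T) * (\<epsilon> * sqrt (shift_cost H d))"
    proof (rule euler_Lipschitz[OF n])
      fix i assume i: "i \<le> n"
      have "\<bar>step_integral (\<lambda>t w'. ?U w t) (\<nu> i) (\<tau> i) (c i) w - (LINT q:{0<..<grid n i}|lborel. \<eta> w q)\<bar> \<le> \<epsilon> * sqrt (shift_cost H d)"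
        unfolding shift_cost_def
        by (rule step_integral_primitive_error[OF H T \<eta>m \<eta>N grid_bounds[OF n i]]) (use \<tau> \<epsilon> i in auto)
      thus "\<bar>(\<beta> w i + step_integral (\<lambda>t w'. ?U w t) (\<nu> i) (\<tau> i) (c i) w) - (\<beta> w i + (LINT q:{0<..<grid n i}|lborel. \<eta> w q))\<bar> \<le> \<epsilon> * sqrt (shift_cost H d)"
        by simp
    qed
    hence "L * \<bar>?y1 - ?y2\<bar> \<le> ?err" using fL(1) by (rule mult_left_mono)
    thus ?thesis unfolding \<Phi>2 using fL(2)[of ?y1 ?y2] unfolding y2 by linarith
  qed
  have TV: "\<bar>expectation (\<lambda>w. \<Phi> (\<lambda>j\<in>{..<m}. \<zeta> j w)) - expectation (\<lambda>w. \<Phi> (?sh w))\<bar> \<le> C * sqrt (exp (shift_cost H d) - 1)"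
    by (rule g.shift_total_variation[OF pred energy \<Phi>m]) (simp add: \<Phi>_def fC)
  have "\<bar>expectation (\<lambda>w. \<Phi> (?sh w)) - expectation (\<lambda>w. f (euler (mean_drift n) x (\<beta> w) n))\<bar>
     \<le> ?err"
  proof -
    have i1: "integrable M (\<lambda>w. \<Phi> (?sh w))"
    proof (rule integrable_const_bound[where B=C])
      have "?sh \<in> measurable M (Pi\<^sub>M {..<m} (\<lambda>_. borel))"
        using g.shifted_measurable[OF pred order_refl] measurable_from_subalg[OF g.sub[OF order_refl]] by blast
      from measurable_compose[OF this \<Phi>m] show "(\<lambda>w. \<Phi> (?sh w)) \<in> borel_measurable M" .
    qed (simp add: \<Phi>_def fC)
    have i2: "integrable M (\<lambda>w. f (euler (mean_drift n) x (\<beta> w) n))"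
    proof (rule integrable_const_bound[where B=C])
      have "(\<lambda>w. e w n) \<in> borel_measurable M" using liftM[OF em] by simp
      thus "(\<lambda>w. f (euler (mean_drift n) x (\<beta> w) n)) \<in> borel_measurable M" unfolding e_def by measurable
    qed (simp add: fC)
    define gap where "gap w = \<Phi> (?sh w) - f (euler (mean_drift n) x (\<beta> w) n)" for w
    have ig: "integrable M gap" unfolding gap_def[abs_def] using i1 i2 by auto
    have "\<bar>expectation gap\<bar> \<le> expectation (\<lambda>w. \<bar>gap w\<bar>)" by (rule integral_abs_bound)
    also have "\<dots> \<le> expectation (\<lambda>w. ?err)"
    proof (rule integral_mono)
      show "integrable M (\<lambda>w. \<bar>gap w\<bar>)" using ig by simp
      show "\<bar>gap w\<bar> \<le> ?err" for w
        using dev[of w] by (simp add: gap_def)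
    qed simp
    also have "\<dots> = ?err" by (simp add: prob_space)
    finally show ?thesis using i1 i2 by (simp add: gap_def[abs_def])
  qed
  with TV show ?thesis unfolding \<Phi>1 by linarith
qed

end

section \<open>From Lipschitz test functions to total variation\<close>

text \<open>
  The indicator of a compact set, minus \<open>1/2\<close>, is a limit of Lipschitz functions bounded by \<open>1/2\<close>; this centering yields
  \<open>\<delta> / 2\<close> for compact sets and, by inner regularity, for Borel sets. Integrating over the level sets of \<open>f + c\<close>, whose
  values lie in \<open>{0..2 * c}\<close>, restores the factor \<open>c\<close>.
\<close>

lemma bounded_Lipschitz_imp_total_variation:
  fixes \<mu> \<nu> :: "real measure"
  assumes \<mu>: "prob_space \<mu>" "sets \<mu> = sets borel" and \<nu>: "prob_space \<nu>" "sets \<nu> = sets borel"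
    and Lip: "\<And>f L C. L \<ge> 0 \<Longrightarrow> (\<And>z z'. \<bar>f z - f z'\<bar> \<le> L * \<bar>z - z'\<bar>) \<Longrightarrow> (\<And>z. \<bar>f z\<bar> \<le> C) \<Longrightarrow>
        \<bar>(LINT z|\<mu>. f z) - (LINT z|\<nu>. f z)\<bar> \<le> C * \<delta>"
    and f: "f \<in> borel_measurable borel" "\<And>z. \<bar>f z\<bar> \<le> c"
  shows "(LINT z|\<mu>. f z) - (LINT z|\<nu>. f z) \<le> c * \<delta>"
proof -
  interpret m: prob_space \<mu> by fact
  interpret n: prob_space \<nu> by fact
  note [measurable_cong] = \<mu>(2) \<nu>(2)
  have sp: "space \<mu> = UNIV" "space \<nu> = UNIV" using sets_eq_imp_space_eq[OF \<mu>(2)] sets_eq_imp_space_eq[OF \<nu>(2)] by auto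
  have \<delta>0: "\<delta> \<ge> 0" using Lip[of 0 "\<lambda>_. 0" 1] by simp
  have cpt: "m.prob k \<le> n.prob k + \<delta> / 2" if k: "compact k" for k :: "real set"
  proof (cases "k = {}")
    case True thus ?thesis using \<delta>0 by simp
  next
    case False
    have kb [measurable]: "k \<in> sets borel" using k by (simp add: borel_compact)
    define h where "h j z = max 0 (1 - real j * infdist z k) - 1/2" for j :: nat and z
    have hL: "\<bar>h j z - h j z'\<bar> \<le> real j * \<bar>z - z'\<bar>" for j z z'
    proof -
      have "\<bar>h j z - h j z'\<bar> \<le> \<bar>real j * infdist z k - real j * infdist z' k\<bar>" by (simp add: h_def max_def abs_minus_commute)
      also have "\<dots> = real j * \<bar>infdist z k - infdist z' k\<bar>" by (simp add: abs_mult right_diff_distrib[symmetric])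
      also have "\<dots> \<le> real j * \<bar>z - z'\<bar>"
        using infdist_triangle_abs[of z k z'] by (intro mult_left_mono) (auto simp: dist_real_def)
      finally show ?thesis .
    qed
    have hb: "\<bar>h j z\<bar> \<le> 1/2" for j z
    proof -
      have "\<bar>max 0 (1 - q) - 1/2\<bar> \<le> 1/2" if "0 \<le> q" for q :: real
        using that by (cases "q \<le> 1") (auto simp: max_def abs_real_def)
      from this[of "real j * infdist z k"] show ?thesis by (simp add: h_def infdist_nonneg)
    qed
    have [measurable]: "h j \<in> borel_measurable borel" for j
      unfolding h_def[abs_def] by (intro borel_measurable_continuous_onI continuous_intros)
    have lim: "(\<lambda>j. h j z) \<longlonglongrightarrow> indicator k z - 1/2" for z
    proof (cases "z \<in> k")
      case True thus ?thesis by (simp add: h_def)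
    next
      case z: False
      have "infdist z k > 0" using z k False by (simp add: infdist_pos_not_in_closed compact_imp_closed)
      then obtain J where J: "1 / infdist z k < real J" using reals_Archimedean2 by blast
      have "eventually (\<lambda>j. h j z = indicator k z - 1/2) sequentially"
        unfolding eventually_sequentially
      proof (intro exI allI impI)
        fix j assume "j \<ge> J"
        hence "1 / infdist z k < real j" using J by (meson of_nat_le_iff order_less_le_trans)
        hence "1 < real j * infdist z k" using \<open>infdist z k > 0\<close> by (simp add: field_simps)
        thus "h j z = indicator k z - 1/2" using z by (simp add: h_def)
      qed
      thus ?thesis by (rule tendsto_eventually)
    qed
    have lm: "(\<lambda>j. LINT z|\<mu>. h j z) \<longlonglongrightarrow> (LINT z|\<mu>. indicator k z - 1/2)"
      by (rule integral_dominated_convergence[where w="\<lambda>_. 1/2"]) (use lim hb in auto)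
    have ln: "(\<lambda>j. LINT z|\<nu>. h j z) \<longlonglongrightarrow> (LINT z|\<nu>. indicator k z - 1/2)"
      by (rule integral_dominated_convergence[where w="\<lambda>_. 1/2"]) (use lim hb in auto)
    have "(LINT z|\<mu>. h j z) - (LINT z|\<nu>. h j z) \<le> 1/2 * \<delta>" for j
      by (rule order_trans[OF abs_ge_self Lip[OF _ hL hb]]) simp
    hence "(LINT z|\<mu>. indicator k z - 1/2) - (LINT z|\<nu>. indicator k z - 1/2) \<le> 1/2 * \<delta>"
      by (intro LIMSEQ_le_const2[OF tendsto_diff[OF lm ln]]) auto
    moreover have "integrable \<mu> (indicat_real k)" "integrable \<nu> (indicat_real k)"
      by (rule m.integrable_const_bound[where B=1] n.integrable_const_bound[where B=1]; simp)+
    ultimately show ?thesis using m.prob_space n.prob_space by (simp add: sp)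
  qed
  have bor: "m.prob A \<le> n.prob A + \<delta> / 2" if A: "A \<in> sets borel" for A
  proof (rule field_le_epsilon)
    fix e :: real assume e: "e > 0"
    show "m.prob A \<le> n.prob A + \<delta> / 2 + e"
    proof (cases "m.prob A = 0")
      case True thus ?thesis using e \<delta>0 by (simp add: add_nonneg_nonneg)
    next
      case False
      hence "m.prob A > 0" by (simp add: zero_less_measure_iff)
      hence "ennreal (m.prob A - e) < emeasure \<mu> A"
        unfolding m.emeasure_eq_measure by (rule ennreal_lessI) (use e in simp)
      also have "emeasure \<mu> A = \<Squnion> (emeasure \<mu> ` {K. K \<subseteq> A \<and> compact K})"
        by (rule inner_regular) (use \<mu> A in \<open>auto simp: m.emeasure_eq_measure\<close>)
      finally obtain k where k: "k \<subseteq> A" "compact k" "ennreal (m.prob A - e) < emeasure \<mu> k"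
        by (auto simp: less_SUP_iff)
      have "\<not> m.prob k \<le> m.prob A - e"
        using k(3) ennreal_leI[of "m.prob k" "m.prob A - e"] by (auto simp: m.emeasure_eq_measure)
      hence "m.prob A \<le> m.prob k + e" by simp
      also have "\<dots> \<le> n.prob k + \<delta> / 2 + e" using cpt[OF k(2)] by simp
      also have "n.prob k \<le> n.prob A" by (rule n.finite_measure_mono) (use k A \<nu>(2) in auto)
      finally show ?thesis by simp
    qed
  qed
  have c0: "c \<ge> 0" using f(2)[of 0] by linarith
  note [measurable] = f(1)
  have layer: "(\<integral>\<^sup>+z. ennreal (f z + c) \<partial>\<rho>) = (\<integral>\<^sup>+s. ennreal (measure \<rho> {z. s < f z + c}) * indicator {0..2 * c} s \<partial>lborel)"
    if \<rho>: "prob_space \<rho>" "sets \<rho> = sets borel" for \<rho> :: "real measure"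
  proof -
    let ?i = "\<lambda>z s. if 0 \<le> s \<and> s < f z + c then 1 else (0::ennreal)"
    let ?m = "\<lambda>s. ennreal (measure \<rho> {z. s < f z + c}) * indicator {0..2 * c} s"
    interpret r: prob_space \<rho> by fact
    note [measurable_cong] = \<rho>(2)
    interpret rl: pair_sigma_finite \<rho> lborel ..
    have "(\<integral>\<^sup>+z. ennreal (f z + c) \<partial>\<rho>) = (\<integral>\<^sup>+z. (\<integral>\<^sup>+s. ?i z s \<partial>lborel) \<partial>\<rho>)"
    proof (intro nn_integral_cong)
      fix z
      have "(\<integral>\<^sup>+s. ?i z s \<partial>lborel) = (\<integral>\<^sup>+s. indicator {0..<f z + c} s \<partial>lborel)"
        by (intro nn_integral_cong) (auto simp: indicator_def)
      also have "\<dots> = ennreal (f z + c)" using f(2)[of z] by simp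
      finally show "ennreal (f z + c) = (\<integral>\<^sup>+s. ?i z s \<partial>lborel)" by simp
    qed
    also have "\<dots> = (\<integral>\<^sup>+s. (\<integral>\<^sup>+z. ?i z s \<partial>\<rho>) \<partial>lborel)"
      by (rule rl.Fubini'[symmetric]) measurable
    also have "\<dots> = (\<integral>\<^sup>+s. ?m s \<partial>lborel)"
    proof (intro nn_integral_cong_AE)
      have "AE s in lborel. s \<noteq> 2 * c" by (rule AE_lborel_singleton)
      thus "AE s in lborel. (\<integral>\<^sup>+z. ?i z s \<partial>\<rho>) = ?m s"
      proof eventually_elim
        fix s assume "s \<noteq> 2 * c"
        have "(\<integral>\<^sup>+z. ?i z s \<partial>\<rho>) = (\<integral>\<^sup>+z. indicator {0..} s * indicator {z. s < f z + c} z \<partial>\<rho>)"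
          by (intro nn_integral_cong) (auto simp: indicator_def)
        also have "\<dots> = indicator {0..} s * emeasure \<rho> {z. s < f z + c}"
          by (rule nn_integral_cmult_indicator) measurable
        also have "\<dots> = ?m s"
        proof (cases "s \<le> 2 * c")
          case False
          have "f z \<le> c" for z using f(2)[of z] by simp
          hence "{z. s < f z + c} = {}" using False by (auto simp: not_less intro: order_trans[of "f _ + c" "2 * c"])
          thus ?thesis by simp
        qed (auto simp: r.emeasure_eq_measure indicator_def)
        finally show "(\<integral>\<^sup>+z. ?i z s \<partial>\<rho>) = ?m s" .
      qed
    qed
    finally show ?thesis .
  qed
  have mono_meas: "(\<lambda>s. measure \<rho> {z. s < f z + c}) \<in> borel_measurable borel" if "prob_space \<rho>" "sets \<rho> = sets borel" for \<rho> :: "real measure"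
  proof -
    interpret r: prob_space \<rho> by fact
    have "mono (\<lambda>s. - measure \<rho> {z. s < f z + c})"
      by (intro monoI) (auto intro!: r.finite_measure_mono simp: that)
    from borel_measurable_mono[OF this] show ?thesis by simp
  qed
  note [measurable] = mono_meas[OF \<nu>]
  have "(\<integral>\<^sup>+z. ennreal (f z + c) \<partial>\<mu>) \<le> (\<integral>\<^sup>+s. ennreal (n.prob {z. s < f z + c}) * indicator {0..2 * c} s + ennreal (\<delta> / 2) * indicator {0..2 * c} s \<partial>lborel)"
    unfolding layer[OF \<mu>]
  proof (intro nn_integral_mono)
    fix s :: real
    have "{z. s < f z + c} \<in> sets borel" by measurable
    from bor[OF this] have "ennreal (m.prob {z. s < f z + c}) \<le> ennreal (n.prob {z. s < f z + c}) + ennreal (\<delta> / 2)"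
      using \<delta>0 by (subst ennreal_plus[symmetric]) (auto intro!: ennreal_leI simp del: ennreal_plus)
    thus "ennreal (m.prob {z. s < f z + c}) * indicator {0..2 * c} s \<le> ennreal (n.prob {z. s < f z + c}) * indicator {0..2 * c} s + ennreal (\<delta> / 2) * indicator {0..2 * c} s"
      by (simp add: indicator_def)
  qed
  also have "\<dots> = (\<integral>\<^sup>+z. ennreal (f z + c) \<partial>\<nu>) + ennreal (\<delta> / 2) * ennreal (2 * c)"
    unfolding layer[OF \<nu>] using c0 by (subst nn_integral_add) (auto simp: nn_integral_cmult_indicator)
  finally have le: "(\<integral>\<^sup>+z. ennreal (f z + c) \<partial>\<mu>) \<le> (\<integral>\<^sup>+z. ennreal (f z + c) \<partial>\<nu>) + ennreal (c * \<delta>)"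
    using \<delta>0 c0 by (simp add: ennreal_mult[symmetric] mult.commute)
  have fc: "f z + c \<ge> 0" for z using f(2)[of z] by linarith
  have i: "integrable \<mu> f" "integrable \<nu> f"
    by (rule m.integrable_const_bound[where B=c] n.integrable_const_bound[where B=c]; use f in auto)+
  have "(\<integral>\<^sup>+z. ennreal (f z + c) \<partial>\<mu>) = ennreal (LINT z|\<mu>. f z + c)" "(\<integral>\<^sup>+z. ennreal (f z + c) \<partial>\<nu>) = ennreal (LINT z|\<nu>. f z + c)"
    by (rule nn_integral_eq_integral; use i fc in simp)+
  moreover have "(LINT z|\<nu>. f z + c) \<ge> 0" using fc by (intro Bochner_Integration.integral_nonneg)
  ultimately have "(LINT z|\<mu>. f z + c) \<le> (LINT z|\<nu>. f z + c) + c * \<delta>"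
    using le \<delta>0 c0 by (simp add: ennreal_plus[symmetric] ennreal_le_iff del: ennreal_plus)
  thus ?thesis using i m.prob_space n.prob_space by simp
qed

section \<open>Passage to the limit\<close>

lemma continuous_on_Lipschitz_real:
  fixes f :: "real \<Rightarrow> real"
  assumes "L \<ge> 0" "\<And>z z'. \<bar>f z - f z'\<bar> \<le> L * \<bar>z - z'\<bar>"
  shows "continuous_on A f"
proof (rule lipschitz_on_continuous_on)
  show "L-lipschitz_on A f" by (rule lipschitz_onI) (use assms in \<open>auto simp: dist_real_def\<close>)
qed

text \<open>
  A statement about single paths: the discrete Gronwall inequality, driven by the modulus of continuity of the path.
\<close>

lemma (in lipschitz_drift) euler_converges:
  fixes X \<beta> :: "real \<Rightarrow> real"
  assumes X: "continuous_on {0..T} X"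
    and eq: "\<And>t. t \<in> {0..T} \<Longrightarrow> set_integrable lborel {0..t} (\<lambda>s. b s (X s)) \<and> X t = x + (LINT s:{0..t}|lborel. b s (X s)) + \<beta> t"
  shows "(\<lambda>n. euler (mean_drift (Suc n)) x (\<lambda>i. \<beta> (grid (Suc n) i)) (Suc n)) \<longlonglongrightarrow> X T"
proof (rule LIMSEQ_I)
  fix r :: real assume r: "r > 0"
  define w where "w = r / (2 * exp (K * T))"
  have w: "w > 0" using r by (simp add: w_def)
  have "uniformly_continuous_on {0..T} X" by (rule compact_uniformly_continuous[OF X]) simp
  then obtain \<rho> where \<rho>: "\<rho> > 0" "\<And>s t. s \<in> {0..T} \<Longrightarrow> t \<in> {0..T} \<Longrightarrow> \<bar>s - t\<bar> < \<rho> \<Longrightarrow> \<bar>X s - X t\<bar> < w"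
    using w unfolding uniformly_continuous_on_def dist_real_def by metis
  obtain N where N: "T / \<rho> < real N" using reals_Archimedean2 by blast
  have "norm (euler (mean_drift (Suc n)) x (\<lambda>i. \<beta> (grid (Suc n) i)) (Suc n) - X T) < r" if nN: "n \<ge> N" for n
  proof -
    define m where "m = Suc n"
    have m: "m > 0" by (simp add: m_def)
    have "T / \<rho> < real m" using N nN by (simp add: m_def)
    hence mesh: "T / real m < \<rho>" using \<rho>(1) m by (simp add: field_simps)
    define S where "S i = euler_drift (mean_drift m) x (\<lambda>i. \<beta> (grid m i)) i" for i
    define I where "I t = (LINT s:{0..t}|lborel. b s (X s))" for t
    define E where "E i = euler (mean_drift m) x (\<lambda>i. \<beta> (grid m i)) i" for i
    have XE: "X (grid m i) - E i = I (grid m i) - S i" if "i \<le> m" for i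
      using eq[OF grid_bounds[OF m that]] by (simp add: E_def euler_def I_def S_def)
    have step: "\<bar>I (grid m (Suc i)) - S (Suc i)\<bar> \<le> (1 + K * T / real m) * \<bar>I (grid m i) - S i\<bar> + K * T / real m * w" if i: "i < m" for i
    proof -
      let ?J = "{grid m i<..grid m (Suc i)}"
      have gb: "0 \<le> grid m i" "grid m i \<le> grid m (Suc i)" "grid m (Suc i) \<le> T"
        using grid_bounds[OF m, of i] grid_bounds[OF m, of "Suc i"] grid_mono[of i "Suc i" m] i by auto
      have int: "set_integrable lborel {0..grid m (Suc i)} (\<lambda>s. b s (X s))" using eq[of "grid m (Suc i)"] gb by auto
      have intJ: "set_integrable lborel ?J (\<lambda>s. b s (X s))" by (rule set_integrable_subset[OF int]) (use gb in auto)
      have "I (grid m (Suc i)) - I (grid m i) = (LINT s:?J|lborel. b s (X s))"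
        unfolding I_def by (rule set_integral_Icc_diff[OF int]) (use gb in auto)
      moreover have "S (Suc i) = S i + mean_drift m i (E i)" by (simp add: S_def E_def euler_def)
      ultimately have "(I (grid m (Suc i)) - S (Suc i)) - (I (grid m i) - S i) = (LINT s:?J|lborel. b s (X s)) - (LINT s:?J|lborel. b s (E i))"
        by (simp add: mean_drift_def)
      also have "\<dots> = (LINT s:?J|lborel. b s (X s) - b s (E i))"
        using intJ set_integrable_b by (subst set_integral_diff) auto
      finally have diff: "(I (grid m (Suc i)) - S (Suc i)) - (I (grid m i) - S i) = (LINT s:?J|lborel. b s (X s) - b s (E i))" .
      have "\<bar>LINT s:?J|lborel. b s (X s) - b s (E i)\<bar> \<le> (LINT s:?J|lborel. K * (w + \<bar>I (grid m i) - S i\<bar>))"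
        unfolding set_lebesgue_integral_def
      proof (rule order_trans[OF integral_abs_bound integral_mono])
        show "integrable lborel (\<lambda>s. \<bar>indicat_real ?J s *\<^sub>R (b s (X s) - b s (E i))\<bar>)"
          using set_integral_diff(1)[OF intJ set_integrable_b] by (simp add: set_integrable_def)
        show "integrable lborel (\<lambda>s. indicat_real ?J s *\<^sub>R (K * (w + \<bar>I (grid m i) - S i\<bar>)))"
          by (rule integrableI_bounded_set_indicator[where B="K * (w + \<bar>I (grid m i) - S i\<bar>)"])
            (use K w emeasure_lborel_Ioc_finite in \<open>auto simp: abs_mult\<close>)
        fix s
        show "\<bar>indicat_real ?J s *\<^sub>R (b s (X s) - b s (E i))\<bar> \<le> indicat_real ?J s *\<^sub>R (K * (w + \<bar>I (grid m i) - S i\<bar>))"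
        proof (cases "s \<in> ?J")
          case True
          hence "\<bar>s - grid m i\<bar> < \<rho>" using grid_step[of m i] mesh by auto
          hence "\<bar>X s - X (grid m i)\<bar> < w" by (intro \<rho>(2)) (use True gb in auto)
          hence "\<bar>X s - E i\<bar> \<le> w + \<bar>I (grid m i) - S i\<bar>" using XE[of i] i by linarith
          hence "K * \<bar>X s - E i\<bar> \<le> K * (w + \<bar>I (grid m i) - S i\<bar>)" using K by (intro mult_left_mono) auto
          thus ?thesis using b_Lip[of s "X s" "E i"] True by simp
        qed simp
      qed
      also have "\<dots> = K * T / real m * (w + \<bar>I (grid m i) - S i\<bar>)"
        using gb grid_step[of m i] by (simp add: set_integral_const)
      finally have "\<bar>(I (grid m (Suc i)) - S (Suc i)) - (I (grid m i) - S i)\<bar> \<le> K * T / real m * (w + \<bar>I (grid m i) - S i\<bar>)"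
        unfolding diff .
      hence "\<bar>I (grid m (Suc i)) - S (Suc i)\<bar> \<le> \<bar>I (grid m i) - S i\<bar> + K * T / real m * (w + \<bar>I (grid m i) - S i\<bar>)" by linarith
      thus ?thesis by (simp add: algebra_simps)
    qed
    have "I 0 = 0"
    proof -
      have "AE s in lborel. indicat_real {0..0} s *\<^sub>R b s (X s) = 0"
        using AE_lborel_singleton[of "0::real"] by eventually_elim auto
      thus ?thesis unfolding I_def set_lebesgue_integral_def by (rule integral_eq_zero_AE)
    qed
    hence start: "\<bar>I (grid m 0) - S 0\<bar> \<le> 0" by (simp add: S_def)
    have \<kappa>: "K * T / real m \<ge> 0" using K T by simp
    have "\<bar>I (grid m m) - S m\<bar> \<le> w * ((1 + K * T / real m) ^ m - 1)"
      by (rule discrete_Gronwall[where e="\<lambda>i. \<bar>I (grid m i) - S i\<bar>" and n=m, OF \<kappa> start step]) auto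
    also have "\<dots> \<le> w * exp (K * T)"
      using one_plus_power_le_exp[OF \<kappa>, of m] w m by (intro mult_left_mono) auto
    also have "\<dots> < r" using r by (simp add: w_def)
    finally have "\<bar>X (grid m m) - E m\<bar> < r" using XE[of m] by simp
    thus ?thesis using grid_n[OF m] by (simp add: m_def E_def abs_minus_commute)
  qed
  thus "\<exists>no. \<forall>n\<ge>no. norm (euler (mean_drift (Suc n)) x (\<lambda>i. \<beta> (grid (Suc n) i)) (Suc n) - X T) < r" by blast
qed

context fractional_equation
begin

text \<open>
  The bound for step functions exceeds this one by a multiple of their \<open>L\<^sup>2\<close> error, which tends to \<open>0\<close> on a fixed grid; so does the
  cost of putting back the noise itself.
\<close>

lemma noise_coupling:
  assumes n: "n > 0"
    and f [measurable]: "f \<in> borel_measurable borel" and fC: "\<And>z. \<bar>f z\<bar> \<le> C" and fL: "L \<ge> 0" "\<And>z z'. \<bar>f z - f z'\<bar> \<le> L * \<bar>z - z'\<bar>"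
  shows "\<bar>(LINT w|M. f (euler (mean_drift n) (x + d) (\<lambda>i. B (grid n i) w) n)) - (LINT w|M. f (euler (mean_drift n) x (\<lambda>i. B (grid n i) w) n))\<bar>
     \<le> C * sqrt (exp (shift_cost H d) - 1)"
proof -
  define good where "good i \<nu> \<tau> c \<longleftrightarrow>
        (\<forall>k. \<forall>j\<le>\<nu> k. \<tau> k j \<in> {0..grid n i}) \<and>
        (\<forall>k. \<forall>j<\<nu> k. \<tau> k j \<le> \<tau> k (Suc j)) \<and>
        (\<lambda>k. \<integral>\<^sup>+s\<in>{0..grid n i}. ennreal ((K_H H (grid n i) s - step_fun (\<nu> k) (\<tau> k) (c k) s)\<^sup>2) \<partial>lborel) \<longlonglongrightarrow> 0 \<and>
        (\<lambda>k. \<integral>\<^sup>+\<omega>. ennreal ((B (grid n i) \<omega> - step_integral W (\<nu> k) (\<tau> k) (c k) \<omega>)\<^sup>2) \<partial>M) \<longlonglongrightarrow> 0"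
    for i and \<nu> :: "nat \<Rightarrow> nat" and \<tau> c :: "nat \<Rightarrow> nat \<Rightarrow> real"
  have wi: "has_wiener_integral M W (grid n i) (K_H H (grid n i)) (B (grid n i))" if "i \<le> n" for i
    using B grid_bounds[OF n that] by (simp add: fractional_brownian_motion_def)
  have Bm: "B (grid n i) \<in> borel_measurable M" if "i \<le> n" for i using wi[OF that] by (simp add: has_wiener_integral_def)
  have "\<exists>p. i \<le> n \<longrightarrow> good i (fst p) (fst (snd p)) (snd (snd p))" for i
  proof (cases "i \<le> n")
    case True
    then obtain \<nu> \<tau> c where "good i \<nu> \<tau> c"
      using wi[OF True] unfolding has_wiener_integral_def good_def by blast
    thus ?thesis by (intro exI[of _ "(\<nu>, \<tau>, c)"]) simp
  qed simp
  then obtain p where p: "\<And>i. i \<le> n \<Longrightarrow> good i (fst (p i)) (fst (snd (p i))) (snd (snd (p i)))"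
    using choice[of "\<lambda>i p. i \<le> n \<longrightarrow> good i (fst p) (fst (snd p)) (snd (snd p))"] by blast
  define \<nu> where "\<nu> i = fst (p i)" for i
  define \<tau> where "\<tau> i = fst (snd (p i))" for i
  define c where "c i = snd (snd (p i))" for i
  have G: "good i (\<nu> i) (\<tau> i) (c i)" if "i \<le> n" for i using p[OF that] by (simp add: \<nu>_def \<tau>_def c_def)
  define E where "E z \<beta> = euler (mean_drift n) z \<beta> n" for z \<beta>
  define D where "D = L * exp (K * T) * sqrt (shift_cost H d) + 2 * (L * (exp (K * T) * real (Suc n)))"
  have D0: "D \<ge> 0" using fL H by (simp add: D_def shift_cost_def energy_bound_def)
  let ?Bv = "\<lambda>w i. B (grid n i) w"
  have bound: "\<bar>(LINT w|M. f (E (x + d) (?Bv w))) - (LINT w|M. f (E x (?Bv w)))\<bar> \<le> C * sqrt (exp (shift_cost H d) - 1) + D * \<epsilon>"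
    if \<epsilon>: "\<epsilon> > 0" for \<epsilon>
  proof -
    let ?e1 = "\<lambda>i k. \<integral>\<^sup>+s\<in>{0..grid n i}. ennreal ((K_H H (grid n i) s - step_fun (\<nu> i k) (\<tau> i k) (c i k) s)\<^sup>2) \<partial>lborel"
    let ?e2 = "\<lambda>i k. \<integral>\<^sup>+\<omega>. ennreal ((B (grid n i) \<omega> - step_integral W (\<nu> i k) (\<tau> i k) (c i k) \<omega>)\<^sup>2) \<partial>M"
    have pos: "(0::ennreal) < ennreal (\<epsilon>\<^sup>2)" using \<epsilon> by simp
    have "eventually (\<lambda>k. ?e1 i k < ennreal (\<epsilon>\<^sup>2) \<and> ?e2 i k < ennreal (\<epsilon>\<^sup>2)) sequentially"
      if i: "i \<in> {..n}" for i
      using G[of i] i order_tendstoD(2)[OF _ pos] unfolding good_def by (intro eventually_conj) auto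
    hence "eventually (\<lambda>k. \<forall>i\<in>{..n}. ?e1 i k < ennreal (\<epsilon>\<^sup>2) \<and> ?e2 i k < ennreal (\<epsilon>\<^sup>2)) sequentially"
      by (intro eventually_ball_finite) auto
    then obtain k where k: "\<And>i. i \<le> n \<Longrightarrow> ?e1 i k \<le> ennreal (\<epsilon>\<^sup>2)"
      "\<And>i. i \<le> n \<Longrightarrow> ?e2 i k \<le> ennreal (\<epsilon>\<^sup>2)"
      unfolding eventually_sequentially by (meson atMost_iff less_imp_le order_refl)
    define \<beta> where "\<beta> w i = step_integral W (\<nu> i k) (\<tau> i k) (c i k) w" for w i
    let ?\<Delta> = "\<lambda>i w. \<bar>\<beta> w i - B (grid n i) w\<bar>"
    have \<tau>1: "\<tau> i k j \<in> {0..grid n i}" if "i \<le> n" "j \<le> \<nu> i k" for i j using G[OF that(1)] that unfolding good_def by blast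
    have \<tau>2: "\<tau> i k j \<le> \<tau> i k (Suc j)" if "i \<le> n" "j < \<nu> i k" for i j using G[OF that(1)] that unfolding good_def by blast
    have main: "\<bar>(LINT w|M. f (E (x + d) (\<beta> w))) - (LINT w|M. f (E x (\<beta> w)))\<bar>
      \<le> C * sqrt (exp (shift_cost H d) - 1) + L * (exp (K * T) * (\<epsilon> * sqrt (shift_cost H d)))"
      unfolding E_def \<beta>_def
      by (rule step_approximation_coupling[OF n, of "\<lambda>i. \<nu> i k" "\<lambda>i. \<tau> i k" \<epsilon> "\<lambda>i. c i k", OF \<tau>1 \<tau>2 _ k(1) f fC fL])
        (use \<epsilon> in auto)
    have \<beta>m: "(\<lambda>w. \<beta> w i) \<in> borel_measurable M" if i: "i \<le> n" for i
      unfolding \<beta>_def step_integral_def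
    proof (intro borel_measurable_sum borel_measurable_times borel_measurable_const borel_measurable_diff)
      have Wm: "W t \<in> borel_measurable M" if "t \<in> {0..T}" for t
        using W sp that measurable_from_subalg[of M "\<F> t" "W t" borel] by (simp add: wiener_process_def filtered_prob_space_def)
      fix j assume "j \<in> {..<\<nu> i k}"
      thus "W (\<tau> i k (Suc j)) \<in> borel_measurable M" "W (\<tau> i k j) \<in> borel_measurable M"
        using \<tau>1[of i j] \<tau>1[of i "Suc j"] i grid_bounds[OF n i] by (auto intro!: Wm)
    qed
    have L1: "integrable M (?\<Delta> i)" "expectation (?\<Delta> i) \<le> \<epsilon>" if i: "i \<le> n" for i
    proof -
      define g where "g w = ?\<Delta> i w" for w
      have gm [measurable]: "g \<in> borel_measurable M" unfolding g_def[abs_def] using \<beta>m[OF i] Bm[OF i] by measurable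
      have le: "(\<integral>\<^sup>+w. ennreal ((g w)\<^sup>2) \<partial>M) \<le> ennreal (\<epsilon>\<^sup>2)"
        using k(2)[OF i] by (simp add: g_def \<beta>_def power2_commute)
      have ig2: "integrable M (\<lambda>w. (g w)\<^sup>2)"
        by (rule integrableI_bounded) (use le in \<open>auto intro: le_less_trans\<close>)
      have g2: "expectation (\<lambda>w. (g w)\<^sup>2) \<le> \<epsilon>\<^sup>2" using le nn_integral_eq_integral[OF ig2] by (simp add: ennreal_le_iff)
      have "integrable M (\<lambda>w. g w * 1)" "(expectation (\<lambda>w. g w * 1))\<^sup>2 \<le> expectation (\<lambda>w. (g w)\<^sup>2) * expectation (\<lambda>w. 1\<^sup>2)"
        by (rule integral_Cauchy_Schwarz[OF gm _ ig2]; simp)+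
      hence "integrable M g" "(expectation g)\<^sup>2 \<le> \<epsilon>\<^sup>2" using g2 by (simp_all add: prob_space)
      thus "integrable M (?\<Delta> i)" "expectation (?\<Delta> i) \<le> \<epsilon>"
        using \<epsilon> power2_le_imp_le[of "expectation g" \<epsilon>] by (simp_all add: g_def[abs_def])
    qed
    \<comment> \<open>Replacing the noise by its approximation costs its mean error at each of the grid points.\<close>
    have close: "\<bar>expectation (\<lambda>w. f (E z (\<beta> w))) - expectation (\<lambda>w. f (E z (?Bv w)))\<bar> \<le> L * (exp (K * T) * real (Suc n)) * \<epsilon>" for z
    proof -
      have mE: "(\<lambda>w. E z (\<beta> w)) \<in> borel_measurable M" "(\<lambda>w. E z (?Bv w)) \<in> borel_measurable M"
        unfolding E_def by (rule euler_measurable[OF mean_drift_measurable]; use \<beta>m Bm in auto)+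
      have iE: "integrable M (\<lambda>w. f (E z (\<beta> w)))" "integrable M (\<lambda>w. f (E z (?Bv w)))"
        using mE by (auto intro!: integrable_const_bound[where B=C] simp: fC)
      have pt: "\<bar>f (E z (\<beta> w)) - f (E z (?Bv w))\<bar> \<le> L * (exp (K * T) * (\<Sum>i\<le>n. ?\<Delta> i w))" for w
      proof -
        have "\<bar>E z (\<beta> w) - E z (?Bv w)\<bar> \<le> exp (K * T) * (\<Sum>i\<le>n. ?\<Delta> i w)"
          unfolding E_def
        proof (rule euler_Lipschitz[OF n])
          show "?\<Delta> i w \<le> (\<Sum>i\<le>n. ?\<Delta> i w)" if "i \<le> n" for i
            by (rule member_le_sum[of i "{..n}" "\<lambda>i. ?\<Delta> i w"]) (use that in auto)
        qed
        thus ?thesis using fL(2)[of "E z (\<beta> w)" "E z (?Bv w)"] mult_left_mono[OF _ fL(1)] by (meson order_trans)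
      qed
      have "\<bar>expectation (\<lambda>w. f (E z (\<beta> w))) - expectation (\<lambda>w. f (E z (?Bv w)))\<bar>
         = \<bar>expectation (\<lambda>w. f (E z (\<beta> w)) - f (E z (?Bv w)))\<bar>" using iE by simp
      also have "\<dots> \<le> expectation (\<lambda>w. \<bar>f (E z (\<beta> w)) - f (E z (?Bv w))\<bar>)" by (rule integral_abs_bound)
      also have "\<dots> \<le> expectation (\<lambda>w. L * (exp (K * T) * (\<Sum>i\<le>n. ?\<Delta> i w)))"
      proof (rule integral_mono)
        show "integrable M (\<lambda>w. \<bar>f (E z (\<beta> w)) - f (E z (?Bv w))\<bar>)" using iE by auto
        show "integrable M (\<lambda>w. L * (exp (K * T) * (\<Sum>i\<le>n. ?\<Delta> i w)))"
          using L1(1) by (intro integrable_mult_right Bochner_Integration.integrable_sum) auto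
      qed (rule pt)
      also have "\<dots> = L * (exp (K * T) * (\<Sum>i\<le>n. expectation (?\<Delta> i)))"
        using L1(1) by (simp add: Bochner_Integration.integral_sum)
      also have "\<dots> \<le> L * (exp (K * T) * (\<Sum>i\<le>n. \<epsilon>))"
        using L1(2) fL(1) by (intro mult_left_mono sum_mono) auto
      finally show ?thesis by (simp add: mult_ac)
    qed
    show ?thesis using main close[of "x + d"] close[of x] unfolding D_def by (simp add: algebra_simps abs_le_iff)
  qed
  have "\<bar>(LINT w|M. f (E (x + d) (?Bv w))) - (LINT w|M. f (E x (?Bv w)))\<bar> \<le> C * sqrt (exp (shift_cost H d) - 1)"
  proof (rule field_le_epsilon)
    fix e :: real assume e: "e > 0"
    have "D * (e / (D + 1)) \<le> e" using D0 e by (simp add: field_simps)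
    thus "\<bar>(LINT w|M. f (E (x + d) (?Bv w))) - (LINT w|M. f (E x (?Bv w)))\<bar> \<le> C * sqrt (exp (shift_cost H d) - 1) + e"
      using bound[of "e / (D + 1)"] D0 e by simp
  qed
  thus ?thesis unfolding E_def .
qed

lemma solution_measurable [measurable]: "X z T \<in> borel_measurable M"
proof -
  have "X z T \<in> borel_measurable (\<F> T)" using X[of z] T by (simp add: is_solution_def)
  thus ?thesis using sp measurable_from_subalg[of M "\<F> T"] by (auto simp: filtered_prob_space_def)
qed

lemma solution_coupling:
  assumes fC: "\<And>z. \<bar>f z\<bar> \<le> C" and fL: "L \<ge> 0" "\<And>z z'. \<bar>f z - f z'\<bar> \<le> L * \<bar>z - z'\<bar>"
  shows "\<bar>(LINT w|M. f (X x T w)) - (LINT w|M. f (X y T w))\<bar> \<le> C * sqrt (exp (shift_cost H (x - y)) - 1)"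
proof -
  have cont: "continuous_on UNIV f" using fL by (rule continuous_on_Lipschitz_real)
  hence f [measurable]: "f \<in> borel_measurable borel" by (rule borel_measurable_continuous_onI)
  define E where "E z n w = euler (mean_drift (Suc n)) z (\<lambda>i. B (grid (Suc n) i) w) (Suc n)" for z n w
  have Bm: "B t \<in> borel_measurable M" if "t \<in> {0..T}" for t
    using B that by (simp add: fractional_brownian_motion_def has_wiener_integral_def)
  have Em [measurable]: "E z n \<in> borel_measurable M" for z n
    unfolding E_def[abs_def]
    by (rule euler_measurable[OF mean_drift_measurable]) (auto intro!: Bm grid_bounds[unfolded atLeastAtMost_iff])
  have lim: "(\<lambda>n. expectation (\<lambda>w. f (E z n w))) \<longlonglongrightarrow> expectation (\<lambda>w. f (X z T w))" for z
  proof (rule integral_dominated_convergence[where w="\<lambda>_. C"])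
    have "AE w in M. continuous_on {0..T} (\<lambda>t. X z t w)"
      "AE w in M. \<forall>t\<in>{0..T}. set_integrable lborel {0..t} (\<lambda>s. b s (X z s w)) \<and> X z t w = z + (LINT s:{0..t}|lborel. b s (X z s w)) + B t w"
      using X[of z] unfolding is_solution_def by blast+
    thus "AE w in M. (\<lambda>n. f (E z n w)) \<longlonglongrightarrow> f (X z T w)"
    proof eventually_elim
      fix w assume 1: "continuous_on {0..T} (\<lambda>t. X z t w)" and 2: "\<forall>t\<in>{0..T}. set_integrable lborel {0..t} (\<lambda>s. b s (X z s w)) \<and> X z t w = z + (LINT s:{0..t}|lborel. b s (X z s w)) + B t w"
      have "(\<lambda>n. E z n w) \<longlonglongrightarrow> X z T w"
        unfolding E_def by (rule euler_converges[OF 1, of z "\<lambda>t. B t w"]) (use 2 in blast)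
      thus "(\<lambda>n. f (E z n w)) \<longlonglongrightarrow> f (X z T w)"
        by (intro continuous_on_tendsto_compose[OF cont]) auto
    qed
  qed (auto simp: fC)
  have "\<bar>expectation (\<lambda>w. f (E x n w)) - expectation (\<lambda>w. f (E y n w))\<bar> \<le> C * sqrt (exp (shift_cost H (x - y)) - 1)" for n
    using noise_coupling[OF _ f fC fL, of "Suc n" y "x - y"] by (simp add: E_def)
  thus ?thesis
    by (intro LIMSEQ_le_const2[OF tendsto_rabs[OF tendsto_diff[OF lim lim]]]) auto
qed

lemma solution_total_variation:
  assumes f: "f \<in> borel_measurable borel" "\<And>z. \<bar>f z\<bar> \<le> c"
  shows "transition_op M X T f x - transition_op M X T f y \<le> c * sqrt (exp (shift_cost H (x - y)) - 1)"
proof -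
  have "(LINT z|distr M borel (X x T). f z) - (LINT z|distr M borel (X y T). f z) \<le> c * sqrt (exp (shift_cost H (x - y)) - 1)"
  proof (rule bounded_Lipschitz_imp_total_variation[OF _ _ _ _ _ f])
    show "prob_space (distr M borel (X x T))" "prob_space (distr M borel (X y T))" by (auto intro: prob_space_distr)
    fix g :: "real \<Rightarrow> real" and L C :: real
    assume g: "L \<ge> 0" "\<And>z z'. \<bar>g z - g z'\<bar> \<le> L * \<bar>z - z'\<bar>" "\<And>z. \<bar>g z\<bar> \<le> C"
    have "continuous_on UNIV g" using g(1,2) by (rule continuous_on_Lipschitz_real)
    hence "g \<in> borel_measurable borel" by (rule borel_measurable_continuous_onI)
    thus "\<bar>(LINT z|distr M borel (X x T). g z) - (LINT z|distr M borel (X y T). g z)\<bar> \<le> C * sqrt (exp (shift_cost H (x - y)) - 1)"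
      using solution_coupling[OF g(3,1,2), of x y] by (simp add: integral_distr)
  qed simp_all
  thus ?thesis using f(1) by (simp add: integral_distr transition_op_def)
qed

end

theorem proposition3p3:
  fixes M :: "'w measure" and \<F> :: "real \<Rightarrow> 'w measure"
    and H T K :: real
    and W B :: "real \<Rightarrow> 'w \<Rightarrow> real"
    and b :: "real \<Rightarrow> real \<Rightarrow> real"
    and X :: "real \<Rightarrow> real \<Rightarrow> 'w \<Rightarrow> real"
  assumes H: "0 < H" "H < 1 / 2" and T: "T > 0"
    and space: "filtered_prob_space M \<F>"
    and W: "wiener_process M \<F> T W"
    and B: "fractional_brownian_motion M H T W B"
    and b_meas: "(\<lambda>(t, x). b t x) \<in> borel_measurable (restrict_space borel ({0..T} \<times> (UNIV :: real set)))"
    and K: "K > 0"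
    and b_Lipschitz: "\<And>t x y. t \<in> {0..T} \<Longrightarrow> \<bar>b t x - b t y\<bar> \<le> K * \<bar>x - y\<bar>"
    and b_bounded: "bounded ((\<lambda>t. b t 0) ` {0..T})"
    and X: "\<And>x. is_solution M \<F> T b B x (X x)"
  shows "strong_Feller (transition_op M X T) \<and>
    (\<forall>x y f. f \<in> borel_measurable borel \<and> bounded (range f) \<longrightarrow>
       \<bar>transition_op M X T f x - transition_op M X T f y\<bar>
         \<le> sup_norm f * sqrt (2 * Harnack_const T K H) * \<bar>x - y\<bar> *
           exp (Harnack_const T K H * \<bar>x - y\<bar>\<^sup>2))"
proof -
  interpret prob_space M using space by (simp add: filtered_prob_space_def)
  \<comment> \<open>The equation only sees the drift on \<open>{0..T}\<close>, so extending it by zero keeps all solutions.\<close>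
  define b' where "b' t x = (if t \<in> {0..T} then b t x else 0)" for t x
  obtain \<beta>0 where "\<forall>y\<in>(\<lambda>t. b t 0) ` {0..T}. norm y \<le> \<beta>0" using b_bounded unfolding bounded_iff ..
  hence \<beta>0: "\<bar>b t 0\<bar> \<le> \<beta>0" if "t \<in> {0..T}" for t using that by force
  interpret d: lipschitz_drift b' K T "\<bar>\<beta>0\<bar>"
  proof
    have "(\<lambda>z. indicator ({0..T} \<times> UNIV) z *\<^sub>R (case z of (t, x) \<Rightarrow> b t x)) \<in> borel_measurable borel"
      using b_meas by (subst borel_measurable_restrict_space_iff[symmetric]) (auto intro!: borel_closed closed_Times)
    also have "(\<lambda>z. indicator ({0..T} \<times> UNIV) z *\<^sub>R (case z of (t, x) \<Rightarrow> b t x)) = (\<lambda>(t, x). b' t x)"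
      by (auto simp: b'_def indicator_def)
    finally show "(\<lambda>(t, x). b' t x) \<in> borel_measurable (borel \<Otimes>\<^sub>M borel)" by (simp add: borel_prod)
    show "\<bar>b' t x - b' t y\<bar> \<le> K * \<bar>x - y\<bar>" for t x y using b_Lipschitz[of t x y] K by (simp add: b'_def)
    show "\<bar>b' t 0\<bar> \<le> \<bar>\<beta>0\<bar>" for t by (auto simp: b'_def intro: order_trans[OF \<beta>0 abs_ge_self])
  qed (use K T in auto)
  have eqi: "set_integrable lborel {0..t} (\<lambda>s. b' s (z s)) = set_integrable lborel {0..t} (\<lambda>s. b s (z s))"
    "(LINT s:{0..t}|lborel. b' s (z s)) = (LINT s:{0..t}|lborel. b s (z s))" if "t \<in> {0..T}" for t and z :: "real \<Rightarrow> real"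
    using that unfolding set_integrable_def set_lebesgue_integral_def
    by (auto simp: b'_def indicator_def intro!: Bochner_Integration.integrable_cong Bochner_Integration.integral_cong)
  have X': "is_solution M \<F> T b' B x (X x)" for x
  proof -
    have "(\<forall>t\<in>{0..T}. set_integrable lborel {0..t} (\<lambda>s. b' s (X x s \<omega>)) \<and>
          X x t \<omega> = x + (LINT s:{0..t}|lborel. b' s (X x s \<omega>)) + B t \<omega>) \<longleftrightarrow>
       (\<forall>t\<in>{0..T}. set_integrable lborel {0..t} (\<lambda>s. b s (X x s \<omega>)) \<and>
          X x t \<omega> = x + (LINT s:{0..t}|lborel. b s (X x s \<omega>)) + B t \<omega>)" for \<omega>
      by (intro ball_cong refl) (simp only: eqi)
    note eqs = this
    show ?thesis using X[of x] unfolding is_solution_def eqs .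
  qed
  interpret e: fractional_equation b' K T "\<bar>\<beta>0\<bar>" M \<F> H W B X
    by unfold_locales (fact H space W B X')+
  let ?C = "Harnack_const T K H"
  have C0: "?C \<ge> 0" using H by (simp add: Harnack_const_def)
  have est: "\<bar>transition_op M X T f x - transition_op M X T f y\<bar> \<le> sup_norm f * sqrt (2 * ?C) * \<bar>x - y\<bar> * exp (?C * \<bar>x - y\<bar>\<^sup>2)"
    if f: "f \<in> borel_measurable borel" "bounded (range f)" for x y f
  proof -
    have fs: "\<bar>f z\<bar> \<le> sup_norm f" for z
      unfolding sup_norm_def
    proof (rule cSUP_upper)
      obtain a where a: "\<And>z. \<bar>f z\<bar> \<le> a" using f(2) unfolding bounded_iff by auto
      show "bdd_above (range (\<lambda>x. \<bar>f x\<bar>))" by (rule bdd_aboveI2[where M=a]) (rule a)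
    qed simp
    have s0: "sup_norm f \<ge> 0" using fs[of 0] by linarith
    let ?A = "d.shift_cost H (x - y)"
    have A: "?A = 2 * ?C * (x - y)\<^sup>2" by (rule d.shift_cost_eq[OF H(2)])
    have "d.shift_cost H (y - x) = ?A" by (simp add: d.shift_cost_eq[OF H(2)] power2_commute)
    hence "\<bar>transition_op M X T f x - transition_op M X T f y\<bar> \<le> sup_norm f * sqrt (exp ?A - 1)"
      using e.solution_total_variation[OF f(1) fs, of x y] e.solution_total_variation[OF f(1) fs, of y x]
      by (simp add: abs_le_iff)
    also have "\<dots> \<le> sup_norm f * (sqrt (2 * ?C) * \<bar>x - y\<bar> * exp (?C * \<bar>x - y\<bar>\<^sup>2))"
    proof (rule mult_left_mono[OF _ s0])
      have "exp ?A - 1 \<le> ?A * exp ?A"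
      proof -
        have "1 - ?A \<le> exp (- ?A)" using exp_ge_add_one_self[of "- ?A"] by simp
        hence "(1 - ?A) * exp ?A \<le> exp (- ?A) * exp ?A" by (intro mult_right_mono) auto
        thus ?thesis by (simp add: exp_minus algebra_simps)
      qed
      also have "\<dots> = (sqrt (2 * ?C) * \<bar>x - y\<bar> * exp (?C * \<bar>x - y\<bar>\<^sup>2))\<^sup>2"
        using C0 by (simp add: A power_mult_distrib exp_double[symmetric] mult_ac)
      finally have "sqrt (exp ?A - 1) \<le> sqrt ((sqrt (2 * ?C) * \<bar>x - y\<bar> * exp (?C * \<bar>x - y\<bar>\<^sup>2))\<^sup>2)" by (rule real_sqrt_le_mono)
      thus "sqrt (exp ?A - 1) \<le> sqrt (2 * ?C) * \<bar>x - y\<bar> * exp (?C * \<bar>x - y\<bar>\<^sup>2)"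
        using C0 by (simp add: abs_mult)
    qed
    finally show ?thesis by (simp add: mult_ac)
  qed
  have "strong_Feller (transition_op M X T)"
    unfolding strong_Feller_def
  proof (intro allI impI, elim conjE)
    fix f :: "real \<Rightarrow> real" assume f: "f \<in> borel_measurable borel" "bounded (range f)"
    obtain a where a: "\<And>z. \<bar>f z\<bar> \<le> a" using f(2) unfolding bounded_iff by auto
    have "\<bar>transition_op M X T f x\<bar> \<le> a" for x
    proof (cases "integrable M (\<lambda>w. f (X x T w))")
      case True
      have "\<bar>transition_op M X T f x\<bar> \<le> expectation (\<lambda>w. \<bar>f (X x T w)\<bar>)" unfolding transition_op_def by (rule integral_abs_bound)
      also have "\<dots> \<le> expectation (\<lambda>w. a)" by (rule integral_mono) (use True a in auto)
      finally show ?thesis by (simp add: prob_space)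
    next
      case False
      thus ?thesis using a[of 0] by (simp add: transition_op_def not_integrable_integral_eq)
    qed
    hence "bounded (range (transition_op M X T f))" unfolding bounded_iff by auto
    moreover have "isCont (transition_op M X T f) x" for x
    proof -
      have "((\<lambda>y. sup_norm f * sqrt (2 * ?C) * \<bar>y - x\<bar> * exp (?C * \<bar>y - x\<bar>\<^sup>2)) \<longlongrightarrow> sup_norm f * sqrt (2 * ?C) * \<bar>x - x\<bar> * exp (?C * \<bar>x - x\<bar>\<^sup>2)) (at x)"
        by (intro tendsto_intros)
      hence "((\<lambda>y. sup_norm f * sqrt (2 * ?C) * \<bar>y - x\<bar> * exp (?C * \<bar>y - x\<bar>\<^sup>2)) \<longlongrightarrow> 0) (at x)" by simp
      hence "((\<lambda>y. transition_op M X T f y - transition_op M X T f x) \<longlongrightarrow> 0) (at x)"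
      proof (rule Lim_null_comparison[rotated], intro always_eventually allI)
        show "norm (transition_op M X T f y - transition_op M X T f x) \<le> sup_norm f * sqrt (2 * ?C) * \<bar>y - x\<bar> * exp (?C * \<bar>y - x\<bar>\<^sup>2)" for y
          using est[OF f, of y x] by simp
      qed
      thus ?thesis unfolding isCont_def by (simp add: LIM_zero_iff)
    qed
    ultimately show "bounded (range (transition_op M X T f)) \<and> continuous_on UNIV (transition_op M X T f)"
      by (simp add: continuous_at_imp_continuous_on)
  qed
  thus ?thesis using est by blast
qed

end
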